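(* For every integer $n\ge 3$ the group $\operatorname{SL}(n,\mathbb{Z})$ is strongly bounded but not uniformly bounded.
   Context: A subset $S$ of a group $G$ normally generates $G$ if the normal subgroup of $G$ generated by $S$ is $G$; $G$ is finitely normally generated if some finite $S$ normally generates it. For such $S$, $\|g\|_S$ is the least $m\ge 0$ such that $g$ is a product of $m$ conjugates in $G$ of elements of $S$ and their inverses, and $\|G\|_S=\sup_{g\in G}\|g\|_S$. Set $\Delta_k(G)=\sup\{\|G\|_S : S \text{ normally generates } G,\ |S|\le k\}$ (with $\sup\emptyset=-\infty$) and $\Delta(G)=\sup\{\|G\|_S : S \text{ finite, normally generates } G\}$. A finitely normally generated group $G$ is strongly bounded if $\Delta_k(G)<\infty$ for all $k\ge 1$, and uniformly bounded if $\Delta(G)<\infty$. *)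

theory Defs
  imports
    "HOL-Algebra.Coset"
    "HOL-Library.Extended_Real"
    "Jordan_Normal_Form.Determinant"
begin

definition normal_closure :: "('a, 'b) monoid_scheme \<Rightarrow> 'a set \<Rightarrow> 'a set"
  where "normal_closure G S = \<Inter>{N. N \<lhd> G \<and> S \<subseteq> N}"

definition normally_generates :: "('a, 'b) monoid_scheme \<Rightarrow> 'a set \<Rightarrow> bool"
  where "normally_generates G S \<longleftrightarrow> S \<subseteq> carrier G \<and> normal_closure G S = carrier G"

definition finitely_normally_generated :: "('a, 'b) monoid_scheme \<Rightarrow> bool"
  where "finitely_normally_generated G \<longleftrightarrow>
    group G \<and> (\<exists>S. finite S \<and> normally_generates G S)"

definition sym_conjugates :: "('a, 'b) monoid_scheme \<Rightarrow> 'a set \<Rightarrow> 'a set"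
  where "sym_conjugates G S =
    {x \<otimes>\<^bsub>G\<^esub> t \<otimes>\<^bsub>G\<^esub> inv\<^bsub>G\<^esub> x | x t. x \<in> carrier G \<and> t \<in> S \<union> (\<lambda>s. inv\<^bsub>G\<^esub> s) ` S}"

text \<open>If no such product equals \<open>g\<close>, the infimum is over the empty set and the norm is \<open>\<infinity>\<close>;
  this does not happen when \<open>S\<close> normally generates \<open>G\<close> and \<open>g\<close> is in \<open>G\<close>.\<close>

definition conj_norm :: "('a, 'b) monoid_scheme \<Rightarrow> 'a set \<Rightarrow> 'a \<Rightarrow> ereal"
  where "conj_norm G S g =
    Inf {ereal (real (length cs)) | cs.
      set cs \<subseteq> sym_conjugates G S \<and> foldr (\<otimes>\<^bsub>G\<^esub>) cs \<one>\<^bsub>G\<^esub> = g}"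

definition conj_diameter :: "('a, 'b) monoid_scheme \<Rightarrow> 'a set \<Rightarrow> ereal"
  where "conj_diameter G S = (SUP g\<in>carrier G. conj_norm G S g)"

text \<open>In \<^typ>\<open>ereal\<close> the supremum of the empty set is \<open>-\<infinity>\<close>.\<close>

definition Delta_upto :: "nat \<Rightarrow> ('a, 'b) monoid_scheme \<Rightarrow> ereal"
  where "Delta_upto k G =
    (SUP S\<in>{S. finite S \<and> card S \<le> k \<and> normally_generates G S}. conj_diameter G S)"

definition Delta :: "('a, 'b) monoid_scheme \<Rightarrow> ereal"
  where "Delta G = (SUP S\<in>{S. finite S \<and> normally_generates G S}. conj_diameter G S)"

definition strongly_bounded :: "('a, 'b) monoid_scheme \<Rightarrow> bool"
  where "strongly_bounded G \<longleftrightarrow>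
    finitely_normally_generated G \<and> (\<forall>k\<ge>1. Delta_upto k G < \<infinity>)"

definition uniformly_bounded :: "('a, 'b) monoid_scheme \<Rightarrow> bool"
  where "uniformly_bounded G \<longleftrightarrow> finitely_normally_generated G \<and> Delta G < \<infinity>"

definition SL_int :: "nat \<Rightarrow> int mat monoid"
  where "SL_int n =
    \<lparr>carrier = {A \<in> carrier_mat n n. Determinant.det A = 1}, monoid.mult = (*), one = 1\<^sub>m n\<rparr>"

lemma group_SL_int: "group (SL_int n)"
proof (rule groupI)
  fix A assume "A \<in> carrier (SL_int n)"
  then have A: "A \<in> carrier_mat n n" "Determinant.det A = 1"
    by (auto simp: SL_int_def)
  have B: "adj_mat A \<in> carrier_mat n n" "adj_mat A * A = 1\<^sub>m n"
    using adj_mat[OF A(1)] A(2) by auto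
  have "Determinant.det (adj_mat A) * Determinant.det A = 1"
    using det_mult[OF B(1) A(1)] B(2) by simp
  then show "\<exists>B\<in>carrier (SL_int n). B \<otimes>\<^bsub>SL_int n\<^esub> A = \<one>\<^bsub>SL_int n\<^esub>"
    using A B by (auto simp: SL_int_def)
qed (auto simp: SL_int_def det_mult)

end

(*
  Elements of SL(n,Z) are compared up to products of boundedly many conjugates of elementary
  matrices; this "distance" is invariant under multiplication on both sides. Row operations and
  the stable range of Z reduce SL(n,Z) to SL(2,Z) inside SL(3,Z). There the class of a matrix depends
  only on its first row (a,b) and is multiplicative in b (Mennicke), and M^k has, up to bounded
  error, the first row (a^k,b), because M^k = x + yM with x^2 = 1 mod y. So M^m is bounded if
  a^m = 1 mod b, and M^e is bounded if d^e = 1 or -1 mod c. For a suitable prime power c in an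
  arithmetic progression the exponents m = totient b and e = totient c / 2 are coprime, hence M
  itself is bounded. Only the existence of such a prime power is needed from Dirichlet's theorem; it
  is proved by Mertens' and Shapiro's elementary method, with Monsky's proof that L(1,chi) is nonzero
  for real characters chi.

  If S normally generates, commutators of conjugates of S with elementary matrices give elementary
  matrices whose entries are the off-diagonal entries and the differences of diagonal entries of the
  elements of S. No integer m > 1 divides all of these, as otherwise S would be central modulo m, so
  a sum of boundedly many of their multiples equals 1.

  For a set P of K primes, the elementary matrices with entries prod (P - {p}), p in P, normally
  generate, but modulo p all of them except one are trivial. So a matrix that is nontrivial modulo
  every p in P is not a product of fewer than K conjugates.
*)
theory Submission
  imports
    Defs
    Complex_Main
    "HOL-Number_Theory.Number_Theory"
    "HOL-Computational_Algebra.Squarefree"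
begin

section \<open>Dirichlet characters\<close>

text \<open>The obstacle throughout is a bound that does not depend on the entries: Euclid's
  algorithm writes a matrix in SL(2,Z) as a product of elementary ones, but their number grows with
  the entries. Mennicke's relation, at a constant cost, is where the third coordinate enters. Powers
  help because the second entry of the first row of \<open>x + y M\<close> is the product
  \<open>y * b\<close>, so that this relation splits it: the part with \<open>y\<close> is harmless,
  and the part with \<open>b\<close> sees only \<open>a^k\<close>. Totients are usually even, so two
  of them would share the factor 2; halving the second one costs only a sign. For
  \<open>c = -1\<close> modulo \<open>4 * m\<close> the half is odd and prime to \<open>m\<close>.
  This works modulo prime powers, which are what the von Mangoldt function counts.

  For a normally generating set the bound may depend on the set only through its cardinality, so
  each step multiplies the radius by a constant depending on \<open>n\<close> alone. Whatever takes
  an unbounded number of operations, such as clearing a column by Euclid's algorithm, is done by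
  conjugation, which leaves the radius unchanged.\<close>

definition dchars :: "nat \<Rightarrow> (nat \<Rightarrow> complex) set" where
  "dchars N = {ch. ch 1 = 1 \<and> (\<forall>m n. ch (m * n) = ch m * ch n) \<and>
     (\<forall>m n. [m = n] (mod N) \<longrightarrow> ch m = ch n) \<and> (\<forall>n. ch n = 0 \<longleftrightarrow> \<not> coprime n N)}"

definition dchar0 :: "nat \<Rightarrow> nat \<Rightarrow> complex" where
  "dchar0 N n = (if coprime n N then 1 else 0)"

context
  fixes N :: nat and ch :: "nat \<Rightarrow> complex"
  assumes chi: "ch \<in> dchars N" and N: "N > 0"
begin

lemma dchar_one: "ch 1 = 1" and dchar_mult: "ch (m * n) = ch m * ch n"
  and dchar_cong: "[m = n] (mod N) \<Longrightarrow> ch m = ch n"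
  and dchar_eq_0_iff: "ch n = 0 \<longleftrightarrow> \<not> coprime n N"
  using chi by (auto simp: dchars_def)

lemma dchar_power: "ch (m ^ k) = ch m ^ k"
  by (induction k) (use dchar_one dchar_mult in auto)

lemma dchar_power_totient: "coprime n N \<Longrightarrow> ch n ^ totient N = 1"
  using dchar_cong[OF euler_theorem] dchar_power dchar_one by metis

lemma norm_dchar: "coprime n N \<Longrightarrow> norm (ch n) = 1"
proof -
  assume "coprime n N"
  then have "norm (ch n) ^ totient N = 1"
    using dchar_power_totient[of n] by (simp flip: norm_power)
  then show ?thesis using power_eq_1_iff[of "norm (ch n)" "totient N"] N by simp
qed

lemma norm_dchar_le: "norm (ch n) \<le> 1"
  using norm_dchar[of n] dchar_eq_0_iff[of n] by (cases "coprime n N") auto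

text \<open>Multiplication by a unit \<open>a\<close> with \<open>ch a \<noteq> 1\<close> permutes
  the residues modulo \<open>N\<close>, so the sum equals \<open>ch a\<close> times itself.\<close>

lemma dchar_sum_period:
  assumes "ch \<noteq> dchar0 N"
  shows "(\<Sum>n<N. ch n) = 0"
proof -
  obtain a where a: "ch a \<noteq> dchar0 N a" using assms by blast
  have cop: "coprime a N" using a dchar_eq_0_iff[of a] by (auto simp: dchar0_def split: if_splits)
  have a1: "ch a \<noteq> 1" using a cop by (auto simp: dchar0_def)
  have inj: "inj_on (\<lambda>n. a * n mod N) {..<N}"
  proof (rule inj_onI)
    fix x y assume xy: "x \<in> {..<N}" "y \<in> {..<N}" "a * x mod N = a * y mod N"
    then have "[x = y] (mod N)" using cop by (simp add: cong_def[symmetric] cong_mult_lcancel_nat)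
    then show "x = y" using xy by (simp add: cong_def)
  qed
  have "(\<lambda>n. a * n mod N) ` {..<N} = {..<N}"
    by (rule endo_inj_surj) (use inj N in auto)
  then have "(\<Sum>n<N. ch n) = (\<Sum>n<N. ch (a * n mod N))"
    using sum.reindex[OF inj, of ch] by (simp add: o_def)
  also have "\<dots> = (\<Sum>n<N. ch a * ch n)"
    by (intro sum.cong refl, subst dchar_mult[symmetric], rule dchar_cong) (simp add: cong_def)
  also have "\<dots> = ch a * (\<Sum>n<N. ch n)" by (simp add: sum_distrib_left)
  finally show ?thesis using a1 by simp
qed

text \<open>Whole periods cancel and at most \<open>N\<close> terms of norm at most 1 remain. This
  is the input for summation by parts.\<close>

lemma dchar_partial_sum_bound:
  assumes "ch \<noteq> dchar0 N"
  shows "norm (\<Sum>n<x. ch n) \<le> N"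
proof (induction x rule: less_induct)
  case (less x)
  show ?case
  proof (cases "x \<le> N")
    case True
    have "norm (\<Sum>n<x. ch n) \<le> (\<Sum>n<x. 1)"
      by (rule order_trans[OF norm_sum sum_mono]) (rule norm_dchar_le)
    then show ?thesis using True by simp
  next
    case False
    have "(\<Sum>n<x. ch n) = (\<Sum>n<N. ch n) + (\<Sum>n\<in>{N..<x}. ch n)"
      using False by (subst sum.union_disjoint[symmetric]) (auto intro!: sum.cong)
    also have "(\<Sum>n\<in>{N..<x}. ch n) = (\<Sum>n<x - N. ch (n + N))"
      by (rule sum.reindex_bij_witness[of _ "\<lambda>n. n + N" "\<lambda>n. n - N"]) auto
    also have "\<dots> = (\<Sum>n<x - N. ch n)"
      by (intro sum.cong refl dchar_cong) (simp add: cong_def)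
    finally show ?thesis using less.IH[of "x - N"] False N dchar_sum_period[OF assms] by simp
  qed
qed

end

lemma dchars_mult: "ch \<in> dchars N \<Longrightarrow> \<psi> \<in> dchars N \<Longrightarrow> (\<lambda>n. ch n * \<psi> n) \<in> dchars N"
  unfolding dchars_def by (auto simp: mult_ac)

lemma dchars_cnj: "ch \<in> dchars N \<Longrightarrow> (\<lambda>n. cnj (ch n)) \<in> dchars N"
  unfolding dchars_def by auto

lemma dchar0_dchars: "dchar0 N \<in> dchars N"
  unfolding dchars_def dchar0_def using cong_imp_coprime cong_sym by (auto; blast)

text \<open>A character is determined by its values on the residues, each of which is 0 or a root of
  unity of order dividing \<open>totient N\<close>.\<close>

lemma finite_dchars:
  assumes N: "N > 0"
  shows "finite (dchars N)"
proof -
  define E where "E = insert (0::complex) {z. z ^ totient N = 1}"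
  have fin: "finite ({..<N} \<rightarrow>\<^sub>E E)"
    unfolding E_def using finite_roots_unity[of "totient N"] N
    by (intro finite_PiE) (auto simp: Suc_le_eq)
  have "inj_on (\<lambda>ch. restrict ch {..<N}) (dchars N)"
  proof (rule inj_onI)
    fix ch \<psi> assume *: "ch \<in> dchars N" "\<psi> \<in> dchars N" "restrict ch {..<N} = restrict \<psi> {..<N}"
    have "ch n = \<psi> n" for n
    proof -
      have "ch (n mod N) = \<psi> (n mod N)" using *(3) N
        by (auto dest: fun_cong[of _ _ "n mod N"])
      then show ?thesis using dchar_cong[OF *(1) N, of n "n mod N"] dchar_cong[OF *(2) N, of n "n mod N"]
        by simp
    qed
    then show "ch = \<psi>" by blast
  qed
  moreover have "(\<lambda>ch. restrict ch {..<N}) ` dchars N \<subseteq> {..<N} \<rightarrow>\<^sub>E E"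
  proof (intro image_subsetI PiE_I)
    fix ch n assume "ch \<in> dchars N" "n \<in> {..<N}"
    then show "restrict ch {..<N} n \<in> E"
      using dchar_power_totient[OF _ N, of ch n] dchar_eq_0_iff[OF _ N, of ch n] by (auto simp: E_def)
  qed auto
  ultimately show ?thesis using fin by (meson finite_imageD finite_subset)
qed

section \<open>Separation of residue classes by characters, orthogonality\<close>

context
  fixes N :: nat
  assumes N: "N > 0"
begin

lemma root_of_unity_sum:
  fixes \<zeta> :: complex
  assumes "\<zeta> ^ h = 1" "\<And>k. 0 < k \<Longrightarrow> k < h \<Longrightarrow> \<zeta> ^ k \<noteq> 1" "k < h"
  shows "(\<Sum>i<h. \<zeta> ^ (i * k)) = (if k = 0 then of_nat h else 0)"
proof (cases "k = 0")
  case False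
  have "(\<Sum>i<h. \<zeta> ^ (i * k)) = (\<Sum>i<h. (\<zeta> ^ k) ^ i)"
    by (simp add: power_mult[symmetric] mult.commute)
  also have "\<dots> = ((\<zeta> ^ k) ^ h - 1) / (\<zeta> ^ k - 1)"
    using assms(2)[of k] assms(3) False by (intro geometric_sum) auto
  also have "(\<zeta> ^ k) ^ h = 1" using assms(1) by (metis mult.commute power_mult power_one)
  finally show ?thesis using False by simp
qed auto

lemma primitive_root_of_unity: "h > 0 \<Longrightarrow> \<exists>\<zeta>::complex. \<zeta> ^ h = 1 \<and> (\<forall>k. 0 < k \<longrightarrow> k < h \<longrightarrow> \<zeta> ^ k \<noteq> 1)"
proof (intro exI conjI allI impI)
  assume h: "h > 0"
  show "cis (2 * pi / h) ^ h = 1" using h by (simp add: DeMoivre)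
  fix k assume k: "0 < k" "k < h"
  show "cis (2 * pi / h) ^ k \<noteq> 1"
  proof
    assume "cis (2 * pi / h) ^ k = 1"
    then have "cis (2 * pi * (k / h)) = 1" by (simp add: DeMoivre mult_ac)
    then have "cos (2 * pi * (k / h)) = 1" by (metis cis.sel(1) one_complex.sel(1))
    then obtain j :: int where "2 * pi * (k / h) = j * (2 * pi)" using cos_one_2pi_int by auto
    then have "real k = j * h" using h by (simp add: field_simps)
    then have "int k = j * int h" by (metis of_int_eq_iff of_int_mult of_int_of_nat_eq)
    then have "int h dvd int k" by simp
    then show False using k by (auto dest: dvd_imp_le)
  qed
qed

text \<open>The nonzero functions on the unit group modulo \<open>N\<close>, extended by 0. The unit
  group acts on them by translations.\<close>

definition cop_fun :: "(nat \<Rightarrow> complex) \<Rightarrow> bool" where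
  "cop_fun f \<longleftrightarrow> (\<forall>m n. [m = n] (mod N) \<longrightarrow> f m = f n) \<and> (\<forall>n. \<not> coprime n N \<longrightarrow> f n = 0) \<and> (\<exists>n. f n \<noteq> 0)"

text \<open>Translation by \<open>g\<close> has order dividing the totient, so a function on the residue classes is a
  sum of eigenvectors. A common eigenvector of all translations is a character up to a scalar.\<close>

lemma cop_fun_decompose:
  assumes f: "cop_fun f" and g: "coprime g N"
  obtains \<zeta> :: complex and P where "\<zeta> \<noteq> 0" "\<And>i. 0 < i \<Longrightarrow> i < totient N \<Longrightarrow> \<zeta> ^ i \<noteq> 1"
    "\<And>i n. \<zeta> ^ i * P i (g * n) = P i n"
    "\<And>n. (\<Sum>i<totient N. P i n) = of_nat (totient N) * f n"
    "\<And>i. (\<exists>n. P i n \<noteq> 0) \<Longrightarrow> cop_fun (P i)"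
    "\<And>i b d. \<forall>n. f (b * n) = d * f n \<Longrightarrow> \<forall>n. P i (b * n) = d * P i n"
proof -
  define h where "h = totient N"
  have h: "h > 0" using N by (simp add: h_def)
  obtain \<zeta> :: complex where z: "\<zeta> ^ h = 1" "\<And>k. 0 < k \<Longrightarrow> k < h \<Longrightarrow> \<zeta> ^ k \<noteq> 1"
    using primitive_root_of_unity[OF h] by blast
  \<comment> \<open>Up to the factor \<open>h\<close>, this is the projection to the eigenspace of
    translation by \<open>g\<close> with eigenvalue \<open>\<zeta>^(-i)\<close>. It commutes with
    the other translations, so their eigenvectors stay eigenvectors.\<close>
  define P where "P i n = (\<Sum>k<h. \<zeta> ^ (i * k) * f (g ^ k * n))" for i n
  have fc: "\<And>m n. [m = n] (mod N) \<Longrightarrow> f m = f n" and f0: "\<And>n. \<not> coprime n N \<Longrightarrow> f n = 0"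
    using f by (auto simp: cop_fun_def)
  show thesis
  proof (rule that[of \<zeta> P, folded h_def])
    show "\<zeta> \<noteq> 0" using z(1) h by (metis power_0_left zero_neq_one gr_implies_not0)
    show "\<And>i. 0 < i \<Longrightarrow> i < h \<Longrightarrow> \<zeta> ^ i \<noteq> 1" by (rule z(2))
    fix i n
    define F where "F k = \<zeta> ^ (i * k) * f (g ^ k * n)" for k
    have "f (g ^ h * n) = f n"
      using cong_scalar_right[OF euler_theorem[OF g], of n] by (intro fc) (simp add: h_def)
    moreover have "\<zeta> ^ (i * h) = 1" using z(1) by (metis mult.commute power_mult power_one)
    ultimately have Fh: "F h = F 0" by (simp add: F_def)
    have "\<zeta> ^ i * P i (g * n) = (\<Sum>k<h. F (Suc k))"
      unfolding P_def F_def by (simp add: sum_distrib_left power_add mult_ac)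
    also have "\<dots> = (\<Sum>k<h. F k)"
      using sum.lessThan_Suc_shift[of F h] Fh by simp
    finally show "\<zeta> ^ i * P i (g * n) = P i n" by (simp add: P_def F_def)
  next
    fix n
    have "(\<Sum>i<h. P i n) = (\<Sum>k<h. (\<Sum>i<h. \<zeta> ^ (i * k)) * f (g ^ k * n))"
      unfolding P_def by (subst sum.swap) (simp add: sum_distrib_right)
    also have "\<dots> = (\<Sum>k<h. if k = 0 then of_nat h * f n else 0)"
      by (intro sum.cong refl, subst root_of_unity_sum[OF z]) auto
    also have "\<dots> = of_nat h * f n" using h by simp
    finally show "(\<Sum>i<h. P i n) = of_nat h * f n" .
  next
    fix i assume ex: "\<exists>n. P i n \<noteq> 0"
    have "P i m = P i n" if "[m = n] (mod N)" for m n
      unfolding P_def by (intro sum.cong refl arg_cong2[where f = "(*)"] fc cong_mult cong_refl that)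
    moreover have "P i n = 0" if "\<not> coprime n N" for n
      unfolding P_def by (intro sum.neutral ballI) (use f0 that in auto)
    ultimately show "cop_fun (P i)" using ex by (auto simp: cop_fun_def)
  next
    fix i a c assume *: "\<forall>n. f (a * n) = c * f n"
    have "f (g ^ k * (a * n)) = c * f (g ^ k * n)" for k n
      using *[rule_format, of "g ^ k * n"] by (simp add: mult_ac)
    then show "\<forall>n. P i (a * n) = c * P i n"
      unfolding P_def by (simp add: sum_distrib_left mult_ac)
  qed
qed

text \<open>The indicator of the class of 1 is moved by \<open>a\<close>, so one of its components
  has an eigenvalue \<open>c \<noteq> 1\<close> for \<open>a\<close>. Projecting this component for
  one residue after another keeps that eigenvalue and ends in a common eigenvector, which becomes a
  character after division by its value at 1.\<close>

lemma dchar_separate: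
  assumes a: "coprime a N" "\<not> [a = 1] (mod N)"
  obtains ch where "ch \<in> dchars N" "ch a \<noteq> 1"
proof -
  have "\<exists>f c. cop_fun f \<and> c \<noteq> 1 \<and> (\<forall>n. f (a * n) = c * f n)"
  proof -
    define \<delta> :: "nat \<Rightarrow> complex" where "\<delta> n = (if [n = 1] (mod N) then 1 else 0)" for n
    have cop1: "coprime n N" if "[n = 1] (mod N)" for n
      using cong_imp_coprime[OF cong_sym[OF that]] by simp
    have d: "cop_fun \<delta>" unfolding cop_fun_def
    proof (intro conjI allI impI)
      show "\<delta> m = \<delta> n" if "[m = n] (mod N)" for m n using that by (auto simp: \<delta>_def cong_def)
      show "\<delta> n = 0" if "\<not> coprime n N" for n using that cop1 by (auto simp: \<delta>_def)
      show "\<exists>n. \<delta> n \<noteq> 0" by (rule exI[of _ 1]) (simp add: \<delta>_def)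
    qed
    obtain \<zeta> P where P: "\<zeta> \<noteq> 0" "\<And>i. 0 < i \<Longrightarrow> i < totient N \<Longrightarrow> \<zeta> ^ i \<noteq> 1"
      "\<And>i n. \<zeta> ^ i * P i (a * n) = P i n"
      "\<And>n. (\<Sum>i<totient N. P i n) = of_nat (totient N) * \<delta> n"
      "\<And>i. (\<exists>n. P i n \<noteq> 0) \<Longrightarrow> cop_fun (P i)"
      "\<And>i b d. \<forall>n. \<delta> (b * n) = d * \<delta> n \<Longrightarrow> \<forall>n. P i (b * n) = d * P i n"
      by (rule cop_fun_decompose[OF d a(1)]) (rule that; assumption)
    have tp: "totient N > 0" using N by simp
    \<comment> \<open>Otherwise only the invariant component \<open>i = 0\<close> is left, and the
      indicator would not be moved by \<open>a\<close>.\<close>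
    have "\<exists>i n. 0 < i \<and> i < totient N \<and> P i n \<noteq> 0"
    proof (rule ccontr)
      assume "\<not> ?thesis"
      then have "(\<Sum>i<totient N. P i n) = (\<Sum>i<totient N. if i = 0 then P 0 n else 0)" for n
        by (intro sum.cong) auto
      then have eq: "of_nat (totient N) * \<delta> n = P 0 n" for n using P(4)[of n] tp by simp
      then have "of_nat (totient N) * \<delta> (a * 1) = of_nat (totient N) * \<delta> 1" using P(3)[of 0 1] by simp
      then have "\<delta> a = \<delta> 1" using N by simp
      then show False using a(2) by (auto simp: \<delta>_def split: if_splits)
    qed
    then obtain i where i: "0 < i" "i < totient N" "\<exists>n. P i n \<noteq> 0" by blast
    have "P i (a * n) = inverse (\<zeta> ^ i) * P i n" for n
      using P(3)[of i n] P(1) by (simp add: field_simps)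
    moreover have "inverse (\<zeta> ^ i) \<noteq> 1" using P(2)[OF i(1,2)] by simp
    ultimately show ?thesis using P(5)[OF i(3)] by blast
  qed
  then obtain f0 c where f0: "cop_fun f0" "c \<noteq> 1" "\<And>n. f0 (a * n) = c * f0 n" by blast
  have "\<exists>f. cop_fun f \<and> (\<forall>n. f (a * n) = c * f n) \<and> (\<forall>g\<in>S. \<exists>d. \<forall>n. f (g * n) = d * f n)"
    if "finite S" "\<forall>g\<in>S. coprime g N" for S
    using that
  proof (induction S rule: finite_induct)
    case empty
    then show ?case using f0 by auto
  next
    case (insert g S)
    then obtain f where f: "cop_fun f" "\<And>n. f (a * n) = c * f n" "\<forall>g\<in>S. \<exists>d. \<forall>n. f (g * n) = d * f n"
      by auto
    have g: "coprime g N" using insert by auto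
    obtain \<zeta> P where P: "\<zeta> \<noteq> 0" "\<And>i. 0 < i \<Longrightarrow> i < totient N \<Longrightarrow> \<zeta> ^ i \<noteq> 1"
      "\<And>i n. \<zeta> ^ i * P i (g * n) = P i n"
      "\<And>n. (\<Sum>i<totient N. P i n) = of_nat (totient N) * f n"
      "\<And>i. (\<exists>n. P i n \<noteq> 0) \<Longrightarrow> cop_fun (P i)"
      "\<And>i b d. \<forall>n. f (b * n) = d * f n \<Longrightarrow> \<forall>n. P i (b * n) = d * P i n"
      by (rule cop_fun_decompose[OF f(1) g]) (rule that; assumption)
    have "\<exists>i n. P i n \<noteq> 0"
    proof (rule ccontr)
      assume "\<not> ?thesis"
      then have "of_nat (totient N) * f n = 0" for n using P(4)[of n] by simp
      then show False using f(1) N by (auto simp: cop_fun_def)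
    qed
    then obtain i where i: "cop_fun (P i)" using P(5) by blast
    have "P i (g * n) = inverse (\<zeta> ^ i) * P i n" for n
      using P(3)[of i n] P(1) by (simp add: field_simps)
    then have "\<exists>d. \<forall>n. P i (g * n) = d * P i n" by blast
    moreover have "\<forall>g\<in>S. \<exists>d. \<forall>n. P i (g * n) = d * P i n"
    proof
      fix b assume "b \<in> S"
      then obtain d where "\<forall>n. f (b * n) = d * f n" using f(3) by blast
      then show "\<exists>d. \<forall>n. P i (b * n) = d * P i n" using P(6)[of b d i] by blast
    qed
    ultimately have "\<forall>b\<in>insert g S. \<exists>d. \<forall>n. P i (b * n) = d * P i n" by blast
    moreover have "\<forall>n. P i (a * n) = c * P i n" using P(6)[of a c i] f(2) by blast
    ultimately show ?case using i by blast
  qed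
  note common_eigenvector = this
  have "\<exists>f. cop_fun f \<and> (\<forall>n. f (a * n) = c * f n) \<and>
      (\<forall>g\<in>{g\<in>{..<N}. coprime g N}. \<exists>d. \<forall>n. f (g * n) = d * f n)"
    by (rule common_eigenvector) auto
  then obtain f where f_all: "cop_fun f \<and> (\<forall>n. f (a * n) = c * f n) \<and>
      (\<forall>g\<in>{g\<in>{..<N}. coprime g N}. \<exists>d. \<forall>n. f (g * n) = d * f n)" ..
  have f: "cop_fun f" "\<And>n. f (a * n) = c * f n"
    using f_all by simp_all
  have f3: "\<exists>d. \<forall>n. f (g * n) = d * f n" if "g < N" "coprime g N" for g
    using f_all that by simp
  have fc: "\<And>m n. [m = n] (mod N) \<Longrightarrow> f m = f n" and fz: "\<And>n. \<not> coprime n N \<Longrightarrow> f n = 0"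
    using f(1) by (auto simp: cop_fun_def)
  have ev: "\<exists>d. \<forall>n. f (g * n) = d * f n" if "coprime g N" for g
  proof -
    have "coprime (g mod N) N" using that N by simp
    then obtain d where "\<forall>n. f (g mod N * n) = d * f n" using f3[of "g mod N"] N by auto
    moreover have "f (g * n) = f (g mod N * n)" for n by (rule fc) (simp add: cong_def mod_mult_left_eq)
    ultimately show ?thesis by auto
  qed
  have ev1: "f (g * n) * f 1 = f g * f n" if cop: "coprime g N" for g n
  proof -
    obtain d where "\<forall>n. f (g * n) = d * f n" using ev[OF cop] by blast
    from this[rule_format, of n] this[rule_format, of 1] show ?thesis by simp
  qed
  \<comment> \<open>For a common eigenvector \<open>f (m * m) * f 1 = f m * f m\<close>, so
    vanishing at 1 would spread to all units.\<close>
  have f1: "f 1 \<noteq> 0"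
  proof
    assume f1: "f 1 = 0"
    obtain m where m: "f m \<noteq> 0" using f(1) by (auto simp: cop_fun_def)
    then have "coprime m N" using fz by blast
    from ev1[OF this, of m] f1 m show False by simp
  qed
  define ch where "ch n = f n / f 1" for n
  have mult: "ch (m * n) = ch m * ch n" for m n
  proof (cases "coprime m N")
    case True
    then show ?thesis using ev1[OF True, of n] f1 by (simp add: ch_def field_simps)
  next
    case False
    then show ?thesis using fz[of m] fz[of "m * n"] by (simp add: ch_def)
  qed
  have one: "ch 1 = 1" using f1 by (simp add: ch_def)
  have pow: "ch (m ^ k) = ch m ^ k" for m k by (induction k) (simp_all add: mult one[unfolded One_nat_def])
  have chic: "ch m = ch n" if "[m = n] (mod N)" for m n using fc[OF that] by (simp add: ch_def)
  have nz: "ch n \<noteq> 0" if "coprime n N" for n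
  proof
    assume "ch n = 0"
    then have "ch (n ^ totient N) = 0" using N by (simp add: pow)
    then show False using chic[OF euler_theorem[OF that]] one by simp
  qed
  have "ch \<in> dchars N" unfolding dchars_def
    using mult chic one nz fz by (auto simp: ch_def)
  moreover have "ch a = c" using f(2)[of 1] f1 by (simp add: ch_def)
  ultimately show ?thesis using that f0(2) by blast
qed

text \<open>Multiplication by a character \<open>\<psi>\<close> with
  \<open>\<psi> a \<noteq> 1\<close> permutes the characters and multiplies the sum by
  \<open>\<psi> a\<close>.\<close>

lemma dchar_orthogonality:
  assumes "coprime a N"
  shows "(\<Sum>ch\<in>dchars N. ch a) = (if [a = 1] (mod N) then of_nat (card (dchars N)) else 0)"
proof (cases "[a = 1] (mod N)")
  case True
  then have "ch a = 1" if "ch \<in> dchars N" for ch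
    using dchar_cong[OF that N True] dchar_one[OF that N] by simp
  then have "(\<Sum>ch\<in>dchars N. ch a) = (\<Sum>ch\<in>dchars N. 1)" by (intro sum.cong refl)
  then show ?thesis using True by simp
next
  case False
  obtain \<psi> where psi: "\<psi> \<in> dchars N" "\<psi> a \<noteq> 1" using dchar_separate[OF assms False] .
  have inj: "inj_on (\<lambda>ch n. \<psi> n * ch n) (dchars N)"
  proof (rule inj_onI)
    fix ch ch' assume *: "ch \<in> dchars N" "ch' \<in> dchars N" "(\<lambda>n. \<psi> n * ch n) = (\<lambda>n. \<psi> n * ch' n)"
    have "ch n = ch' n" for n
      using fun_cong[OF *(3), of n] dchar_eq_0_iff[OF psi(1) N] dchar_eq_0_iff[OF *(1) N] dchar_eq_0_iff[OF *(2) N]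
      by (cases "coprime n N") (simp, metis)
    then show "ch = ch'" by blast
  qed
  have "(\<lambda>ch n. \<psi> n * ch n) ` dchars N = dchars N"
    by (rule endo_inj_surj) (use inj finite_dchars[OF N] dchars_mult[OF psi(1)] in auto)
  then have "(\<Sum>ch\<in>dchars N. ch a) = (\<Sum>ch\<in>dchars N. \<psi> a * ch a)"
    using sum.reindex[OF inj, of "\<lambda>ch. ch a"] by (simp add: o_def)
  also have "\<dots> = \<psi> a * (\<Sum>ch\<in>dchars N. ch a)" by (simp add: sum_distrib_left)
  finally have "(\<Sum>ch\<in>dchars N. ch a) = 0" using psi(2) by simp
  then show ?thesis using False by simp
qed

end

section \<open>Estimates of Chebyshev and Mertens\<close>

text \<open>Summation by parts. The boundary terms contribute \<open>B * f k\<close> and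
  \<open>B * f m\<close>, the remaining sum telescopes to \<open>B * (f m - f k)\<close>; hence the
  factor 2.\<close>

lemma abel_bound:
  fixes a :: "nat \<Rightarrow> complex" and f :: "nat \<Rightarrow> real"
  assumes B: "\<And>x. norm (\<Sum>n<x. a n) \<le> B"
    and f: "\<And>n. n \<ge> m \<Longrightarrow> f (Suc n) \<le> f n" "\<And>n. n \<ge> m \<Longrightarrow> f n \<ge> 0"
  shows "norm (\<Sum>n\<in>{m..<k}. a n * of_real (f n)) \<le> 2 * B * f m"
proof (cases "m \<le> k")
  case True
  define A where "A x = (\<Sum>n<x. a n)" for x
  have eq: "(\<Sum>n\<in>{m..<k}. a n * of_real (f n)) =
      A k * of_real (f k) - A m * of_real (f m) + (\<Sum>n\<in>{m..<k}. A (Suc n) * of_real (f n - f (Suc n)))"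
    using True by (induction k rule: dec_induct) (auto simp: A_def algebra_simps)
  have "norm (\<Sum>n\<in>{m..<k}. A (Suc n) * of_real (f n - f (Suc n))) \<le> (\<Sum>n\<in>{m..<k}. B * (f n - f (Suc n)))"
  proof (intro order_trans[OF norm_sum] sum_mono)
    fix n assume "n \<in> {m..<k}"
    then have "f n - f (Suc n) \<ge> 0" using f(1)[of n] by simp
    then show "norm (A (Suc n) * of_real (f n - f (Suc n))) \<le> B * (f n - f (Suc n))"
      using mult_right_mono[OF B[of "Suc n"]] by (simp only: norm_mult norm_of_real A_def abs_of_nonneg)
  qed
  also have "\<dots> = B * (f m - f k)"
    using True by (induction k rule: dec_induct) (auto simp: algebra_simps)
  finally have 1: "norm (\<Sum>n\<in>{m..<k}. A (Suc n) * of_real (f n - f (Suc n))) \<le> B * (f m - f k)" .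
  have 2: "norm (A x * of_real (f x)) \<le> B * f x" if "x \<ge> m" for x
    using f(2)[OF that] B[of x] unfolding A_def by (auto simp: norm_mult mult_right_mono)
  show ?thesis unfolding eq
    using 1 2[of m] 2[of k] True
    norm_triangle_ineq[of "A k * of_real (f k) - A m * of_real (f m)" "\<Sum>n\<in>{m..<k}. A (Suc n) * of_real (f n - f (Suc n))"]
    norm_triangle_ineq4[of "A k * of_real (f k)" "A m * of_real (f m)"]
    by (simp add: algebra_simps)
next
  case False
  have "B \<ge> 0" using B[of 0] by simp
  then show ?thesis using False f(2)[of m] by simp
qed

text \<open>Both sides run over the pairs \<open>(d, m)\<close> of positive numbers with
  \<open>d * m \<le> x\<close>.\<close>

lemma sum_divisors_swap:
  fixes F :: "nat \<Rightarrow> nat \<Rightarrow> 'a :: comm_monoid_add"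
  shows "(\<Sum>n\<in>{1..x}. \<Sum>d | d dvd n. F d (n div d)) = (\<Sum>d\<in>{1..x}. \<Sum>m\<in>{1..x div d}. F d m)"
proof -
  have "(\<Sum>n\<in>{1..x}. \<Sum>d | d dvd n. F d (n div d)) = (\<Sum>(n,d)\<in>(SIGMA n:{1..x}. {d. d dvd n}). F d (n div d))"
    by (rule sum.Sigma) auto
  also have "\<dots> = (\<Sum>(d,m)\<in>(SIGMA d:{1..x}. {1..x div d}). F d m)"
  proof (rule sum.reindex_bij_witness[of _ "\<lambda>(d,m). (d * m, d)" "\<lambda>(n,d). (d, n div d)"])
    fix p assume p: "p \<in> (SIGMA d:{1..x}. {1..x div d})"
    then obtain d m where dm: "p = (d, m)" "1 \<le> d" "1 \<le> m" "m \<le> x div d" by auto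
    then have "d * m \<le> x" by (metis div_times_less_eq_dividend dual_order.trans mult.commute mult_le_mono2)
    then show "(case p of (d, m) \<Rightarrow> (d * m, d)) \<in> (SIGMA n:{1..x}. {d. d dvd n})"
      "(case case p of (d, m) \<Rightarrow> (d * m, d) of (n, d) \<Rightarrow> (d, n div d)) = p"
      using dm by auto
  next
    fix p assume p: "p \<in> (SIGMA n:{1..x}. {d. d dvd n})"
    then obtain n d where nd: "p = (n, d)" "1 \<le> n" "n \<le> x" "d dvd n" by auto
    then have "d \<le> n" "d > 0" by (auto intro: dvd_imp_le dvd_pos_nat)
    then show "(case p of (n, d) \<Rightarrow> (d, n div d)) \<in> (SIGMA d:{1..x}. {1..x div d})"
      using nd by (auto simp: div_le_mono div_greater_zero_iff Suc_le_eq)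
    show "(case case p of (n, d) \<Rightarrow> (d, n div d) of (d, m) \<Rightarrow> (d * m, d)) = p" using nd by auto
  qed auto
  also have "\<dots> = (\<Sum>d\<in>{1..x}. \<Sum>m\<in>{1..x div d}. F d m)"
    by (rule sum.Sigma[symmetric]) auto
  finally show ?thesis .
qed

lemma ln_Suc_bound: "n > 0 \<Longrightarrow> real n * (ln (real (Suc n)) - ln (real n)) \<le> 1"
proof -
  assume n: "n > 0"
  have "ln (real (Suc n)) - ln (real n) = ln (1 + 1 / real n)"
    using n ln_div[of "real (Suc n)" "real n"] by (simp add: add_divide_distrib add.commute)
  also have "\<dots> \<le> 1 / real n" using n by (intro ln_add_one_self_le_self) auto
  finally show ?thesis using n by (simp add: field_simps)
qed

lemma ln_fact_ge: "real n * ln (real n) - real n \<le> ln (fact n)"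
proof (induction n)
  case (Suc n)
  show ?case
  proof (cases "n = 0")
    case False
    have "ln (fact (Suc n)) = ln (real (Suc n)) + ln (fact n)"
      by (simp add: ln_mult del: of_nat_Suc)
    then show ?thesis using Suc ln_Suc_bound[of n] False by (simp add: algebra_simps)
  qed auto
qed auto

lemma ln_fact_eq: "ln (fact n) = (\<Sum>k\<in>{1..n}. ln (real k))"
  by (subst fact_prod, subst of_nat_prod, subst ln_prod) auto

lemma ln_fact_le: "ln (fact n) \<le> real n * ln (real n)"
proof -
  have "(\<Sum>k\<in>{1..n}. ln (real k)) \<le> (\<Sum>k\<in>{1..n}. ln (real n))"
    by (intro sum_mono) auto
  then show ?thesis by (simp add: ln_fact_eq)
qed

text \<open>Legendre's formula: \<open>ln n\<close> is the divisor sum of \<open>mangoldt\<close>,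
  and \<open>d\<close> has \<open>x div d\<close> multiples up to \<open>x\<close>.\<close>

lemma ln_fact_mangoldt: "ln (fact x) = (\<Sum>d\<in>{1..x}. mangoldt d * real (x div d))"
proof -
  have "ln (fact x) = (\<Sum>n\<in>{1..x}. \<Sum>d | d dvd n. mangoldt d :: real)"
    unfolding ln_fact_eq by (intro sum.cong refl) (simp add: mangoldt_sum)
  also have "\<dots> = (\<Sum>d\<in>{1..x}. \<Sum>m\<in>{1..x div d}. mangoldt d)"
    by (rule sum_divisors_swap)
  finally show ?thesis by (simp add: mult.commute)
qed

definition chebyshev_psi :: "nat \<Rightarrow> real" where "chebyshev_psi x = (\<Sum>d\<in>{1..x}. mangoldt d)"

text \<open>Chebyshev's argument with the central binomial coefficient, which is at most
  \<open>4 ^ k\<close>. In its logarithm the coefficient \<open>2 * k div d - 2 * (k div d)\<close>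
  of \<open>mangoldt d\<close> is never negative, and it is at least 1 for
  \<open>k < d \<le> 2 * k\<close>.\<close>

lemma chebyshev_psi_double: "chebyshev_psi (2 * k) \<le> chebyshev_psi k + 2 * real k"
proof -
  have split: "{1..2 * k} = {1..k} \<union> {k<..2 * k}" by auto
  have "chebyshev_psi (2 * k) - chebyshev_psi k = (\<Sum>d\<in>{k<..2*k}. mangoldt d)"
    unfolding chebyshev_psi_def split by (subst sum.union_disjoint) auto
  also have "\<dots> \<le> (\<Sum>d\<in>{k<..2*k}. mangoldt d * (real (2 * k div d) - 2 * real (k div d)))"
  proof (intro sum_mono)
    fix d assume d: "d \<in> {k<..2*k}"
    then have "k div d = 0" "2 * k div d \<ge> 1" by (auto simp: Suc_le_eq div_greater_zero_iff)
    then show "mangoldt d \<le> mangoldt d * (real (2 * k div d) - 2 * real (k div d))"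
      using mult_left_mono[of 1 "real (2 * k div d)" "mangoldt d"] mangoldt_nonneg[of d] by simp
  qed
  also have "\<dots> \<le> (\<Sum>d\<in>{1..2*k}. mangoldt d * (real (2 * k div d) - 2 * real (k div d)))"
  proof (intro sum_mono2)
    fix d
    have "2 * (k div d) \<le> 2 * k div d" by (cases "d = 0") (auto simp: less_eq_div_iff_mult_less_eq)
    then have "2 * real (k div d) \<le> real (2 * k div d)" by linarith
    then show "0 \<le> mangoldt d * (real (2 * k div d) - 2 * real (k div d))"
      using mangoldt_nonneg[of d] by simp
  qed auto
  also have "\<dots> = ln (fact (2 * k)) - 2 * (\<Sum>d\<in>{1..2*k}. mangoldt d * real (k div d))"
    unfolding ln_fact_mangoldt by (simp add: sum_subtractf sum_distrib_left algebra_simps)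
  also have "(\<Sum>d\<in>{1..2*k}. mangoldt d * real (k div d)) = (\<Sum>d\<in>{1..k}. mangoldt d * real (k div d))"
    by (rule sum.mono_neutral_right) auto
  also have "\<dots> = ln (fact k)" by (simp add: ln_fact_mangoldt)
  also have "ln (fact (2 * k)) - 2 * ln (fact k) = ln (real (2 * k choose k))"
    by (simp add: binomial_fact ln_div ln_mult)
  also have "\<dots> \<le> ln (4 ^ k)"
  proof -
    have "2 * k choose k \<le> 2 ^ (2 * k)" by (rule binomial_le_pow2)
    then have "real (2 * k choose k) \<le> 2 ^ (2 * k)"
      by (metis of_nat_le_iff of_nat_numeral of_nat_power)
    then show ?thesis by (subst ln_le_cancel_iff) (auto simp: power_mult)
  qed
  also have "\<dots> = k * (2 * ln 2)"
    using ln_mult[of 2 "2::real"] by (simp add: ln_realpow)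
  also have "\<dots> \<le> 2 * real k" using ln_2_less_1 by (simp add: mult_left_le)
  finally show ?thesis by simp
qed

text \<open>Halving. The constant 4 closes the odd step, where the estimate
  \<open>ln x \<le> x - 1\<close> for the last term costs another \<open>2 * k\<close>.\<close>

lemma chebyshev_psi_le: "chebyshev_psi x \<le> 4 * real x"
proof (induction x rule: less_induct)
  case (less x)
  show ?case
  proof (cases "x = 0")
    case False
    define k where "k = x div 2"
    have k: "chebyshev_psi k \<le> 4 * real k" using less[of k] False by (simp add: k_def)
    show ?thesis
    proof (cases "even x")
      case True
      then have "x = 2 * k" by (simp add: k_def)
      then show ?thesis using k chebyshev_psi_double[of k] by simp
    next
      case odd: False
      then have x: "x = Suc (2 * k)" by (simp add: k_def)
      have "chebyshev_psi x = chebyshev_psi (2 * k) + mangoldt x"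
        by (simp add: chebyshev_psi_def x)
      also have "mangoldt x \<le> ln (real x)" using False by (intro mangoldt_le) auto
      also have "ln (real x) \<le> real x - 1" using False by (intro ln_le_minus_one) auto
      finally show ?thesis using k chebyshev_psi_double[of k] by (simp add: x)
    qed
  qed (simp add: chebyshev_psi_def)
qed

text \<open>Compare the sum of \<open>mangoldt d * (x / d)\<close> with that of
  \<open>mangoldt d * (x div d)\<close>, which is \<open>ln (fact x)\<close>. The fractional parts
  cost at most \<open>chebyshev_psi x \<le> 4 * x\<close>, hence the 4; the 1 comes from the lower
  bound for \<open>ln (fact x)\<close>.\<close>

lemma mertens:
  assumes "x > 0"
  shows "(\<Sum>d\<in>{1..x}. mangoldt d / real d) \<le> ln (real x) + 4"
    and "(\<Sum>d\<in>{1..x}. mangoldt d / real d) \<ge> ln (real x) - 1"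
proof -
  let ?T = "\<Sum>d\<in>{1..x}. mangoldt d / real d"
  have "real x * ?T - chebyshev_psi x = (\<Sum>d\<in>{1..x}. mangoldt d * (real x / real d - 1))"
    unfolding chebyshev_psi_def by (simp add: sum_distrib_left sum_subtractf[symmetric] algebra_simps)
  also have "\<dots> \<le> (\<Sum>d\<in>{1..x}. mangoldt d * real (x div d))"
  proof (intro sum_mono mult_left_mono mangoldt_nonneg)
    fix d :: nat
    have "real x / real d < real (x div d) + 1" if "d > 0"
    proof -
      have "x < d * (x div d + 1)" using dividend_less_times_div[OF that] by simp
      then have "real x < real (d * (x div d + 1))" by linarith
      then show ?thesis using that by (simp add: field_simps)
    qed
    then show "real x / real d - 1 \<le> real (x div d)" by (cases "d = 0") auto
  qed
  also have "\<dots> \<le> real x * ln (real x)" unfolding ln_fact_mangoldt[symmetric] by (rule ln_fact_le)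
  finally have "real x * ?T \<le> real x * (ln (real x) + 4)"
    using chebyshev_psi_le[of x] by (simp add: algebra_simps)
  then show "?T \<le> ln (real x) + 4" using assms by simp
  have "real x * (ln (real x) - 1) \<le> (\<Sum>d\<in>{1..x}. mangoldt d * real (x div d))"
    unfolding ln_fact_mangoldt[symmetric] using ln_fact_ge[of x] by (simp add: algebra_simps)
  also have "\<dots> \<le> (\<Sum>d\<in>{1..x}. mangoldt d * (real x / real d))"
    by (intro sum_mono mult_left_mono mangoldt_nonneg of_nat_div_le_of_nat)
  also have "\<dots> = real x * ?T" by (simp add: sum_distrib_left algebra_simps)
  finally show "?T \<ge> ln (real x) - 1" using assms by simp
qed

lemma sum_ln_quotient_le: "(\<Sum>d\<in>{1..x}. ln (real x / real d)) \<le> real x"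
proof -
  have "(\<Sum>d\<in>{1..x}. ln (real x / real d)) = (\<Sum>d\<in>{1..x}. ln (real x) - ln (real d))"
    by (intro sum.cong refl) (auto simp: ln_div)
  also have "\<dots> = real x * ln (real x) - ln (fact x)" by (simp add: sum_subtractf ln_fact_eq)
  finally show ?thesis using ln_fact_ge[of x] by simp
qed

text \<open>Only powers of the primes dividing \<open>N\<close> contribute, and each of these primes
  gives a geometric series of ratio at most 1/2.\<close>

lemma mangoldt_noncoprime_bound:
  assumes N: "N > 0"
  shows "(\<Sum>n | n \<in> {1..x} \<and> \<not> coprime n N. mangoldt n / real n) \<le> (\<Sum>p\<in>prime_factors N. ln (real p))"
proof -
  let ?I = "prime_factors N \<times> {1..x}"
  let ?g = "\<lambda>n. mangoldt n / real n"
  have "(\<Sum>n | n \<in> {1..x} \<and> \<not> coprime n N. ?g n) \<le> (\<Sum>n\<in>(\<lambda>(p,k). p ^ k) ` ?I. ?g n)"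
  proof (rule order_trans[OF eq_refl sum_mono2])
    show "(\<Sum>n | n \<in> {1..x} \<and> \<not> coprime n N. ?g n) =
        (\<Sum>n | n \<in> {1..x} \<and> \<not> coprime n N \<and> primepow n. ?g n)"
      by (rule sum.mono_neutral_right) (auto simp: mangoldt_def)
    show "{n \<in> {1..x}. \<not> coprime n N \<and> primepow n} \<subseteq> (\<lambda>(p,k). p ^ k) ` ?I"
    proof
      fix n assume n: "n \<in> {n \<in> {1..x}. \<not> coprime n N \<and> primepow n}"
      then obtain p k where pk: "prime p" "k > 0" "n = p ^ k" by (auto simp: primepow_def)
      have "p dvd N" using n pk prime_imp_coprime[of p N] by auto
      then have "p \<in> prime_factors N" using pk N by (auto simp: prime_factors_dvd)
      \<comment> \<open>The exponent is below \<open>p ^ k \<le> x\<close>, so it lies in the finite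
        range \<open>{1..x}\<close>.\<close>
      moreover have "k < p ^ k" using pk prime_gt_1_nat by (intro power_gt_expt) (auto simp: )
      ultimately show "n \<in> (\<lambda>(p,k). p ^ k) ` ?I" using pk n by (auto intro!: image_eqI[of _ _ "(p, k)"])
    qed
    show "0 \<le> ?g n" for n using mangoldt_nonneg[of n] by simp
  qed auto
  also have "\<dots> \<le> (\<Sum>z\<in>?I. (?g \<circ> (\<lambda>(p,k). p ^ k)) z)"
    by (rule sum_image_le) (auto simp: mangoldt_nonneg)
  also have "\<dots> = (\<Sum>p\<in>prime_factors N. \<Sum>k\<in>{1..x}. ?g (p ^ k))"
    by (simp add: sum.cartesian_product case_prod_unfold)
  also have "\<dots> \<le> (\<Sum>p\<in>prime_factors N. ln (real p))"
  proof (rule sum_mono)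
    fix p assume "p \<in> prime_factors N"
    then have p: "prime p" "p \<ge> 2" using prime_ge_2_nat by auto
    have "(\<Sum>k\<in>{1..x}. ?g (p ^ k)) \<le> (\<Sum>k\<in>{1..x}. ln (real p) * (1/2) ^ k)"
    proof (rule sum_mono)
      fix k assume "k \<in> {1..x}"
      then have "?g (p ^ k) = ln (real p) * (1 / real p) ^ k"
        using p by (simp add: power_one_over)
      also have "\<dots> \<le> ln (real p) * (1/2) ^ k"
        using p by (intro mult_left_mono power_mono) (auto simp: field_simps)
      finally show "?g (p ^ k) \<le> ln (real p) * (1/2) ^ k" .
    qed
    also have "\<dots> = ln (real p) * (\<Sum>k\<in>{1..x}. (1/2) ^ k)" by (simp add: sum_distrib_left)
    also have "(\<Sum>k\<in>{1..x}. (1/2::real) ^ k) = 1 - (1/2) ^ x"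
      by (induction x) auto
    also have "ln (real p) * \<dots> \<le> ln (real p)" using p by (simp add: mult_left_le)
    finally show "(\<Sum>k\<in>{1..x}. ?g (p ^ k)) \<le> ln (real p)" .
  qed
  finally show ?thesis .
qed

section \<open>The Moebius function\<close>

definition moebius :: "nat \<Rightarrow> real" where
  "moebius n = (if squarefree n then (-1) ^ card (prime_factors n) else 0)"

lemma abs_moebius_le: "\<bar>moebius n\<bar> \<le> 1"
  by (simp add: moebius_def power_abs)

lemma moebius_1 [simp]: "moebius 1 = 1" "moebius (Suc 0) = 1"
  by (auto simp: moebius_def)

lemma moebius_prime_mult:
  assumes "prime p" "\<not> p dvd d"
  shows "moebius (p * d) = - moebius d"
proof -
  have d: "d \<noteq> 0" using assms by (metis dvd_0_right)
  have cop: "coprime p d" using assms by (simp add: prime_imp_coprime)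
  have "prime_factors (p * d) = insert p (prime_factors d)"
    using assms d prime_factors_product[of p d] by (auto simp: prime_prime_factors)
  moreover have "p \<notin> prime_factors d" using assms(2) by auto
  ultimately have "card (prime_factors (p * d)) = Suc (card (prime_factors d))" by simp
  moreover have "squarefree (p * d) \<longleftrightarrow> squarefree d"
    using squarefree_mult_coprime[OF cop] squarefree_prime[OF assms(1)] squarefree_multD(2)[of p d] by blast
  ultimately show ?thesis by (simp add: moebius_def)
qed

text \<open>Choose a prime \<open>p\<close> dividing \<open>n\<close>. The squarefree divisors prime
  to \<open>p\<close> cancel against their multiples by \<open>p\<close>.\<close>

lemma sum_moebius_divisors:
  assumes "n > 0"
  shows "(\<Sum>d | d dvd n. moebius d) = (if n = 1 then 1 else 0)"
proof (cases "n = 1")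
  case False
  then obtain p where p: "prime p" "p dvd n" using prime_factor_nat by blast
  let ?S = "{d. d dvd n}"
  have fin: "finite ?S" using assms by simp
  let ?A = "{d. d dvd n \<and> squarefree d \<and> \<not> p dvd d}"
  let ?B = "{d. d dvd n \<and> squarefree d \<and> p dvd d}"
  have "(\<Sum>d | d dvd n. moebius d) = (\<Sum>d\<in>?A \<union> ?B. moebius d)"
    by (rule sum.mono_neutral_right) (use fin in \<open>auto simp: moebius_def\<close>)
  also have "\<dots> = (\<Sum>d\<in>?A. moebius d) + (\<Sum>d\<in>?B. moebius d)"
    by (rule sum.union_disjoint) (use fin in \<open>auto intro: finite_subset[OF _ fin]\<close>)
  also have "(\<Sum>d\<in>?B. moebius d) = (\<Sum>d\<in>?A. moebius (p * d))"
  proof (rule sum.reindex_bij_witness[of _ "\<lambda>d. p * d" "\<lambda>d. d div p"])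
    fix d assume d: "d \<in> ?B"
    then obtain e where e: "d = p * e" by auto
    have sq: "squarefree (p * e)" using d e by simp
    have ndvd: "\<not> p dvd e"
    proof
      assume "p dvd e"
      then have "p ^ 2 dvd p * e" by (simp add: power2_eq_square)
      then have "is_unit p" using sq squarefreeD by blast
      then show False using p(1) by simp
    qed
    have "d div p = e" using e p by (simp add: prime_gt_0_nat)
    then show "d div p \<in> ?A" using d e ndvd squarefree_multD(2)[OF sq] by (auto dest: dvd_mult_right)
    show "p * (d div p) = d" using e p by (simp add: prime_gt_0_nat)
    show "moebius (p * (d div p)) = moebius d" using e p by (simp add: prime_gt_0_nat)
  next
    fix d assume d: "d \<in> ?A"
    have cop: "coprime p d" using d p by (simp add: prime_imp_coprime)
    show "p * d div p = d" using p by (simp add: prime_gt_0_nat)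
    have "p * d dvd n" using d p cop by (simp add: divides_mult)
    then show "p * d \<in> ?B"
      using d squarefree_mult_coprime[OF cop squarefree_prime[OF p(1)]] by auto
  qed
  also have "\<dots> = (\<Sum>d\<in>?A. - moebius d)"
    by (intro sum.cong refl moebius_prime_mult p) auto
  finally show ?thesis using False by (simp add: sum_negf)
qed auto

text \<open>Moebius inversion of \<open>mangoldt_sum\<close>, after writing
  \<open>ln d = ln n - ln (n div d)\<close>. The term with \<open>ln n\<close> drops out: for
  \<open>n > 1\<close> its Moebius sum vanishes, for \<open>n = 1\<close> the logarithm
  does.\<close>

lemma sum_moebius_ln:
  assumes "n > 0"
  shows "(\<Sum>d | d dvd n. moebius d * ln (real d)) = - mangoldt n"
proof -
  let ?D = "\<lambda>n::nat. {d. d dvd n}"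
  have swap: "d dvd n \<and> e dvd n div d \<longleftrightarrow> e dvd n \<and> d dvd n div e" for d e
    using assms by (metis dvd_div_iff_mult dvd_mult_left dvd_mult_right mult.commute dvd_0_left_iff gr_implies_not0)
  have fin: "finite (?D k)" if "k > 0" for k using that by simp
  have "(\<Sum>d\<in>?D n. moebius d * ln (real (n div d))) = (\<Sum>d\<in>?D n. \<Sum>e\<in>?D (n div d). moebius d * mangoldt e)"
  proof (intro sum.cong refl)
    fix d assume "d \<in> ?D n"
    then have "n div d > 0" using assms by (auto simp: div_greater_zero_iff dvd_imp_le dvd_pos_nat)
    then show "moebius d * ln (real (n div d)) = (\<Sum>e\<in>?D (n div d). moebius d * mangoldt e)"
      by (simp add: sum_distrib_left[symmetric] mangoldt_sum)
  qed
  also have "\<dots> = (\<Sum>(d,e)\<in>(SIGMA d:?D n. ?D (n div d)). moebius d * mangoldt e)"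
    by (rule sum.Sigma) (use assms in \<open>auto simp: div_greater_zero_iff dvd_imp_le dvd_pos_nat intro!: fin\<close>)
  also have "\<dots> = (\<Sum>(e,d)\<in>(SIGMA e:?D n. ?D (n div e)). moebius d * mangoldt e)"
    by (rule sum.reindex_bij_witness[of _ "\<lambda>(x,y). (y,x)" "\<lambda>(x,y). (y,x)"])
       (use assms in \<open>auto dest: swap[THEN iffD1, OF conjI] swap[THEN iffD2, OF conjI]\<close>)
  also have "\<dots> = (\<Sum>e\<in>?D n. \<Sum>d\<in>?D (n div e). moebius d * mangoldt e)"
    by (rule sum.Sigma[symmetric]) (use assms in \<open>auto simp: div_greater_zero_iff dvd_imp_le dvd_pos_nat intro!: fin\<close>)
  also have "\<dots> = (\<Sum>e\<in>?D n. if e = n then mangoldt e else 0)"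
  proof (intro sum.cong refl)
    fix e assume e: "e \<in> ?D n"
    then have pos: "n div e > 0" using assms by (auto simp: div_greater_zero_iff dvd_imp_le dvd_pos_nat)
    have "n div e = 1 \<longleftrightarrow> e = n" using e assms
      by (metis div_self dvd_mult_div_cancel gr_implies_not0 mem_Collect_eq mult.right_neutral)
    then show "(\<Sum>d\<in>?D (n div e). moebius d * mangoldt e) = (if e = n then mangoldt e else 0)"
      using sum_moebius_divisors[OF pos] by (simp add: sum_distrib_right[symmetric])
  qed
  also have "\<dots> = mangoldt n" using assms by simp
  finally have 1: "(\<Sum>d\<in>?D n. moebius d * ln (real (n div d))) = mangoldt n" .
  have "(\<Sum>d\<in>?D n. moebius d * ln (real (n div d))) = (\<Sum>d\<in>?D n. moebius d * ln (real n) - moebius d * ln (real d))"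
  proof (intro sum.cong refl)
    fix d assume d: "d \<in> ?D n"
    then have "real (n div d) = real n / real d" "d > 0" using assms by (auto simp: real_of_nat_div dvd_pos_nat)
    then show "moebius d * ln (real (n div d)) = moebius d * ln (real n) - moebius d * ln (real d)"
      using assms by (simp add: ln_div algebra_simps)
  qed
  also have "\<dots> = (\<Sum>d\<in>?D n. moebius d) * ln (real n) - (\<Sum>d\<in>?D n. moebius d * ln (real d))"
    by (simp add: sum_subtractf sum_distrib_right)
  also have "(\<Sum>d\<in>?D n. moebius d) * ln (real n) = 0"
    using sum_moebius_divisors[OF assms] by simp
  finally show ?thesis using 1 by simp
qed

section \<open>Nonvanishing of L(1) and prime powers in residue classes\<close>

text \<open>Partial sums of the Dirichlet series of \<open>- L' / L\<close> at 1.\<close>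

definition char_mangoldt_sum :: "(nat \<Rightarrow> complex) \<Rightarrow> nat \<Rightarrow> complex" where
  "char_mangoldt_sum ch x = (\<Sum>n\<in>{1..x}. ch n * of_real (mangoldt n / real n))"

definition L1_partial :: "(nat \<Rightarrow> complex) \<Rightarrow> nat \<Rightarrow> complex" where
  "L1_partial ch x = (\<Sum>n\<in>{1..x}. ch n * of_real (1 / real n))"

lemma atLeast1_atMost_eq: "{1..x} = {1..<Suc x}" by auto

text \<open>Summation by parts bounds the tails. The rate \<open>1 / x\<close> matters below, beyond
  mere convergence.\<close>

lemma L1_partial_limit:
  assumes B: "\<And>x. norm (\<Sum>n<x. ch n) \<le> B"
  obtains L where "L1_partial ch \<longlonglongrightarrow> L" "\<And>x. norm (L1_partial ch x - L) \<le> 2 * B / real (Suc x)"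
proof -
  have B0: "B \<ge> 0" using B[of 0] by simp
  have diff: "norm (L1_partial ch y - L1_partial ch x) \<le> 2 * B / real (Suc x)" if "x \<le> y" for x y
  proof -
    have "L1_partial ch y - L1_partial ch x = (\<Sum>n\<in>{Suc x..<Suc y}. ch n * of_real (1 / real n))"
    proof -
      have un: "{1..y} = {1..x} \<union> {Suc x..<Suc y}" using that by auto
      have "L1_partial ch y = L1_partial ch x + (\<Sum>n\<in>{Suc x..<Suc y}. ch n * of_real (1 / real n))"
        unfolding L1_partial_def un by (rule sum.union_disjoint) auto
      then show ?thesis by simp
    qed
    also have "norm \<dots> \<le> 2 * B * (1 / real (Suc x))"
      by (rule abel_bound[OF B]) (auto simp: field_simps)
    finally show ?thesis by simp
  qed
  have "Cauchy (L1_partial ch)"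
  proof (rule CauchyI')
    fix e :: real assume e: "e > 0"
    obtain M :: nat where M: "2 * B / e < real M" using reals_Archimedean2 by blast
    have "dist (L1_partial ch m) (L1_partial ch n) < e" if mn: "m \<ge> M" "n > m" for m n
    proof -
      have "2 * B / e < real (Suc m)" using M mn by linarith
      then have "2 * B / real (Suc m) < e" using e by (simp add: field_simps del: of_nat_Suc)
      then show ?thesis using diff[of m n] mn by (simp add: dist_norm norm_minus_commute)
    qed
    then show "\<exists>M. \<forall>m\<ge>M. \<forall>n>m. dist (L1_partial ch m) (L1_partial ch n) < e" by blast
  qed
  then obtain L where L: "L1_partial ch \<longlonglongrightarrow> L" using Cauchy_convergent_iff convergent_def by blast
  moreover have "norm (L1_partial ch x - L) \<le> 2 * B / real (Suc x)" for x
  proof (rule LIMSEQ_le_const2)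
    show "(\<lambda>y. norm (L1_partial ch x - L1_partial ch y)) \<longlonglongrightarrow> norm (L1_partial ch x - L)"
      by (intro tendsto_intros L)
    show "\<exists>M. \<forall>y\<ge>M. norm (L1_partial ch x - L1_partial ch y) \<le> 2 * B / real (Suc x)"
      using diff[of x] unfolding norm_minus_commute[of "L1_partial ch x"] by blast
  qed
  ultimately show thesis using that by blast
qed

section \<open>Von Mangoldt sums twisted by a nonprincipal character\<close>

context
  fixes N :: nat and ch :: "nat \<Rightarrow> complex"
  assumes chi: "ch \<in> dchars N" and N: "N > 0" and nonprincipal: "ch \<noteq> dchar0 N"
begin

text \<open>\<open>ln n / n\<close> decreases only from \<open>n = 3\<close> on, so the first two
  terms are bounded separately.\<close>

lemma char_ln_sum_bounded: "norm (\<Sum>n\<in>{1..x}. ch n * of_real (ln (real n) / real n)) \<le> 2 + 2 * real N * (ln 3 / 3)"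
proof -
  have sub: "{1..x} = ({1..x} \<inter> {1,2}) \<union> {3..<Suc x}" by auto
  have "(\<Sum>n\<in>{1..x}. ch n * of_real (ln (real n) / real n)) =
    (\<Sum>n\<in>{1..x} \<inter> {1,2}. ch n * of_real (ln (real n) / real n)) +
    (\<Sum>n\<in>{3..<Suc x}. ch n * of_real (ln (real n) / real n))"
    by (subst sub, rule sum.union_disjoint) auto
  moreover have "norm (\<Sum>n\<in>{1..x} \<inter> {1,2}. ch n * of_real (ln (real n) / real n)) \<le> 2"
  proof -
    have "norm (\<Sum>n\<in>{1..x} \<inter> {1,2}. ch n * of_real (ln (real n) / real n)) \<le> (\<Sum>n\<in>{1..x} \<inter> {1,2}. 1)"
    proof (intro order_trans[OF norm_sum] sum_mono)
      fix n assume "n \<in> {1..x} \<inter> {1,2}"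
      then have "\<bar>ln (real n) / real n\<bar> \<le> 1" using ln_2_less_1 by auto
      then show "norm (ch n * of_real (ln (real n) / real n)) \<le> 1"
        using norm_dchar_le[OF chi N, of n] by (simp only: norm_mult norm_of_real mult_le_one norm_ge_zero abs_ge_zero)
    qed
    also have "\<dots> \<le> 2" using card_mono[of "{1::nat,2}" "{1..x} \<inter> {1,2}"] by simp
    finally show ?thesis .
  qed
  moreover have "norm (\<Sum>n\<in>{3..<Suc x}. ch n * of_real (ln (real n) / real n)) \<le> 2 * real N * (ln (real 3) / real 3)"
  proof (rule abel_bound[OF dchar_partial_sum_bound[OF chi N nonprincipal]])
    fix n :: nat assume n: "3 \<le> n"
    have "exp 1 \<le> real n" using exp_le n by linarith
    then have "1 \<le> ln (real n)" using n by (subst ln_ge_iff) auto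
    moreover have "real n * (ln (real (Suc n)) - ln (real n)) \<le> 1" using n by (intro ln_Suc_bound) auto
    ultimately have "real n * ln (real (Suc n)) \<le> real (Suc n) * ln (real n)" by (simp add: algebra_simps)
    then show "ln (real (Suc n)) / real (Suc n) \<le> ln (real n) / real n"
      using n by (simp add: divide_simps mult.commute)
  qed auto
  ultimately show ?thesis
    using norm_triangle_ineq[of "\<Sum>n\<in>{1..x} \<inter> {1,2}. ch n * of_real (ln (real n) / real n)"
       "\<Sum>n\<in>{3..<Suc x}. ch n * of_real (ln (real n) / real n)"] by simp
qed

lemma char_quotient:
  assumes "d > 0" "d dvd n" "n > 0"
  shows "ch n * of_real (1 / real n) = ch d * of_real (1 / real d) * (ch (n div d) * of_real (1 / real (n div d)))"
  using assms dchar_mult[OF chi N, of d "n div d"] by (simp add: real_of_nat_div)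

text \<open>A completely multiplicative factor passes through the Dirichlet convolution of
  \<open>g\<close> with 1, and the inner sums become partial sums of \<open>L(1)\<close>.\<close>

lemma char_convolution_sum:
  fixes g :: "nat \<Rightarrow> real"
  shows "(\<Sum>n\<in>{1..x}. ch n * of_real (1 / real n) * of_real (\<Sum>d | d dvd n. g d)) =
     (\<Sum>d\<in>{1..x}. ch d * of_real (g d / real d) * L1_partial ch (x div d))"
proof -
  have "(\<Sum>n\<in>{1..x}. ch n * of_real (1 / real n) * of_real (\<Sum>d | d dvd n. g d)) =
     (\<Sum>n\<in>{1..x}. \<Sum>d | d dvd n. ch d * of_real (g d / real d) * (ch (n div d) * of_real (1 / real (n div d))))"
  proof (intro sum.cong refl)
    fix n assume n: "n \<in> {1..x}"
    have "ch n * of_real (1 / real n) * of_real (g d) =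
      ch d * of_real (g d / real d) * (ch (n div d) * of_real (1 / real (n div d)))" if "d dvd n" for d
      using char_quotient[of d n] that n by (simp add: dvd_pos_nat)
    then show "ch n * of_real (1 / real n) * of_real (\<Sum>d | d dvd n. g d) =
      (\<Sum>d | d dvd n. ch d * of_real (g d / real d) * (ch (n div d) * of_real (1 / real (n div d))))"
      by (simp only: of_real_sum sum_distrib_left) (intro sum.cong, auto)
  qed
  also have "\<dots> = (\<Sum>d\<in>{1..x}. \<Sum>m\<in>{1..x div d}. ch d * of_real (g d / real d) * (ch m * of_real (1 / real m)))"
    by (rule sum_divisors_swap)
  finally show ?thesis by (simp add: L1_partial_def sum_distrib_left)
qed

lemma inverse_Suc_div_le: "d > 0 \<Longrightarrow> d \<le> x \<Longrightarrow> 1 / real (Suc (x div d)) \<le> real d / real x"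
proof -
  assume d: "d > 0" "d \<le> x"
  have "x < d * Suc (x div d)" using dividend_less_times_div[OF d(1)] by simp
  then have "real x \<le> real d * real (Suc (x div d))" by (simp flip: of_nat_mult of_nat_le_iff del: of_nat_Suc)
  then show ?thesis using d by (simp add: field_simps del: of_nat_Suc)
qed

text \<open>Since \<open>ln\<close> is the convolution of \<open>mangoldt\<close> with 1, the
  bounded sum of \<open>ch n * ln n / n\<close> is \<open>L\<close> times the sum in question, up to
  errors \<open>O(d / x)\<close> in the partial sums of \<open>L(1)\<close>. These add up to
  \<open>O(chebyshev_psi x / x)\<close>, and a nonzero \<open>L\<close> can be divided out.\<close>

lemma char_mangoldt_sum_bounded:
  assumes "\<not> L1_partial ch \<longlonglongrightarrow> 0"
  shows "\<exists>C. \<forall>x>0. norm (char_mangoldt_sum ch x) \<le> C"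
proof -
  obtain L where L: "L1_partial ch \<longlonglongrightarrow> L" "\<And>x. norm (L1_partial ch x - L) \<le> 2 * real N / real (Suc x)"
    using L1_partial_limit[OF dchar_partial_sum_bound[OF chi N nonprincipal]] by blast
  have L0: "L \<noteq> 0" using L(1) assms by blast
  define C where "C = 2 + 2 * real N * (ln 3 / 3) + 8 * real N"
  have "norm (char_mangoldt_sum ch x) \<le> C / norm L" if x: "x > 0" for x
  proof -
    let ?S = "\<Sum>n\<in>{1..x}. ch n * of_real (ln (real n) / real n)"
    let ?E = "\<Sum>d\<in>{1..x}. ch d * of_real (mangoldt d / real d) * (L1_partial ch (x div d) - L)"
    have "?S = (\<Sum>n\<in>{1..x}. ch n * of_real (1 / real n) * of_real (\<Sum>d | d dvd n. mangoldt d))"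
      by (intro sum.cong refl) (subst mangoldt_sum, auto)
    also have "\<dots> = (\<Sum>d\<in>{1..x}. ch d * of_real (mangoldt d / real d) * L1_partial ch (x div d))"
      by (rule char_convolution_sum)
    also have "\<dots> = L * char_mangoldt_sum ch x + ?E"
      unfolding char_mangoldt_sum_def sum_distrib_left sum.distrib[symmetric]
      by (rule sum.cong) (simp_all only: algebra_simps)
    finally have eq: "L * char_mangoldt_sum ch x = ?S - ?E" by simp
    have "norm ?E \<le> (\<Sum>d\<in>{1..x}. mangoldt d / real d * (2 * real N * (real d / real x)))"
    proof (intro order_trans[OF norm_sum] sum_mono)
      fix d assume d: "d \<in> {1..x}"
      have "norm (ch d * of_real (mangoldt d / real d)) \<le> 1 * (mangoldt d / real d)"
        unfolding norm_mult norm_of_real using norm_dchar_le[OF chi N, of d] mangoldt_nonneg[of d]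
        by (intro mult_mono) auto
      moreover have "norm (L1_partial ch (x div d) - L) \<le> 2 * real N * (real d / real x)"
        using L(2)[of "x div d"] mult_left_mono[OF inverse_Suc_div_le[of d x], of "2 * real N"] d by simp
      ultimately show "norm (ch d * of_real (mangoldt d / real d) * (L1_partial ch (x div d) - L))
        \<le> mangoldt d / real d * (2 * real N * (real d / real x))"
        unfolding norm_mult[of "ch d * of_real (mangoldt d / real d)"] using mangoldt_nonneg[of d] by (intro mult_mono) auto
    qed
    also have "\<dots> = 2 * real N / real x * chebyshev_psi x"
      unfolding chebyshev_psi_def sum_distrib_left by (intro sum.cong refl) auto
    also have "\<dots> \<le> 2 * real N / real x * (4 * real x)"
      by (intro mult_left_mono chebyshev_psi_le) auto
    also have "\<dots> = 8 * real N" using x by simp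
    finally have "norm ?E \<le> 8 * real N" .
    then have "norm (L * char_mangoldt_sum ch x) \<le> C"
      unfolding eq C_def using char_ln_sum_bounded[of x] norm_triangle_ineq4[of ?S ?E] by linarith
    then show ?thesis using L0 by (simp add: norm_mult field_simps)
  qed
  then show ?thesis by blast
qed

text \<open>The divisor sum of \<open>moebius d * ln (x / d)\<close> is \<open>mangoldt n\<close>,
  plus \<open>ln x\<close> at \<open>n = 1\<close>. When \<open>L = 0\<close>, the partial sums of
  \<open>L(1)\<close> up to \<open>x div d\<close> are themselves \<open>O(d / x)\<close>, and the
  sum of \<open>ln (x / d)\<close> is at most \<open>x\<close>.\<close>

lemma char_mangoldt_sum_vanishing:
  assumes lim: "L1_partial ch \<longlonglongrightarrow> 0" and x: "x > 0"
  shows "norm (char_mangoldt_sum ch x + of_real (ln (real x))) \<le> 2 * real N"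
proof -
  obtain L where L: "L1_partial ch \<longlonglongrightarrow> L" "\<And>x. norm (L1_partial ch x - L) \<le> 2 * real N / real (Suc x)"
    using L1_partial_limit[OF dchar_partial_sum_bound[OF chi N nonprincipal]] by blast
  have "L = 0" using L(1) lim LIMSEQ_unique by blast
  then have bd: "norm (L1_partial ch y) \<le> 2 * real N / real (Suc y)" for y using L(2)[of y] by simp
  define g where "g d = moebius d * ln (real x / real d)" for d
  have "char_mangoldt_sum ch x + of_real (ln (real x)) =
      (\<Sum>n\<in>{1..x}. ch n * of_real (1 / real n) * of_real (mangoldt n + (if n = 1 then ln (real x) else 0)))"
  proof -
    have "(\<Sum>n\<in>{1..x}. ch n * of_real (1 / real n) * of_real (mangoldt n + (if n = 1 then ln (real x) else 0))) =
      (\<Sum>n\<in>{1..x}. ch n * of_real (mangoldt n / real n) + (if n = 1 then of_real (ln (real x)) else 0))"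
      by (intro sum.cong refl) (use dchar_one[OF chi N] in \<open>auto simp: algebra_simps\<close>)
    then show ?thesis using x by (simp add: sum.distrib char_mangoldt_sum_def)
  qed
  also have "\<dots> = (\<Sum>n\<in>{1..x}. ch n * of_real (1 / real n) * of_real (\<Sum>d | d dvd n. g d))"
  proof (intro sum.cong refl arg_cong2[where f = "(*)"] arg_cong[where f = of_real])
    fix n assume n: "n \<in> {1..x}"
    have "(\<Sum>d | d dvd n. g d) = (\<Sum>d | d dvd n. moebius d * ln (real x) - moebius d * ln (real d))"
    proof (intro sum.cong refl)
      fix d assume "d \<in> {d. d dvd n}"
      then have "d > 0" using n by (auto simp: dvd_pos_nat)
      then show "g d = moebius d * ln (real x) - moebius d * ln (real d)"
        using x by (simp add: g_def ln_div algebra_simps)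
    qed
    also have "\<dots> = (\<Sum>d | d dvd n. moebius d) * ln (real x) - (\<Sum>d | d dvd n. moebius d * ln (real d))"
      by (simp add: sum_subtractf sum_distrib_right)
    finally show "mangoldt n + (if n = 1 then ln (real x) else 0) = (\<Sum>d | d dvd n. g d)"
      using n sum_moebius_divisors[of n] sum_moebius_ln[of n] by auto
  qed
  also have "\<dots> = (\<Sum>d\<in>{1..x}. ch d * of_real (g d / real d) * L1_partial ch (x div d))"
    by (rule char_convolution_sum)
  also have "norm \<dots> \<le> (\<Sum>d\<in>{1..x}. 2 * real N / real x * ln (real x / real d))"
  proof (intro order_trans[OF norm_sum] sum_mono)
    fix d assume d: "d \<in> {1..x}"
    have ln0: "ln (real x / real d) \<ge> 0" using d by (intro ln_ge_zero) auto
    have "norm (ch d * of_real (g d / real d)) \<le> 1 * (ln (real x / real d) / real d)"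
      unfolding norm_mult norm_of_real using norm_dchar_le[OF chi N, of d]
    proof (rule mult_mono)
      show "\<bar>g d / real d\<bar> \<le> ln (real x / real d) / real d"
        using ln0 abs_moebius_le[of d] mult_left_mono[of "\<bar>moebius d\<bar>" 1 "ln (real x / real d)"]
        by (simp add: g_def abs_mult divide_right_mono mult.commute)
    qed auto
    moreover have "norm (L1_partial ch (x div d)) \<le> 2 * real N * (real d / real x)"
      using bd[of "x div d"] mult_left_mono[OF inverse_Suc_div_le[of d x], of "2 * real N"] d by simp
    ultimately have "norm (ch d * of_real (g d / real d) * L1_partial ch (x div d))
        \<le> ln (real x / real d) / real d * (2 * real N * (real d / real x))"
      unfolding norm_mult[of "ch d * of_real (g d / real d)"] using ln0 by (intro mult_mono) auto
    then show "norm (ch d * of_real (g d / real d) * L1_partial ch (x div d)) \<le> 2 * real N / real x * ln (real x / real d)"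
      using d by (simp add: mult_ac)
  qed
  also have "\<dots> = 2 * real N / real x * (\<Sum>d\<in>{1..x}. ln (real x / real d))"
    by (simp add: sum_distrib_left)
  also have "\<dots> \<le> 2 * real N / real x * real x"
    by (intro mult_left_mono sum_ln_quotient_le) auto
  finally show ?thesis using x by simp
qed

end

text \<open>The sum over all characters only involves \<open>n \<equiv> 1\<close> and is nonnegative. The principal character
  contributes \<open>ln x\<close> and each vanishing one \<open>- ln x\<close>.\<close>

lemma at_most_one_vanishing:
  assumes N: "N > 0"
    and ch: "ch1 \<in> dchars N" "ch1 \<noteq> dchar0 N" "L1_partial ch1 \<longlonglongrightarrow> 0"
      "ch2 \<in> dchars N" "ch2 \<noteq> dchar0 N" "L1_partial ch2 \<longlonglongrightarrow> 0"
  shows "ch1 = ch2"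
proof (rule ccontr)
  assume neq: "ch1 \<noteq> ch2"
  let ?X = "dchars N"
  let ?Y = "?X - {dchar0 N, ch1, ch2}"
  have fin: "finite ?X" by (rule finite_dchars[OF N])
  have "\<exists>C\<ge>0. \<forall>x>0. Re (char_mangoldt_sum ch x) \<le> C" if ch: "ch \<in> ?Y" for ch
  proof (cases "L1_partial ch \<longlonglongrightarrow> 0")
    case True
    have "Re (char_mangoldt_sum ch x) \<le> 2 * real N" if x: "x > 0" for x
    proof -
      have "Re (char_mangoldt_sum ch x + of_real (ln (real x))) \<le> 2 * real N"
        using char_mangoldt_sum_vanishing[OF _ N _ True x] ch complex_Re_le_cmod order_trans by blast
      moreover have "ln (real x) \<ge> 0" using x by simp
      ultimately show ?thesis by simp
    qed
    then show ?thesis by (intro exI[of _ "2 * real N"]) auto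
  next
    case False
    then obtain C where "\<forall>x>0. norm (char_mangoldt_sum ch x) \<le> C"
      using char_mangoldt_sum_bounded[OF _ N] ch by blast
    then have "\<forall>x>0. Re (char_mangoldt_sum ch x) \<le> max 0 C"
      using complex_Re_le_cmod order_trans by (metis max.coboundedI2)
    then show ?thesis by (intro exI[of _ "max 0 C"]) auto
  qed
  then obtain C where C: "\<And>ch x. ch \<in> ?Y \<Longrightarrow> x > 0 \<Longrightarrow> Re (char_mangoldt_sum ch x) \<le> C ch"
    by metis
  \<comment> \<open>Nonnegativity of the total reads
    \<open>0 \<le> (ln x + 4) + 2 * (2 * N - ln x) + sum C ?Y\<close>.\<close>
  define K where "K = sum C ?Y + 4 + 4 * real N"
  have "ln (real x) \<le> K" if x: "x > 0" for x
  proof -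
    have "(\<Sum>ch\<in>?X. char_mangoldt_sum ch x) = (\<Sum>n\<in>{1..x}. (\<Sum>ch\<in>?X. ch n) * of_real (mangoldt n / real n))"
      unfolding char_mangoldt_sum_def by (subst sum.swap) (simp only: sum_distrib_right)
    also have "\<dots> = (\<Sum>n\<in>{1..x}. of_real ((if coprime n N \<and> [n = 1] (mod N) then real (card ?X) else 0) * (mangoldt n / real n)))"
    proof (intro sum.cong refl)
      fix n
      have "(\<Sum>ch\<in>?X. ch n) = (if coprime n N \<and> [n = 1] (mod N) then of_nat (card ?X) else 0)"
      proof (cases "coprime n N")
        case True then show ?thesis using dchar_orthogonality[OF N True] by simp
      next
        case False
        then have "ch n = 0" if "ch \<in> ?X" for ch using dchar_eq_0_iff[OF that N] by blast
        then have "(\<Sum>ch\<in>?X. ch n) = 0" by (intro sum.neutral ballI)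
        then show ?thesis using False by simp
      qed
      then show "(\<Sum>ch\<in>?X. ch n) * of_real (mangoldt n / real n) = of_real ((if coprime n N \<and> [n = 1] (mod N) then real (card ?X) else 0) * (mangoldt n / real n))"
        by simp
    qed
    finally have "Re (\<Sum>ch\<in>?X. char_mangoldt_sum ch x) \<ge> 0"
      by (auto intro!: sum_nonneg simp: mangoldt_nonneg simp del: of_real_mult of_real_divide)
    moreover have "Re (\<Sum>ch\<in>?X. char_mangoldt_sum ch x) = Re (char_mangoldt_sum (dchar0 N) x) +
       (Re (char_mangoldt_sum ch1 x) + (Re (char_mangoldt_sum ch2 x) + Re (\<Sum>ch\<in>?Y. char_mangoldt_sum ch x)))"
    proof -
      have X: "?X = insert (dchar0 N) (insert ch1 (insert ch2 ?Y))"
        using ch dchar0_dchars by auto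
      have "(\<Sum>ch\<in>?X. char_mangoldt_sum ch x) =
          (\<Sum>ch\<in>insert (dchar0 N) (insert ch1 (insert ch2 ?Y)). char_mangoldt_sum ch x)"
        by (subst X) (rule refl)
      also have "\<dots> = char_mangoldt_sum (dchar0 N) x +
          (char_mangoldt_sum ch1 x + (char_mangoldt_sum ch2 x + (\<Sum>ch\<in>?Y. char_mangoldt_sum ch x)))"
        using fin ch neq by simp
      finally show ?thesis by (simp only: plus_complex.sel)
    qed
    moreover have "Re (char_mangoldt_sum (dchar0 N) x) \<le> ln (real x) + 4"
    proof -
      have "Re (char_mangoldt_sum (dchar0 N) x) \<le> (\<Sum>n\<in>{1..x}. mangoldt n / real n)"
        unfolding char_mangoldt_sum_def Re_sum by (intro sum_mono) (auto simp: dchar0_def mangoldt_nonneg)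
      then show ?thesis using mertens(1)[OF x] by simp
    qed
    moreover have "Re (char_mangoldt_sum ch1 x) \<le> 2 * real N - ln (real x)"
      using complex_Re_le_cmod[of "char_mangoldt_sum ch1 x + of_real (ln (real x))"]
        char_mangoldt_sum_vanishing[OF ch(1) N ch(2,3) x] by simp
    moreover have "Re (char_mangoldt_sum ch2 x) \<le> 2 * real N - ln (real x)"
      using complex_Re_le_cmod[of "char_mangoldt_sum ch2 x + of_real (ln (real x))"]
        char_mangoldt_sum_vanishing[OF ch(4) N ch(5,6) x] by simp
    moreover have "Re (\<Sum>ch\<in>?Y. char_mangoldt_sum ch x) \<le> sum C ?Y"
      unfolding Re_sum by (intro sum_mono C x)
    ultimately show ?thesis unfolding K_def by linarith
  qed
  note bounded = this
  obtain m :: nat where m: "exp (K + 1) < real m" using reals_Archimedean2 by blast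
  then have m0: "m > 0" using exp_gt_zero[of "K + 1"] by (cases m) auto
  then have "K + 1 \<le> ln (real m)" using m by (subst ln_ge_iff) auto
  then show False using bounded[OF m0] by simp
qed

section \<open>Lambert series of a real character\<close>

lemma geometric_sum_ge:
  fixes t :: real
  assumes "0 \<le> t"
  shows "(\<Sum>i<n. t ^ i) \<ge> real n * sqrt t ^ (n - 1)"
proof -
  have "2 * (\<Sum>i<n. t ^ i) = (\<Sum>i<n. t ^ i + t ^ (n - Suc i))"
    using sum.nat_diff_reindex[of "\<lambda>i. t ^ i" n] by (simp add: sum.distrib)
  also have "\<dots> \<ge> (\<Sum>i<n. 2 * sqrt t ^ (n - 1))"
  \<comment> \<open>The terms \<open>t ^ i\<close> and \<open>t ^ (n - 1 - i)\<close> have the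
    geometric mean \<open>sqrt t ^ (n - 1)\<close>.\<close>
  proof (rule sum_mono)
    fix i assume i: "i \<in> {..<n}"
    have "sqrt t ^ (n - 1) = sqrt (t ^ i * t ^ (n - Suc i))"
      using i by (simp add: real_sqrt_power[symmetric] power_add[symmetric] del: real_sqrt_power)
    also have "\<dots> \<le> (t ^ i + t ^ (n - Suc i)) / 2"
      using assms by (intro arith_geo_mean_sqrt) auto
    finally show "2 * sqrt t ^ (n - 1) \<le> t ^ i + t ^ (n - Suc i)" by simp
  qed
  finally show ?thesis by simp
qed

text \<open>Monsky: if \<open>L(1)\<close> vanishes, the Lambert series of a real character is the sum of its values against
  these weights, which decrease in \<open>n\<close>. So it stays bounded as \<open>t\<close> tends to 1, although its
  coefficients are nonnegative and at least 1 at squares.\<close>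

definition lambert_weight :: "real \<Rightarrow> nat \<Rightarrow> real" where
  "lambert_weight t n = 1 / (real n * (1 - t)) - t ^ n / (1 - t ^ n)"

lemma lambert_weight_eq:
  fixes t :: real
  assumes t: "0 < t" "t < 1" and n: "n > 0"
  shows "lambert_weight t n = (1 / real n - t ^ n / (\<Sum>i<n. t ^ i)) / (1 - t)"
proof -
  have "1 - t ^ n = (1 - t) * (\<Sum>i<n. t ^ i)" by (rule one_diff_power_eq)
  then show ?thesis using t n by (simp add: lambert_weight_def diff_divide_distrib)
qed

text \<open>With \<open>s\<close> the geometric sums, the claim amounts to
  \<open>n * (n + 1) * t ^ n \<le> s n * s (n + 1)\<close>. Both factors on the right are bounded
  below by \<open>geometric_sum_ge\<close>, and
  \<open>t ^ n \<le> sqrt t ^ (2 * n - 1)\<close>.\<close>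

lemma lambert_weight_antimono:
  fixes t :: real
  assumes t: "0 < t" "t < 1" and n: "n > 0"
  shows "lambert_weight t (Suc n) \<le> lambert_weight t n"
proof -
  define s where "s n = (\<Sum>i<n. t ^ i)" for n
  have s_pos: "s k > 0" if "k > 0" for k
    unfolding s_def using t that by (intro sum_pos) auto
  have sSuc: "s (Suc n) = 1 + t * s n"
    unfolding s_def by (subst sum.lessThan_Suc_shift) (simp add: sum_distrib_left)
  have "real n * real (Suc n) * t ^ n = real n * real (Suc n) * sqrt t ^ (2 * n)"
    using t by (simp add: power_mult)
  also have "\<dots> \<le> real n * real (Suc n) * (sqrt t ^ (n - 1) * sqrt t ^ n)"
    using t n by (intro mult_left_mono) (auto simp: power_add[symmetric] intro!: power_decreasing)
  also have "\<dots> = (real n * sqrt t ^ (n - 1)) * (real (Suc n) * sqrt t ^ n)" by simp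
  also have "\<dots> \<le> s n * s (Suc n)"
    unfolding s_def using t geometric_sum_ge[of t n] geometric_sum_ge[of t "Suc n"]
    by (intro mult_mono) (auto intro!: sum_nonneg)
  finally have key: "real n * real (Suc n) * t ^ n \<le> s n * s (Suc n)" .
  have "t ^ n / s n - t ^ Suc n / s (Suc n) = t ^ n * (s (Suc n) - t * s n) / (s n * s (Suc n))"
    using s_pos[of n] s_pos[of "Suc n"] n by (simp add: field_simps)
  also have "\<dots> = t ^ n / (s n * s (Suc n))" by (simp add: sSuc)
  also have "\<dots> \<le> 1 / (real n * real (Suc n))"
    using key s_pos[of n] s_pos[of "Suc n"] n t by (simp add: divide_simps del: of_nat_Suc) (simp add: mult_ac)
  also have "\<dots> = 1 / real n - 1 / real (Suc n)" using n by (simp add: field_simps)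
  finally have "1 / real (Suc n) - t ^ Suc n / s (Suc n) \<le> 1 / real n - t ^ n / s n" by linarith
  then show ?thesis using t n
    unfolding lambert_weight_eq[OF t n] lambert_weight_eq[OF t zero_less_Suc] s_def
    by (intro divide_right_mono) (auto simp del: power_Suc of_nat_Suc sum.lessThan_Suc)
qed

lemma lambert_weight_nonneg:
  fixes t :: real
  assumes t: "0 < t" "t < 1" and n: "n > 0"
  shows "lambert_weight t n \<ge> 0"
proof -
  have "real n * t ^ n \<le> (\<Sum>i<n. t ^ i)"
  proof -
    have "(\<Sum>i<n. t ^ n) \<le> (\<Sum>i<n. t ^ i)" using t by (intro sum_mono power_decreasing) auto
    then show ?thesis by simp
  qed
  moreover have "(\<Sum>i<n. t ^ i) > 0" using t n by (intro sum_pos) auto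
  ultimately have "t ^ n / (\<Sum>i<n. t ^ i) \<le> 1 / real n" using n by (simp add: field_simps)
  then show ?thesis unfolding lambert_weight_eq[OF t n] using t by simp
qed

locale real_mult_sign =
  fixes c :: "nat \<Rightarrow> real"
  assumes mult: "c (m * n) = c m * c n" and one: "c 1 = 1" and sign: "c n \<in> {-1, 0, 1}"
begin

lemma power: "c (m ^ k) = c m ^ k"
  by (induction k) (use mult one in auto)

definition divisor_sum where "divisor_sum n = (\<Sum>d | d dvd n. c d)"

text \<open>Every divisor is uniquely of the form \<open>p ^ i * d\<close> with
  \<open>i \<le> k\<close> and \<open>d dvd m\<close>.\<close>

lemma divisor_sum_prime_power_mult:
  assumes p: "prime p" and m: "\<not> p dvd m" "m > 0"
  shows "divisor_sum (p ^ k * m) = (\<Sum>i\<le>k. c p ^ i) * divisor_sum m"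
proof -
  have p0: "p > 0" using p by (simp add: prime_gt_0_nat)
  have "bij_betw (\<lambda>(i,d). p ^ i * d) ({..k} \<times> {d. d dvd m}) {e. e dvd p ^ k * m}"
  proof (rule bij_betw_imageI)
    show "inj_on (\<lambda>(i,d). p ^ i * d) ({..k} \<times> {d. d dvd m})"
    proof (rule inj_onI, clarsimp)
      fix i d j e assume *: "d dvd m" "e dvd m" "p ^ i * d = p ^ j * e"
      have nd: "\<not> p dvd d" "\<not> p dvd e" using * m(1) dvd_trans by blast+
      have "i = j" using prime_power_cancel[of p d i e j] p nd *(3) by (simp add: mult.commute)
      then show "i = j \<and> d = e" using *(3) p0 by simp
    qed
    show "(\<lambda>(i,d). p ^ i * d) ` ({..k} \<times> {d. d dvd m}) = {e. e dvd p ^ k * m}"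
    proof (intro equalityI subsetI)
      fix e assume "e \<in> {e. e dvd p ^ k * m}"
      then obtain a b where ab: "e = a * b" "a dvd p ^ k" "b dvd m" using division_decomp by blast
      then obtain i where "i \<le> k" "a = p ^ i" using p divides_primepow_nat by blast
      then show "e \<in> (\<lambda>(i,d). p ^ i * d) ` ({..k} \<times> {d. d dvd m})" using ab by auto
    qed (auto intro!: mult_dvd_mono le_imp_power_dvd)
  qed
  then have "divisor_sum (p ^ k * m) = (\<Sum>(i,d)\<in>{..k} \<times> {d. d dvd m}. c (p ^ i * d))"
    unfolding divisor_sum_def by (subst sum.reindex_bij_betw[symmetric]) (auto simp: case_prod_unfold)
  also have "\<dots> = (\<Sum>i\<le>k. c p ^ i) * divisor_sum m"
    unfolding divisor_sum_def by (simp add: sum_product sum.cartesian_product mult power)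
  finally show ?thesis .
qed

text \<open>For the value -1 the sum alternates between 1 and 0; for the values 0 and 1 it is at
  least 1.\<close>

lemma sum_powers_nonneg: "(\<Sum>i\<le>k. c p ^ i) \<ge> 0"
  and sum_powers_even: "even k \<Longrightarrow> (\<Sum>i\<le>k. c p ^ i) \<ge> 1"
proof -
  have "(\<Sum>i\<le>k. c p ^ i) \<ge> (if even k then 1 else 0)"
  proof -
    consider "c p = -1" | "c p = 0" | "c p = 1" using sign[of p] by auto
    then show ?thesis
    proof cases
      case 1
      then have "(\<Sum>i\<le>k. c p ^ i) = (if even k then 1 else 0)" by (induction k) auto
      then show ?thesis by simp
    next
      case 2
      then have "(\<Sum>i\<le>k. c p ^ i) = 1" by (induction k) auto
      then show ?thesis by simp
    qed simp
  qed
  then show "(\<Sum>i\<le>k. c p ^ i) \<ge> 0" "even k \<Longrightarrow> (\<Sum>i\<le>k. c p ^ i) \<ge> 1"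
    by (auto split: if_splits)
qed

lemma divisor_sum_1: "divisor_sum 1 = 1"
  using one by (simp add: divisor_sum_def)

lemma prime_power_split:
  assumes "n > 1"
  obtains p k m where "prime (p::nat)" "n = p ^ k * m" "\<not> p dvd m" "m > 0" "m < n"
proof -
  obtain p where p: "prime p" "p dvd n" using assms prime_factor_nat by (metis nat_neq_iff)
  define k where "k = multiplicity p n"
  obtain m where m: "n = p ^ k * m" "\<not> p dvd m"
    unfolding k_def using multiplicity_decompose'[of n p] assms p by (metis not_prime_unit not_one_less_zero)
  have "k > 0" using p assms by (simp add: k_def prime_multiplicity_gt_zero_iff)
  then have pk: "p ^ k > 1" using prime_gt_1_nat[OF p(1)] by (intro one_less_power)
  have "m > 0" using m assms by (cases m) auto
  then have "m < p ^ k * m" using pk by simp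
  then show thesis using that[OF p(1) m \<open>m > 0\<close>] m(1) by simp
qed

lemma divisor_sum_nonneg: "n > 0 \<Longrightarrow> divisor_sum n \<ge> 0"
proof (induction n rule: less_induct)
  case (less n)
  show ?case
  proof (cases "n > 1")
    case True
    then obtain p k m where *: "prime p" "n = p ^ k * m" "\<not> p dvd m" "m > 0" "m < n"
      using prime_power_split by blast
    then show ?thesis using less.IH[of m] divisor_sum_prime_power_mult[of p m k] sum_powers_nonneg by simp
  next
    case False
    then have "n = 1" using less by simp
    then show ?thesis using divisor_sum_1 by simp
  qed
qed

lemma divisor_sum_square: "s > 0 \<Longrightarrow> divisor_sum (s ^ 2) \<ge> 1"
proof (induction s rule: less_induct)
  case (less s)
  show ?case
  proof (cases "s > 1")
    case True
    then obtain p k m where *: "prime p" "s = p ^ k * m" "\<not> p dvd m" "m > 0" "m < s"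
      using prime_power_split by blast
    have "s ^ 2 = p ^ (2 * k) * m ^ 2" using * by (simp add: power_mult_distrib power_mult[symmetric] mult.commute)
    moreover have "\<not> p dvd m ^ 2" using * prime_dvd_power by blast
    ultimately have "divisor_sum (s ^ 2) = (\<Sum>i\<le>2 * k. c p ^ i) * divisor_sum (m ^ 2)" using divisor_sum_prime_power_mult[of p "m ^ 2" "2 * k"] * by simp
    moreover have "divisor_sum (m ^ 2) \<ge> 1" using less.IH[of m] * by simp
    moreover have "(\<Sum>i\<le>2 * k. c p ^ i) \<ge> 1" by (rule sum_powers_even) simp
    ultimately show ?thesis using mult_mono[of 1 "\<Sum>i\<le>2 * k. c p ^ i" 1 "divisor_sum (m ^ 2)"] by simp
  next
    case False
    then have "s = 1" using less by simp
    then show ?thesis using divisor_sum_1 by simp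
  qed
qed

text \<open>Expanding each \<open>t ^ n / (1 - t ^ n)\<close> gives a power series with the
  coefficients \<open>divisor_sum\<close>, of which only those at squares are kept. Truncation at
  \<open>d * m \<le> M\<close> costs at most \<open>t ^ M / (1 - t)\<close> for each
  \<open>d\<close>.\<close>

lemma lambert_sum_ge:
  fixes t :: real
  assumes t: "0 < t" "t < 1" and K: "K ^ 2 \<le> M"
  shows "(\<Sum>n\<in>{1..M}. c n * (t ^ n / (1 - t ^ n))) \<ge> (\<Sum>k\<in>{1..K}. t ^ (k ^ 2)) - real M * t ^ M / (1 - t)"
proof -
  have "(\<Sum>k\<in>{1..K}. t ^ (k ^ 2)) \<le> (\<Sum>k\<in>{1..K}. divisor_sum (k ^ 2) * t ^ (k ^ 2))"
    using t divisor_sum_square by (intro sum_mono) auto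
  also have "\<dots> = (\<Sum>n\<in>(\<lambda>k. k ^ 2) ` {1..K}. divisor_sum n * t ^ n)"
    by (subst sum.reindex) (auto simp: inj_on_def)
  also have "\<dots> \<le> (\<Sum>n\<in>{1..M}. divisor_sum n * t ^ n)"
  proof (rule sum_mono2)
    have "k ^ 2 \<le> M" if "k \<le> K" for k using power_mono[OF that, of 2] K by linarith
    then show "(\<lambda>k. k ^ 2) ` {1..K} \<subseteq> {1..M}" by auto
  qed (use t divisor_sum_nonneg in auto)
  also have "\<dots> = (\<Sum>n\<in>{1..M}. \<Sum>d | d dvd n. c d * t ^ (d * (n div d)))"
    unfolding divisor_sum_def sum_distrib_right by (intro sum.cong) auto
  also have "\<dots> = (\<Sum>d\<in>{1..M}. \<Sum>m\<in>{1..M div d}. c d * t ^ (d * m))"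
    by (rule sum_divisors_swap)
  also have "\<dots> \<le> (\<Sum>d\<in>{1..M}. c d * (t ^ d / (1 - t ^ d)) + t ^ M / (1 - t))"
  proof (rule sum_mono)
    fix d assume d: "d \<in> {1..M}"
    define q where "q = M div d"
    have td: "t ^ d < 1" "t ^ d \<le> t" using t d power_decreasing[of 1 d t] by (auto simp: power_less_one_iff)
    have "(\<Sum>m\<in>{1..q}. t ^ (d * m)) = (\<Sum>m<q. t ^ d * (t ^ d) ^ m)"
      by (rule sum.reindex_bij_witness[of _ Suc "\<lambda>m. m - 1"]) (auto simp: power_mult power_add[symmetric] simp flip: power_Suc)
    also have "\<dots> = t ^ d * ((1 - (t ^ d) ^ q) / (1 - t ^ d))"
      using td by (simp add: sum_distrib_left[symmetric] sum_gp_strict)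
    also have "\<dots> = t ^ d / (1 - t ^ d) - t ^ (d * Suc q) / (1 - t ^ d)"
      by (simp add: diff_divide_distrib power_mult[symmetric] power_add right_diff_distrib)
    finally have eq: "(\<Sum>m\<in>{1..q}. t ^ (d * m)) = t ^ d / (1 - t ^ d) - t ^ (d * Suc q) / (1 - t ^ d)" .
    have "M \<le> d * Suc q" using dividend_less_times_div[of d M] d by (simp add: q_def)
    then have "t ^ (d * Suc q) / (1 - t ^ d) \<le> t ^ M / (1 - t)"
      using t td by (intro frac_le power_decreasing) auto
    moreover have "- c d * (t ^ (d * Suc q) / (1 - t ^ d)) \<le> 1 * (t ^ (d * Suc q) / (1 - t ^ d))"
      using sign[of d] t td by (intro mult_right_mono) auto
    ultimately have "- c d * (t ^ (d * Suc q) / (1 - t ^ d)) \<le> t ^ M / (1 - t)" by simp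
    moreover have "(\<Sum>m\<in>{1..q}. c d * t ^ (d * m)) = c d * (t ^ d / (1 - t ^ d)) - c d * (t ^ (d * Suc q) / (1 - t ^ d))"
      unfolding sum_distrib_left[symmetric] eq by (simp only: right_diff_distrib)
    ultimately show "(\<Sum>m\<in>{1..M div d}. c d * t ^ (d * m)) \<le> c d * (t ^ d / (1 - t ^ d)) + t ^ M / (1 - t)"
      unfolding q_def[symmetric] by linarith
  qed
  also have "\<dots> = (\<Sum>n\<in>{1..M}. c n * (t ^ n / (1 - t ^ n))) + real M * t ^ M / (1 - t)"
    by (simp add: sum.distrib)
  finally show ?thesis by simp
qed

end

lemma real_char_not_vanishing:
  assumes N: "N > 0" and ch: "ch \<in> dchars N" "ch \<noteq> dchar0 N" "L1_partial ch \<longlonglongrightarrow> 0"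
    and real: "\<And>n. cnj (ch n) = ch n"
  shows False
proof -
  define c where "c n = Re (ch n)" for n
  have chc: "ch n = of_real (c n)" for n
    using real[of n] by (simp add: c_def complex_eq_iff)
  have sign: "c n \<in> {-1, 0, 1}" for n
  proof (cases "coprime n N")
    case True
    then have "\<bar>c n\<bar> = 1" using norm_dchar[OF ch(1) N True] chc[of n] by simp
    then show ?thesis by auto
  next
    case False
    then show ?thesis using dchar_eq_0_iff[OF ch(1) N, of n] by (simp add: c_def)
  qed
  interpret real_mult_sign c
  proof
    show "c (m * n) = c m * c n" for m n
      using dchar_mult[OF ch(1) N, of m n] unfolding chc by (simp flip: of_real_mult)
    show "c 1 = 1" using dchar_one[OF ch(1) N] by (simp add: c_def)
  qed (rule sign)
  note B = dchar_partial_sum_bound[OF ch(1) N ch(2)]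
  obtain L where L: "L1_partial ch \<longlonglongrightarrow> L" "\<And>x. norm (L1_partial ch x - L) \<le> 2 * real N / real (Suc x)"
    using L1_partial_limit[OF B] by blast
  have "L = 0" using L(1) ch(3) LIMSEQ_unique by blast
  then have bd: "norm (L1_partial ch x) \<le> 2 * real N / real (Suc x)" for x using L(2)[of x] by simp
  \<comment> \<open>Summation by parts bounds the sum against the weights by \<open>2 * N\<close>,
    as \<open>lambert_weight t 1 = 1\<close>. This sum is \<open>L1_partial ch M / (1 - t)\<close>
    minus the truncated Lambert series, and the first part is \<open>O(1 / M)\<close> because
    \<open>L(1) = 0\<close>.\<close>
  have main: "(\<Sum>k\<in>{1..K}. t ^ (k ^ 2)) \<le> 2 * real N + 2 * real N / real (Suc M) / (1 - t) + real M * t ^ M / (1 - t)"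
    if t: "0 < t" "t < 1" and K: "K ^ 2 \<le> M" for t :: real and K M
  proof -
    have "(\<Sum>n\<in>{1..M}. ch n * of_real (lambert_weight t n)) =
        of_real (1 / (1 - t)) * L1_partial ch M - of_real (\<Sum>n\<in>{1..M}. c n * (t ^ n / (1 - t ^ n)))"
      unfolding L1_partial_def sum_distrib_left of_real_sum sum_subtractf[symmetric]
      by (intro sum.cong refl) (simp add: lambert_weight_def chc algebra_simps)
    moreover have "norm (\<Sum>n\<in>{1..M}. ch n * of_real (lambert_weight t n)) \<le> 2 * real N * lambert_weight t 1"
      unfolding atLeast1_atMost_eq using lambert_weight_antimono[OF t] lambert_weight_nonneg[OF t]
      by (intro abel_bound[OF B]) auto
    moreover have "lambert_weight t 1 = 1" using t by (simp add: lambert_weight_def diff_divide_distrib[symmetric])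
    ultimately have "norm (of_real (1 / (1 - t)) * L1_partial ch M - of_real (\<Sum>n\<in>{1..M}. c n * (t ^ n / (1 - t ^ n)))) \<le> 2 * real N"
      by simp
    then have "norm (of_real (\<Sum>n\<in>{1..M}. c n * (t ^ n / (1 - t ^ n))) :: complex) \<le> 2 * real N + norm (of_real (1 / (1 - t)) * L1_partial ch M)"
      using norm_triangle_sub[of "of_real (\<Sum>n\<in>{1..M}. c n * (t ^ n / (1 - t ^ n)))" "of_real (1 / (1 - t)) * L1_partial ch M"]
      by (subst (asm) (2) norm_minus_commute) linarith
    also have "norm (of_real (1 / (1 - t)) * L1_partial ch M) \<le> 1 / (1 - t) * (2 * real N / real (Suc M))"
      unfolding norm_mult norm_of_real using bd[of M] t by (intro mult_mono) (auto simp del: of_nat_Suc)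
    finally have "(\<Sum>n\<in>{1..M}. c n * (t ^ n / (1 - t ^ n))) \<le> 2 * real N + 1 / (1 - t) * (2 * real N / real (Suc M))"
      unfolding norm_of_real by linarith
    then show ?thesis using lambert_sum_ge[OF t K] by (simp add: mult.commute)
  qed
  \<comment> \<open>\<open>M\<close> tends to infinity while \<open>t\<close> is fixed.\<close>
  have le: "(\<Sum>k\<in>{1..K}. t ^ (k ^ 2)) \<le> 2 * real N" if t: "0 < t" "t < 1" for t :: real and K
  proof (rule LIMSEQ_le_const)
    have "(\<lambda>M. 2 * real N + 2 * real N / real (Suc M) / (1 - t) + real M * t ^ M / (1 - t)) \<longlonglongrightarrow> 2 * real N + 0 / (1 - t) + 0 / (1 - t)"
      using t by (intro tendsto_intros LIMSEQ_Suc[OF lim_const_over_n] powser_times_n_limit_0) auto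
    then show "(\<lambda>M. 2 * real N + 2 * real N / real (Suc M) / (1 - t) + real M * t ^ M / (1 - t)) \<longlonglongrightarrow> 2 * real N" by simp
    show "\<exists>M0. \<forall>M\<ge>M0. (\<Sum>k\<in>{1..K}. t ^ (k ^ 2)) \<le> 2 * real N + 2 * real N / real (Suc M) / (1 - t) + real M * t ^ M / (1 - t)"
      using main[OF t] by blast
  qed
  \<comment> \<open>Now \<open>t\<close> tends to 1 while \<open>K\<close> is fixed, so that
    \<open>K \<le> 2 * N\<close> for every \<open>K\<close>.\<close>
  have "(\<Sum>k\<in>{1..K}. 1 ^ (k ^ 2)) \<le> 2 * real N" for K :: nat
  proof (rule tendsto_upperbound)
    show "((\<lambda>t::real. \<Sum>k\<in>{1..K}. t ^ (k ^ 2)) \<longlongrightarrow> (\<Sum>k\<in>{1..K}. 1 ^ (k ^ 2))) (at_left 1)"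
      by (intro tendsto_intros)
    show "\<forall>\<^sub>F t::real in at_left 1. (\<Sum>k\<in>{1..K}. t ^ (k ^ 2)) \<le> 2 * real N"
      using le unfolding eventually_at_left_field by (intro exI[of _ 0]) auto
  qed auto
  from this[of "2 * N + 1"] show False by simp
qed

text \<open>If \<open>L(1)\<close> vanishes for a nonreal character, it vanishes for the conjugate
  as well, and these would be two different exceptions.\<close>

lemma L1_not_vanishing:
  assumes N: "N > 0" and ch: "ch \<in> dchars N" "ch \<noteq> dchar0 N"
  shows "\<not> L1_partial ch \<longlonglongrightarrow> 0"
proof
  assume lim: "L1_partial ch \<longlonglongrightarrow> 0"
  have "L1_partial (\<lambda>n. cnj (ch n)) = (\<lambda>x. cnj (L1_partial ch x))"
    by (auto simp: L1_partial_def)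
  moreover have "(\<lambda>x. cnj (L1_partial ch x)) \<longlonglongrightarrow> cnj 0" by (intro tendsto_intros lim)
  ultimately have lim': "L1_partial (\<lambda>n. cnj (ch n)) \<longlonglongrightarrow> 0" by simp
  have "(\<lambda>n. cnj (ch n)) \<noteq> dchar0 N"
  proof
    assume eq: "(\<lambda>n. cnj (ch n)) = dchar0 N"
    have "ch n = dchar0 N n" for n
      using fun_cong[OF eq, of n] by (metis complex_cnj_cnj complex_cnj_one complex_cnj_zero dchar0_def)
    then show False using ch(2) by blast
  qed
  then have "(\<lambda>n. cnj (ch n)) = ch"
    using at_most_one_vanishing[OF N dchars_cnj[OF ch(1)] _ lim' ch lim] by blast
  then show False using real_char_not_vanishing[OF N ch lim] by metis
qed

text \<open>The weights \<open>ch r'\<close>, with \<open>r'\<close> inverse to \<open>r\<close>,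
  single out the class of \<open>r\<close>. If it contains no prime power, the weighted total is 0.
  All terms but the principal one are bounded, while that one grows like
  \<open>ln x\<close>.\<close>

theorem primepow_in_residue_class:
  assumes N: "N > 0" and r: "coprime r N"
  obtains q where "primepow (q::nat)" "[q = r] (mod N)"
proof (rule ccontr)
  assume "\<not> thesis"
  then have none: "\<not> [n = r] (mod N)" if "primepow n" for n using that \<open>\<And>q. primepow q \<Longrightarrow> [q = r] (mod N) \<Longrightarrow> thesis\<close> by blast
  let ?X = "dchars N"
  have fin: "finite ?X" by (rule finite_dchars[OF N])
  obtain r' where r': "[r * r' = 1] (mod N)" using cong_solve_coprime_nat[OF r] by auto
  have cop': "coprime r' N"
    using cong_imp_coprime[OF cong_sym[OF r']] by simp
  have "\<forall>ch\<in>?X - {dchar0 N}. \<exists>C. \<forall>x>0. norm (char_mangoldt_sum ch x) \<le> C"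
    using char_mangoldt_sum_bounded[OF _ N] L1_not_vanishing[OF N] by auto
  then obtain C where C: "\<And>ch x. ch \<in> ?X - {dchar0 N} \<Longrightarrow> x > 0 \<Longrightarrow> norm (char_mangoldt_sum ch x) \<le> C ch"
    by metis
  define K where "K = sum C (?X - {dchar0 N}) + (\<Sum>p\<in>prime_factors N. ln (real p)) + 1"
  have "ln (real x) \<le> K" if x: "x > 0" for x
  proof -
    have "(\<Sum>ch\<in>?X. ch r' * char_mangoldt_sum ch x) = (\<Sum>n\<in>{1..x}. (\<Sum>ch\<in>?X. ch (r' * n)) * of_real (mangoldt n / real n))"
      unfolding char_mangoldt_sum_def sum_distrib_left sum_distrib_right
      by (subst sum.swap, intro sum.cong refl) (simp add: dchar_mult[OF _ N] mult_ac)
    also have "\<dots> = 0"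
    proof (intro sum.neutral ballI)
      fix n assume "n \<in> {1..x}"
      show "(\<Sum>ch\<in>?X. ch (r' * n)) * of_real (mangoldt n / real n) = 0"
      proof (cases "primepow n")
        case True
        then have nr: "\<not> [n = r] (mod N)" by (rule none)
        have "\<not> [r' * n = 1] (mod N)"
        proof
          assume "[r' * n = 1] (mod N)"
          then have "[r * (r' * n) = r * 1] (mod N)" by (rule cong_scalar_left)
          moreover have "[r * r' * n = 1 * n] (mod N)" using r' by (rule cong_scalar_right)
          ultimately have "[n = r] (mod N)" by (simp add: mult.assoc) (metis cong_sym cong_trans)
          then show False using nr by blast
        qed
        moreover have "ch (r' * n) = 0" if "\<not> coprime (r' * n) N" "ch \<in> ?X" for ch
          using dchar_eq_0_iff[OF that(2) N] that(1) by blast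
        ultimately have "(\<Sum>ch\<in>?X. ch (r' * n)) = 0"
          using dchar_orthogonality[OF N, of "r' * n"] by (cases "coprime (r' * n) N") (auto intro!: sum.neutral)
        then show ?thesis by simp
      qed (simp add: mangoldt_def)
    qed
    also have "(\<Sum>ch\<in>?X. ch r' * char_mangoldt_sum ch x) = dchar0 N r' * char_mangoldt_sum (dchar0 N) x
        + (\<Sum>ch\<in>?X - {dchar0 N}. ch r' * char_mangoldt_sum ch x)"
      by (rule sum.remove[OF fin dchar0_dchars])
    finally have "char_mangoldt_sum (dchar0 N) x = - (\<Sum>ch\<in>?X - {dchar0 N}. ch r' * char_mangoldt_sum ch x)"
      using cop' by (simp add: dchar0_def eq_neg_iff_add_eq_0)
    also have "norm \<dots> \<le> (\<Sum>ch\<in>?X - {dchar0 N}. C ch)"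
      unfolding norm_minus_cancel
    proof (intro order_trans[OF norm_sum] sum_mono)
      fix ch assume ch: "ch \<in> ?X - {dchar0 N}"
      then have "norm (ch r') * norm (char_mangoldt_sum ch x) \<le> 1 * C ch"
        using norm_dchar_le[OF _ N] C[OF ch x] by (intro mult_mono) auto
      then show "norm (ch r' * char_mangoldt_sum ch x) \<le> C ch" by (simp add: norm_mult)
    qed
    finally have "Re (char_mangoldt_sum (dchar0 N) x) \<le> sum C (?X - {dchar0 N})"
      using complex_Re_le_cmod order_trans by blast
    moreover have "Re (char_mangoldt_sum (dchar0 N) x) = (\<Sum>n | n \<in> {1..x} \<and> coprime n N. mangoldt n / real n)"
    proof -
      have "Re (char_mangoldt_sum (dchar0 N) x) = (\<Sum>n\<in>{1..x}. if coprime n N then mangoldt n / real n else 0)"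
        unfolding char_mangoldt_sum_def Re_sum by (intro sum.cong refl) (auto simp: dchar0_def)
      then show ?thesis by (simp only: sum.inter_filter finite_atLeastAtMost)
    qed
    moreover have "(\<Sum>n\<in>{1..x}. mangoldt n / real n :: real) =
        (\<Sum>n | n \<in> {1..x} \<and> coprime n N. mangoldt n / real n) + (\<Sum>n | n \<in> {1..x} \<and> \<not> coprime n N. mangoldt n / real n)"
      by (subst sum.union_disjoint[symmetric]) (auto intro!: sum.cong)
    ultimately show ?thesis
      using mertens(2)[OF x] mangoldt_noncoprime_bound[OF N, of x] unfolding K_def by linarith
  qed
  note bounded = this
  obtain m :: nat where m: "exp (K + 1) < real m" using reals_Archimedean2 by blast
  then have m0: "m > 0" using exp_gt_zero[of "K + 1"] by (cases m) auto
  then have "K + 1 \<le> ln (real m)" using m by (subst ln_ge_iff) auto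
  then show False using bounded[OF m0] by simp
qed

section \<open>Products of boundedly many conjugates\<close>

text \<open>The ball of radius \<open>k\<close> for \<open>conj_norm G S\<close>. Words of length at
  most \<open>k\<close> make it increasing in \<open>k\<close>.\<close>

definition conj_ball :: "('a, 'b) monoid_scheme \<Rightarrow> 'a set \<Rightarrow> nat \<Rightarrow> 'a set" where
  "conj_ball G S k = {foldr (\<otimes>\<^bsub>G\<^esub>) cs \<one>\<^bsub>G\<^esub> | cs. set cs \<subseteq> sym_conjugates G S \<and> length cs \<le> k}"

lemma sym_conjugatesI:
  "y \<in> carrier G \<Longrightarrow> t \<in> S \<union> (\<lambda>s. inv\<^bsub>G\<^esub> s) ` S \<Longrightarrow> y \<otimes>\<^bsub>G\<^esub> t \<otimes>\<^bsub>G\<^esub> inv\<^bsub>G\<^esub> y \<in> sym_conjugates G S"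
  unfolding sym_conjugates_def by blast

lemma sym_conjugatesE:
  assumes "c \<in> sym_conjugates G S"
  obtains y t where "c = y \<otimes>\<^bsub>G\<^esub> t \<otimes>\<^bsub>G\<^esub> inv\<^bsub>G\<^esub> y" "y \<in> carrier G" "t \<in> S \<union> (\<lambda>s. inv\<^bsub>G\<^esub> s) ` S"
  using assms unfolding sym_conjugates_def by blast

context group
begin

context
  fixes S
  assumes S: "S \<subseteq> carrier G"
begin

lemma sym_conjugates_closed: "sym_conjugates G S \<subseteq> carrier G"
  using S by (auto simp: sym_conjugates_def)

lemma foldr_closed: "set cs \<subseteq> carrier G \<Longrightarrow> foldr (\<otimes>) cs \<one> \<in> carrier G"
  by (induction cs) auto

lemma foldr_append_mult:
  "set cs \<subseteq> carrier G \<Longrightarrow> set ds \<subseteq> carrier G \<Longrightarrow>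
    foldr (\<otimes>) (cs @ ds) \<one> = foldr (\<otimes>) cs \<one> \<otimes> foldr (\<otimes>) ds \<one>"
  by (induction cs) (auto simp: m_assoc foldr_closed simp del: foldr_append)

lemma conj_ball_closed: "conj_ball G S k \<subseteq> carrier G"
  using sym_conjugates_closed by (auto simp: conj_ball_def intro!: foldr_closed)

lemma conj_ball_mono: "k \<le> l \<Longrightarrow> g \<in> conj_ball G S k \<Longrightarrow> g \<in> conj_ball G S l"
  by (fastforce simp: conj_ball_def)

lemma conj_ball_one: "\<one> \<in> conj_ball G S k"
  unfolding conj_ball_def by (intro CollectI exI[of _ "[]"]) auto

lemma conj_ball_mult:
  assumes "g \<in> conj_ball G S k" "h \<in> conj_ball G S l"
  shows "g \<otimes> h \<in> conj_ball G S (k + l)"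
proof -
  obtain cs ds where "set cs \<subseteq> sym_conjugates G S" "length cs \<le> k" "g = foldr (\<otimes>) cs \<one>"
    "set ds \<subseteq> sym_conjugates G S" "length ds \<le> l" "h = foldr (\<otimes>) ds \<one>"
    using assms by (auto simp: conj_ball_def)
  then show ?thesis unfolding conj_ball_def
    using sym_conjugates_closed
    by (intro CollectI exI[of _ "cs @ ds"]) (subst foldr_append_mult, auto)
qed

lemma sym_conjugates_conj:
  assumes "c \<in> sym_conjugates G S" "x \<in> carrier G"
  shows "x \<otimes> c \<otimes> inv x \<in> sym_conjugates G S"
proof -
  obtain y t where *: "c = y \<otimes> t \<otimes> inv y" "y \<in> carrier G" "t \<in> S \<union> (\<lambda>s. inv s) ` S"
    using assms(1) by (rule sym_conjugatesE)
  have t: "t \<in> carrier G" using * S by auto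
  have "x \<otimes> c \<otimes> inv x = (x \<otimes> y) \<otimes> t \<otimes> inv (x \<otimes> y)"
    using * t assms(2) by (simp add: m_assoc inv_mult_group)
  then show ?thesis using sym_conjugatesI[of "x \<otimes> y" G t S] * assms(2) by simp
qed

lemma sym_conjugates_inv:
  assumes "c \<in> sym_conjugates G S"
  shows "inv c \<in> sym_conjugates G S"
proof -
  obtain y t where *: "c = y \<otimes> t \<otimes> inv y" "y \<in> carrier G" "t \<in> S \<union> (\<lambda>s. inv s) ` S"
    using assms(1) by (rule sym_conjugatesE)
  have t: "t \<in> carrier G" "inv t \<in> S \<union> (\<lambda>s. inv s) ` S" using * S by auto
  have "inv c = y \<otimes> inv t \<otimes> inv y"
    using * t by (simp add: m_assoc inv_mult_group)
  then show ?thesis using sym_conjugatesI[OF *(2) t(2)] by simp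
qed

lemma conj_ball_single: "c \<in> sym_conjugates G S \<Longrightarrow> c \<in> conj_ball G S 1"
  unfolding conj_ball_def using sym_conjugates_closed
  by (intro CollectI exI[of _ "[c]"]) auto

lemma conj_ball_base: "s \<in> S \<Longrightarrow> s \<in> conj_ball G S 1"
  using sym_conjugatesI[of \<one> G s S] S by (intro conj_ball_single) auto

lemma conj_ball_induct [consumes 1, case_names one mult]:
  assumes "g \<in> conj_ball G S k"
    and "\<And>k. P k \<one>"
    and "\<And>k c h. c \<in> sym_conjugates G S \<Longrightarrow> h \<in> conj_ball G S k \<Longrightarrow> P k h \<Longrightarrow> P (Suc k) (c \<otimes> h)"
  shows "P k g"
proof -
  obtain cs where cs: "set cs \<subseteq> sym_conjugates G S" "length cs \<le> k" "g = foldr (\<otimes>) cs \<one>"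
    using assms(1) by (auto simp: conj_ball_def)
  then show ?thesis
  proof (induction cs arbitrary: g k)
    case Nil
    then show ?case using assms(2) by simp
  next
    case (Cons c cs)
    obtain l where k: "k = Suc l" using Cons by (cases k) auto
    have "foldr (\<otimes>) cs \<one> \<in> conj_ball G S l"
      using Cons k by (auto simp: conj_ball_def)
    then show ?case using assms(3) Cons k by simp
  qed
qed

lemma conj_ball_conj:
  assumes "g \<in> conj_ball G S k" "x \<in> carrier G"
  shows "x \<otimes> g \<otimes> inv x \<in> conj_ball G S k"
  using assms(1)
proof (induction rule: conj_ball_induct)
  case (one k)
  then show ?case using assms(2) conj_ball_one by simp
next
  case (mult k c h)
  have c: "c \<in> carrier G" "h \<in> carrier G" using mult sym_conjugates_closed conj_ball_closed by auto
  have "x \<otimes> (c \<otimes> h) \<otimes> inv x = (x \<otimes> c \<otimes> inv x) \<otimes> (x \<otimes> h \<otimes> inv x)"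
    using c assms(2) by (simp add: m_assoc) (simp add: m_assoc[symmetric])
  then show ?case
    using conj_ball_mult[OF conj_ball_single[OF sym_conjugates_conj[OF mult(1) assms(2)]] mult(3)] by simp
qed

lemma conj_ball_conj':
  assumes "g \<in> conj_ball G S k" "x \<in> carrier G"
  shows "inv x \<otimes> g \<otimes> x \<in> conj_ball G S k"
  using conj_ball_conj[OF assms(1), of "inv x"] assms(2) by simp

lemma conj_ball_inv:
  assumes "g \<in> conj_ball G S k"
  shows "inv g \<in> conj_ball G S k"
  using assms
proof (induction rule: conj_ball_induct)
  case (one k)
  then show ?case using conj_ball_one by simp
next
  case (mult k c h)
  have c: "c \<in> carrier G" "h \<in> carrier G" using mult sym_conjugates_closed conj_ball_closed by auto
  then have "inv (c \<otimes> h) = inv h \<otimes> inv c" by (simp add: inv_mult_group)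
  then show ?case
    using conj_ball_mult[OF mult(3) conj_ball_single[OF sym_conjugates_inv[OF mult(1)]]] by simp
qed

lemma conj_ball_commutator:
  assumes "g \<in> conj_ball G S k" "x \<in> carrier G"
  shows "g \<otimes> x \<otimes> inv g \<otimes> inv x \<in> conj_ball G S (2 * k)"
    and "x \<otimes> g \<otimes> inv x \<otimes> inv g \<in> conj_ball G S (2 * k)"
proof -
  have g: "g \<in> carrier G" using assms conj_ball_closed by blast
  have "g \<otimes> x \<otimes> inv g \<otimes> inv x = g \<otimes> (x \<otimes> inv g \<otimes> inv x)"
    using g assms by (simp add: m_assoc)
  then show "g \<otimes> x \<otimes> inv g \<otimes> inv x \<in> conj_ball G S (2 * k)"
    using conj_ball_mult[OF assms(1) conj_ball_conj[OF conj_ball_inv[OF assms(1)] assms(2)]]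
    by (simp add: mult_2)
  show "x \<otimes> g \<otimes> inv x \<otimes> inv g \<in> conj_ball G S (2 * k)"
    using conj_ball_mult[OF conj_ball_conj[OF assms] conj_ball_inv[OF assms(1)]] by (simp add: mult_2)
qed

lemma conj_ball_trans:
  assumes "T \<subseteq> conj_ball G S c" "g \<in> conj_ball G T k"
  shows "g \<in> conj_ball G S (c * k)"
proof -
  have T: "T \<subseteq> carrier G" using assms(1) conj_ball_closed by blast
  obtain cs where cs: "set cs \<subseteq> sym_conjugates G T" "length cs \<le> k" "g = foldr (\<otimes>) cs \<one>"
    using assms(2) by (auto simp: conj_ball_def)
  have one: "x \<in> conj_ball G S c" if x: "x \<in> sym_conjugates G T" for x
  proof -
    obtain y t where *: "x = y \<otimes> t \<otimes> inv y" "y \<in> carrier G" "t \<in> T \<union> (\<lambda>s. inv s) ` T"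
      using x by (rule sym_conjugatesE)
    then have "t \<in> conj_ball G S c" using assms(1) conj_ball_inv by blast
    then show ?thesis using * conj_ball_conj by blast
  qed
  have "foldr (\<otimes>) cs \<one> \<in> conj_ball G S (c * length cs)" using cs(1)
  proof (induction cs)
    case (Cons x cs)
    then show ?case using conj_ball_mult[OF one[of x], of "foldr (\<otimes>) cs \<one>" "c * length cs"] by simp
  qed (simp add: conj_ball_one)
  moreover have "c * length cs \<le> c * k" using cs(2) by simp
  ultimately show ?thesis using cs(3) conj_ball_mono by blast
qed

lemma conj_norm_le:
  assumes "g \<in> conj_ball G S k"
  shows "conj_norm G S g \<le> ereal (real k)"
proof -
  obtain cs where cs: "set cs \<subseteq> sym_conjugates G S" "length cs \<le> k" "g = foldr (\<otimes>) cs \<one>"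
    using assms(1) by (auto simp: conj_ball_def)
  have "conj_norm G S g \<le> ereal (real (length cs))"
    unfolding conj_norm_def by (rule Inf_lower) (use cs in blast)
  also have "\<dots> \<le> ereal (real k)" using cs by simp
  finally show ?thesis .
qed

definition conj_near :: "nat \<Rightarrow> 'a \<Rightarrow> 'a \<Rightarrow> bool" where
  "conj_near k g h \<longleftrightarrow> g \<in> carrier G \<and> h \<in> carrier G \<and> g \<otimes> inv h \<in> conj_ball G S k"

lemma conj_near_refl: "g \<in> carrier G \<Longrightarrow> conj_near k g g"
  by (simp add: conj_near_def conj_ball_one)

lemma conj_near_trans:
  assumes "conj_near k g h" "conj_near l h x"
  shows "conj_near (k + l) g x"
proof -
  have "g \<otimes> inv x = (g \<otimes> inv h) \<otimes> (h \<otimes> inv x)"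
    using assms unfolding conj_near_def by (simp add: m_assoc) (simp add: m_assoc[symmetric])
  then show ?thesis using assms conj_ball_mult unfolding conj_near_def by simp
qed

text \<open>The errors add up because the error of \<open>h\<close> may be conjugated by
  \<open>g\<close> without changing its radius.\<close>

lemma conj_near_mult:
  assumes "conj_near k g g'" "conj_near l h h'"
  shows "conj_near (k + l) (g \<otimes> h) (g' \<otimes> h')"
proof -
  have c: "g \<in> carrier G" "g' \<in> carrier G" "h \<in> carrier G" "h' \<in> carrier G"
    using assms by (auto simp: conj_near_def)
  have "(g \<otimes> (h \<otimes> inv h') \<otimes> inv g) \<otimes> (g \<otimes> inv g') = g \<otimes> (h \<otimes> inv h') \<otimes> (inv g \<otimes> g) \<otimes> inv g'"
    using c by (simp only: m_assoc m_closed inv_closed)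
  also have "\<dots> = g \<otimes> h \<otimes> inv (g' \<otimes> h')" using c by (simp add: m_assoc inv_mult_group)
  finally have "(g \<otimes> h) \<otimes> inv (g' \<otimes> h') = (g \<otimes> (h \<otimes> inv h') \<otimes> inv g) \<otimes> (g \<otimes> inv g')" ..
  moreover have "g \<otimes> (h \<otimes> inv h') \<otimes> inv g \<in> conj_ball G S l"
    using assms c conj_ball_conj unfolding conj_near_def by blast
  ultimately show ?thesis using c conj_ball_mult[of _ l "g \<otimes> inv g'" k] assms(1)
    unfolding conj_near_def by (simp add: add.commute)
qed

lemma conj_near_one: "conj_near k g \<one> \<longleftrightarrow> g \<in> conj_ball G S k"
  unfolding conj_near_def using conj_ball_closed[of k] by (auto dest: subsetD)

lemma conj_near_ball:
  assumes "conj_near k g h" "h \<in> conj_ball G S l"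
  shows "g \<in> conj_ball G S (k + l)"
  using conj_near_trans[OF assms(1), of l \<one>] assms(2) by (simp add: conj_near_one)

lemma conj_near_left:
  assumes "e \<in> conj_ball G S k" "g \<in> carrier G"
  shows "conj_near k (e \<otimes> g) g"
  using conj_near_mult[OF _ conj_near_refl[OF assms(2), of 0], of k e \<one>] assms conj_near_one by simp

lemma conj_near_right:
  assumes "e \<in> conj_ball G S k" "g \<in> carrier G"
  shows "conj_near k (g \<otimes> e) g"
  using conj_near_mult[OF conj_near_refl[OF assms(2), of 0], of k e \<one>] assms conj_near_one by simp

lemma conj_near_conj:
  assumes "e \<in> conj_ball G S k" "g \<in> carrier G"
  shows "conj_near (2 * k) (e \<otimes> g \<otimes> inv e) g"
  unfolding conj_near_def using conj_ball_commutator(1)[OF assms] assms conj_ball_closed by auto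

end

end

lemma conj_ball_hom:
  assumes GH: "group G" "group H" "h \<in> hom G H" and S: "S \<subseteq> carrier G" "h ` S \<subseteq> T" "T \<subseteq> carrier H"
    and g: "g \<in> conj_ball G S k"
  shows "h g \<in> conj_ball H T k"
proof -
  interpret G: group G by fact
  interpret H: group H by fact
  interpret group_hom G H h using GH by unfold_locales auto
  have sc: "h c \<in> sym_conjugates H T" if c: "c \<in> sym_conjugates G S" for c
  proof -
    obtain y t where *: "c = y \<otimes>\<^bsub>G\<^esub> t \<otimes>\<^bsub>G\<^esub> inv\<^bsub>G\<^esub> y" "y \<in> carrier G" "t \<in> S \<union> (\<lambda>s. inv\<^bsub>G\<^esub> s) ` S"
      using c by (rule sym_conjugatesE)
    have t: "t \<in> carrier G" using * S by auto
    have "h t \<in> T \<union> (\<lambda>s. inv\<^bsub>H\<^esub> s) ` T"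
    proof (cases "t \<in> S")
      case False
      then obtain s where s: "s \<in> S" "t = inv\<^bsub>G\<^esub> s" using *(3) by blast
      then have "h t = inv\<^bsub>H\<^esub> (h s)" using S(1) by auto
      then show ?thesis using s(1) S(2) by blast
    qed (use S(2) in blast)
    moreover have "h c = h y \<otimes>\<^bsub>H\<^esub> h t \<otimes>\<^bsub>H\<^esub> inv\<^bsub>H\<^esub> (h y)" using * t by simp
    ultimately show ?thesis using sym_conjugatesI[of "h y" H "h t" T] *(2) by simp
  qed
  show ?thesis
  proof (rule G.conj_ball_induct[OF S(1) g, of "\<lambda>k g. h g \<in> conj_ball H T k"])
    show "h \<one>\<^bsub>G\<^esub> \<in> conj_ball H T k" for k using H.conj_ball_one[OF S(3)] by simp
  next
    fix k c x assume *: "c \<in> sym_conjugates G S" "x \<in> conj_ball G S k" "h x \<in> conj_ball H T k"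
    have "h (c \<otimes>\<^bsub>G\<^esub> x) = h c \<otimes>\<^bsub>H\<^esub> h x"
      by (rule hom_mult[OF subsetD[OF G.sym_conjugates_closed[OF S(1)] *(1)] subsetD[OF G.conj_ball_closed[OF S(1)] *(2)]])
    then show "h (c \<otimes>\<^bsub>G\<^esub> x) \<in> conj_ball H T (Suc k)"
      using H.conj_ball_mult[OF S(3) H.conj_ball_single[OF S(3) sc[OF *(1)]] *(3)] by simp
  qed
qed

section \<open>Elementary matrices\<close>

declare index_mult_mat(1) [simp del]

lemma carrier_SL: "carrier (SL_int n) = {A \<in> carrier_mat n n. Determinant.det A = 1}"
  and mult_SL [simp]: "A \<otimes>\<^bsub>SL_int n\<^esub> B = A * B"
  and one_SL [simp]: "\<one>\<^bsub>SL_int n\<^esub> = 1\<^sub>m n"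
  by (simp_all add: SL_int_def)

abbreviation SL :: "nat \<Rightarrow> int mat set" where "SL n \<equiv> carrier (SL_int n)"

abbreviation SLinv :: "nat \<Rightarrow> int mat \<Rightarrow> int mat" where "SLinv n A \<equiv> inv\<^bsub>SL_int n\<^esub> A"

lemma SL_mat: "A \<in> SL n \<Longrightarrow> A \<in> carrier_mat n n"
  by (simp add: carrier_SL)

lemma SL_dim: "A \<in> SL n \<Longrightarrow> dim_row A = n" "A \<in> SL n \<Longrightarrow> dim_col A = n"
  by (auto simp: carrier_SL)

definition elem :: "nat \<Rightarrow> nat \<Rightarrow> nat \<Rightarrow> int \<Rightarrow> int mat" where
  "elem n i j x = mat n n (\<lambda>(r,s). (if r = s then 1 else 0) + (if r = i \<and> s = j then x else 0))"

lemma elem_dim [simp]: "dim_row (elem n i j x) = n" "dim_col (elem n i j x) = n" "elem n i j x \<in> carrier_mat n n"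
  by (auto simp: elem_def)

lemma elem_index: "r < n \<Longrightarrow> s < n \<Longrightarrow> elem n i j x $$ (r,s) = (if r = s then 1 else 0) + (if r = i \<and> s = j then x else 0)"
  by (simp add: elem_def)

lemma elem_SL: "i \<noteq> j \<Longrightarrow> elem n i j x \<in> SL n"
proof -
  assume ij: "i \<noteq> j"
  have "elem n i j x = addrow_mat n x i j"
    by (rule eq_matI) (auto simp: elem_def addrow_mat_def)
  then show ?thesis using det_addrow_mat[OF ij] by (simp add: carrier_SL)
qed

lemma mat_mult_index:
  "A \<in> carrier_mat n m \<Longrightarrow> B \<in> carrier_mat m l \<Longrightarrow> r < n \<Longrightarrow> s < l \<Longrightarrow>
    (A * B) $$ (r,s) = (\<Sum>k<m. A $$ (r,k) * B $$ (k,s))"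
  by (auto simp: index_mult_mat scalar_prod_def atLeast0LessThan)

lemma elem_mult_index:
  assumes "A \<in> carrier_mat n m" "r < n" "s < m" "j < n"
  shows "(elem n i j x * A) $$ (r,s) = A $$ (r,s) + (if r = i then x * A $$ (j,s) else 0)"
proof -
  have "(elem n i j x * A) $$ (r,s) = (\<Sum>k<n. (if k = r then A $$ (r,s) else 0) + (if k = j then (if r = i then x * A $$ (j,s) else 0) else 0))"
    unfolding mat_mult_index[OF elem_dim(3) assms(1-3)]
    by (intro sum.cong refl) (use assms in \<open>auto simp: elem_index distrib_right\<close>)
  then show ?thesis using assms by (simp add: sum.distrib)
qed

lemma mult_elem_index:
  assumes "A \<in> carrier_mat m n" "r < m" "s < n" "i < n"
  shows "(A * elem n i j x) $$ (r,s) = A $$ (r,s) + (if s = j then A $$ (r,i) * x else 0)"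
proof -
  have "(A * elem n i j x) $$ (r,s) = (\<Sum>k<n. (if k = s then A $$ (r,s) else 0) + (if k = i then (if s = j then A $$ (r,i) * x else 0) else 0))"
    unfolding mat_mult_index[OF assms(1) elem_dim(3) assms(2,3)]
    by (intro sum.cong refl) (use assms in \<open>auto simp: elem_index distrib_left\<close>)
  then show ?thesis using assms by (simp add: sum.distrib)
qed

lemma elem_add: "i \<noteq> j \<Longrightarrow> i < n \<Longrightarrow> j < n \<Longrightarrow> elem n i j x * elem n i j y = elem n i j (x + y)"
  by (rule eq_matI) (auto simp: elem_mult_index[where m = n] elem_index)

lemma elem_zero: "elem n i j 0 = 1\<^sub>m n"
  by (rule eq_matI) (auto simp: elem_index)

lemma inv_elem: "i \<noteq> j \<Longrightarrow> i < n \<Longrightarrow> j < n \<Longrightarrow> SLinv n (elem n i j x) = elem n i j (- x)"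
  using group.inv_equality[OF group_SL_int[of n], of "elem n i j (-x)" "elem n i j x"]
  by (simp add: elem_SL elem_add elem_zero)

lemma elem_commutator:
  assumes "i \<noteq> j" "j \<noteq> k" "i \<noteq> k" "i < n" "j < n" "k < n"
  shows "elem n i j x * elem n j k y * elem n i j (- x) * elem n j k (- y) = elem n i k (x * y)"
proof -
  define P where "P = elem n i j x * elem n j k y"
  define Q where "Q = P * elem n i j (- x)"
  have P: "P \<in> carrier_mat n n" unfolding P_def by (rule mult_carrier_mat[OF elem_dim(3) elem_dim(3)])
  have Q: "Q \<in> carrier_mat n n" unfolding Q_def by (rule mult_carrier_mat[OF P elem_dim(3)])
  have P_index: "P $$ (r,s) = (if r = s then 1 else 0) + (if r = i \<and> s = j then x else 0)
      + (if r = j \<and> s = k then y else 0) + (if r = i \<and> s = k then x * y else 0)" if "r < n" "s < n" for r s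
    unfolding P_def using assms that by (subst mult_elem_index[OF elem_dim(3)]) (simp_all add: elem_index)
  have Q_index: "Q $$ (r,s) = (if r = s then 1 else 0)
      + (if r = j \<and> s = k then y else 0) + (if r = i \<and> s = k then x * y else 0)" if "r < n" "s < n" for r s
    unfolding Q_def using assms that by (subst mult_elem_index[OF P]) (simp_all add: P_index)
  have "(Q * elem n j k (- y)) $$ (r,s) = elem n i k (x * y) $$ (r,s)" if "r < n" "s < n" for r s
    using assms that by (subst mult_elem_index[OF Q]) (simp_all add: Q_index elem_index)
  then have "Q * elem n j k (- y) = elem n i k (x * y)"
    using Q by (intro eq_matI) simp_all
  then show ?thesis by (simp only: P_def Q_def)
qed

lemma elem_commutator_group:
  assumes "i \<noteq> j" "j \<noteq> k" "i \<noteq> k" "i < n" "j < n" "k < n"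
  shows "elem n i k (x * y) = elem n i j x \<otimes>\<^bsub>SL_int n\<^esub> elem n j k y \<otimes>\<^bsub>SL_int n\<^esub> SLinv n (elem n i j x) \<otimes>\<^bsub>SL_int n\<^esub> SLinv n (elem n j k y)"
  using elem_commutator[OF assms] assms by (simp add: inv_elem)

lemma third_index: "n \<ge> 3 \<Longrightarrow> \<exists>l<n. l \<noteq> i \<and> l \<noteq> (j :: nat)"
  by presburger

definition elems :: "nat \<Rightarrow> int mat set" where
  "elems n = {elem n i j x | i j x. i < n \<and> j < n \<and> i \<noteq> j}"

lemma elems_SL: "elems n \<subseteq> SL n"
  by (auto simp: elems_def elem_SL)

text \<open>Commutators make this an ideal, except that the radius grows under addition and multiplication.\<close>

definition elem_ideal :: "nat \<Rightarrow> int mat set \<Rightarrow> nat \<Rightarrow> int set" where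
  "elem_ideal n S c = {x. \<forall>i<n. \<forall>j<n. i \<noteq> j \<longrightarrow> elem n i j x \<in> conj_ball (SL_int n) S c}"

context
  fixes n :: nat and S :: "int mat set"
  assumes S: "S \<subseteq> SL n"
begin

interpretation group "SL_int n" by (rule group_SL_int)

lemma elem_ideal_add: "x \<in> elem_ideal n S c \<Longrightarrow> y \<in> elem_ideal n S d \<Longrightarrow> x + y \<in> elem_ideal n S (c + d)"
  unfolding elem_ideal_def using conj_ball_mult[OF S] by (auto simp: elem_add[symmetric])

lemma elem_ideal_mono: "x \<in> elem_ideal n S c \<Longrightarrow> c \<le> d \<Longrightarrow> x \<in> elem_ideal n S d"
  unfolding elem_ideal_def using conj_ball_mono[OF S] by auto

lemma elem_ideal_0: "0 \<in> elem_ideal n S c"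
  unfolding elem_ideal_def using conj_ball_one[OF S] by (auto simp: elem_zero)

lemma elem_right:
  assumes "i \<noteq> j" "j \<noteq> k" "i \<noteq> k" "i < n" "j < n" "k < n" "elem n i j x \<in> conj_ball (SL_int n) S c"
  shows "elem n i k (x * y) \<in> conj_ball (SL_int n) S (2 * c)"
  unfolding elem_commutator_group[OF assms(1-6)]
  by (rule conj_ball_commutator(1)[OF S assms(7)]) (use assms in \<open>simp add: elem_SL\<close>)

lemma elem_left:
  assumes "i \<noteq> j" "j \<noteq> k" "i \<noteq> k" "i < n" "j < n" "k < n" "elem n j k x \<in> conj_ball (SL_int n) S c"
  shows "elem n i k (y * x) \<in> conj_ball (SL_int n) S (2 * c)"
  unfolding elem_commutator_group[OF assms(1-6)]
  by (rule conj_ball_commutator(2)[OF S assms(7)]) (use assms in \<open>simp add: elem_SL\<close>)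

lemma elem_ideal_mult:
  assumes n: "n \<ge> 3" and x: "x \<in> elem_ideal n S c"
  shows "x * y \<in> elem_ideal n S (2 * c)"
  unfolding elem_ideal_def
proof (intro CollectI allI impI)
  fix i j assume ij: "i < n" "j < n" "i \<noteq> j"
  obtain k where k: "k < n" "k \<noteq> i" "k \<noteq> j" using third_index[OF n] by blast
  show "elem n i j (x * y) \<in> conj_ball (SL_int n) S (2 * c)"
    using x k ij by (intro elem_right[of i k j]) (auto simp: elem_ideal_def)
qed

text \<open>A commutator with an elementary matrix of entry 1 moves the position within its row or
  its column and doubles the radius. At most three moves lead from \<open>(i, j)\<close> to any
  position; row \<open>j\<close> is reached through \<open>(i, l)\<close> and
  \<open>(j, l)\<close>.\<close>

lemma elem_idealI:
  assumes n: "n \<ge> 3" and ij: "i < n" "j < n" "i \<noteq> j" and x: "elem n i j x \<in> conj_ball (SL_int n) S c"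
  shows "x \<in> elem_ideal n S (8 * c)"
proof -
  obtain l where l: "l < n" "l \<noteq> i" "l \<noteq> j" using third_index[OF n] by blast
  have right: "elem n p r x \<in> conj_ball (SL_int n) S (2 * d)"
    if "elem n p q x \<in> conj_ball (SL_int n) S d" "p \<noteq> q" "q \<noteq> r" "p \<noteq> r" "p < n" "q < n" "r < n" for p q r d
    using elem_right[of p q r x d 1] that by simp
  have left: "elem n r q x \<in> conj_ball (SL_int n) S (2 * d)"
    if "elem n p q x \<in> conj_ball (SL_int n) S d" "p \<noteq> q" "q \<noteq> r" "p \<noteq> r" "p < n" "q < n" "r < n" for p q r d
    using elem_left[of r p q x d 1] that by simp
  have il: "elem n i l x \<in> conj_ball (SL_int n) S (2 * c)" by (rule right[OF x]) (use ij l in simp_all)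
  have jl: "elem n j l x \<in> conj_ball (SL_int n) S (4 * c)" using left[OF il, of j] ij l by simp
  have "elem n k m x \<in> conj_ball (SL_int n) S (8 * c)" if km: "k < n" "m < n" "k \<noteq> m" for k m
  proof -
    consider "k = i" "m = j" | "k = i" "m \<noteq> j" | "k = j" "m = l" | "k = j" "m \<noteq> l"
      | "k \<noteq> i" "k \<noteq> j" "m = j" | "k \<noteq> i" "k \<noteq> j" "m \<noteq> j" by blast
    then show ?thesis
    proof cases
      case 1
      then show ?thesis using x conj_ball_mono[OF S, of c "8 * c"] by simp
    next
      case 2
      have "elem n k m x \<in> conj_ball (SL_int n) S (2 * c)" unfolding \<open>k = i\<close> by (intro right[OF x]) (use 2 ij km in simp_all)
      then show ?thesis using conj_ball_mono[OF S, of "2 * c" "8 * c"] by simp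
    next
      case 3
      then show ?thesis using jl conj_ball_mono[OF S, of "4 * c" "8 * c"] by simp
    next
      case 4
      have "elem n j m x \<in> conj_ball (SL_int n) S (2 * (4 * c))" by (rule right[OF jl]) (use 4 ij km l in simp_all)
      then show ?thesis using 4 by simp
    next
      case 5
      have "elem n k j x \<in> conj_ball (SL_int n) S (2 * c)" by (rule left[OF x]) (use 5 ij km in simp_all)
      then show ?thesis using 5 conj_ball_mono[OF S, of "2 * c" "8 * c"] by simp
    next
      case 6
      have kj: "elem n k j x \<in> conj_ball (SL_int n) S (2 * c)" by (rule left[OF x]) (use 6 ij km in simp_all)
      have "elem n k m x \<in> conj_ball (SL_int n) S (2 * (2 * c))" by (rule right[OF kj]) (use 6 ij km in simp_all)
      then show ?thesis using conj_ball_mono[OF S, of "4 * c" "8 * c"] by simp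
    qed
  qed
  then show ?thesis by (auto simp: elem_ideal_def)
qed

end

section \<open>Mennicke symbols in SL(3,\<int>)\<close>

definition mat3 :: "int \<Rightarrow> int \<Rightarrow> int \<Rightarrow> int \<Rightarrow> int \<Rightarrow> int \<Rightarrow> int \<Rightarrow> int \<Rightarrow> int \<Rightarrow> int mat" where
  "mat3 a b c d e f g h i = mat 3 3 (\<lambda>(r,s). [[a,b,c],[d,e,f],[g,h,i]] ! r ! s)"

lemma less_3_cases: "(r::nat) < 3 \<Longrightarrow> r = 0 \<or> r = 1 \<or> r = 2"
  by auto

lemma mat3_carrier: "mat3 a b c d e f g h i \<in> carrier_mat 3 3"
  by (simp add: mat3_def)

lemma mat3_mult: "mat3 a b c d e f g h i * mat3 a' b' c' d' e' f' g' h' i' =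
   mat3 (a*a'+b*d'+c*g') (a*b'+b*e'+c*h') (a*c'+b*f'+c*i')
      (d*a'+e*d'+f*g') (d*b'+e*e'+f*h') (d*c'+e*f'+f*i')
      (g*a'+h*d'+i*g') (g*b'+h*e'+i*h') (g*c'+h*f'+i*i')"
proof (rule eq_matI)
  fix r s assume "r < dim_row (mat3 (a*a'+b*d'+c*g') (a*b'+b*e'+c*h') (a*c'+b*f'+c*i')
      (d*a'+e*d'+f*g') (d*b'+e*e'+f*h') (d*c'+e*f'+f*i')
      (g*a'+h*d'+i*g') (g*b'+h*e'+i*h') (g*c'+h*f'+i*i'))" "s < dim_col (mat3 (a*a'+b*d'+c*g') (a*b'+b*e'+c*h') (a*c'+b*f'+c*i')
      (d*a'+e*d'+f*g') (d*b'+e*e'+f*h') (d*c'+e*f'+f*i')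
      (g*a'+h*d'+i*g') (g*b'+h*e'+i*h') (g*c'+h*f'+i*i'))"
  then have rs: "r < 3" "s < 3" by (simp_all add: mat3_def)
  have three: "{..<3::nat} = {0, 1, 2}" by auto
  show "(mat3 a b c d e f g h i * mat3 a' b' c' d' e' f' g' h' i') $$ (r,s) =
    mat3 (a*a'+b*d'+c*g') (a*b'+b*e'+c*h') (a*c'+b*f'+c*i')
      (d*a'+e*d'+f*g') (d*b'+e*e'+f*h') (d*c'+e*f'+f*i')
      (g*a'+h*d'+i*g') (g*b'+h*e'+i*h') (g*c'+h*f'+i*i') $$ (r,s)"
    unfolding mat_mult_index[OF mat3_carrier mat3_carrier rs]
    using less_3_cases[OF rs(1)] less_3_cases[OF rs(2)] by (auto simp: mat3_def three)
qed (simp_all add: mat3_def)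

lemma one_mat3: "1\<^sub>m 3 = mat3 1 0 0 0 1 0 0 0 1"
  by (rule eq_matI) (auto simp: mat3_def dest!: less_3_cases)

lemma elem_mat3:
  "elem 3 0 1 x = mat3 1 x 0 0 1 0 0 0 1" "elem 3 0 2 x = mat3 1 0 x 0 1 0 0 0 1"
  "elem 3 1 0 x = mat3 1 0 0 x 1 0 0 0 1" "elem 3 1 2 x = mat3 1 0 0 0 1 x 0 0 1"
  "elem 3 2 0 x = mat3 1 0 0 0 1 0 x 0 1" "elem 3 2 1 x = mat3 1 0 0 0 1 0 0 x 1"
  by (rule eq_matI; auto simp: mat3_def elem_index dest!: less_3_cases; simp add: mat3_def elem_index)+

lemma mat3_cong:
  "a = a' \<Longrightarrow> b = b' \<Longrightarrow> c = c' \<Longrightarrow> d = d' \<Longrightarrow> e = e' \<Longrightarrow> f = f' \<Longrightarrow> g = g' \<Longrightarrow> h = h' \<Longrightarrow> i = i' \<Longrightarrow>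
   mat3 a b c d e f g h i = mat3 a' b' c' d' e' f' g' h' i'"
  by simp

text \<open>SL(2) occupies the last two coordinates, which leaves coordinate 0 free for Mennicke's
  relation.\<close>

definition sl2_block :: "int \<Rightarrow> int \<Rightarrow> int \<Rightarrow> int \<Rightarrow> int mat" where
  "sl2_block a b c d = mat3 1 0 0 0 a b 0 c d"

definition embed_corner :: "int mat \<Rightarrow> int mat" where
  "embed_corner A = four_block_mat (1\<^sub>m 1) (0\<^sub>m 1 (dim_row A)) (0\<^sub>m (dim_row A) 1) A"

lemma embed_corner_carrier: "A \<in> carrier_mat n n \<Longrightarrow> embed_corner A \<in> carrier_mat (Suc n) (Suc n)"
  unfolding embed_corner_def using four_block_carrier_mat[of "1\<^sub>m 1" 1 1 A n n] by simp

lemma embed_corner_index: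
  assumes "A \<in> carrier_mat n n" "r < Suc n" "s < Suc n"
  shows "embed_corner A $$ (r,s) = (if r = 0 \<and> s = 0 then 1 else if r = 0 \<or> s = 0 then 0 else A $$ (r - 1, s - 1))"
  using assms by (auto simp: embed_corner_def)

lemma embed_corner_mult:
  assumes "A \<in> carrier_mat n n" "B \<in> carrier_mat n n"
  shows "embed_corner (A * B) = embed_corner A * embed_corner B"
  unfolding embed_corner_def using assms
  by (subst mult_four_block_mat[of _ 1 1 _ n _ n _ _ 1 _ n]) auto

lemma det_embed_corner: "A \<in> carrier_mat n n \<Longrightarrow> Determinant.det (embed_corner A) = Determinant.det A"
  unfolding embed_corner_def by (subst det_four_block_mat_upper_right_zero[of _ 1 _ n]) auto

lemma embed_corner_SL: "A \<in> SL n \<Longrightarrow> embed_corner A \<in> SL (Suc n)"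
  using embed_corner_carrier[of A n] det_embed_corner[of A n] by (simp add: carrier_SL)

lemma embed_corner_hom: "embed_corner \<in> hom (SL_int n) (SL_int (Suc n))"
  by (rule homI) (simp_all add: embed_corner_SL embed_corner_mult[of _ n] SL_mat)

lemma embed_corner_els: "embed_corner ` elems n \<subseteq> elems (Suc n)"
proof
  fix M assume "M \<in> embed_corner ` elems n"
  then obtain i j x where *: "i < n" "j < n" "i \<noteq> j" "M = embed_corner (elem n i j x)" by (auto simp: elems_def)
  have "embed_corner (elem n i j x) = elem (Suc n) (Suc i) (Suc j) x"
    by (rule eq_matI)
      (auto simp: embed_corner_index[of _ n] elem_index embed_corner_carrier[of _ n, THEN carrier_matD(1)] embed_corner_carrier[of _ n, THEN carrier_matD(2)])
  then show "M \<in> elems (Suc n)" using * unfolding elems_def by blast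
qed

lemma embed_corner_conj_ball:
  "A \<in> conj_ball (SL_int n) (elems n) k \<Longrightarrow> embed_corner A \<in> conj_ball (SL_int (Suc n)) (elems (Suc n)) k"
  by (rule conj_ball_hom[OF group_SL_int group_SL_int embed_corner_hom elems_SL embed_corner_els elems_SL])

lemma det_m2:
  assumes "A \<in> carrier_mat 2 2"
  shows "Determinant.det A = A $$ (0,0) * A $$ (1,1) - A $$ (0,1) * A $$ (1,0)"
proof -
  have "Determinant.det A = (\<Sum>i<2. A $$ (i,0) * cofactor A i 0)"
    by (rule laplace_expansion_column[OF assms]) simp
  also have "cofactor A 0 0 = A $$ (1,1)" "cofactor A 1 0 = - A $$ (0,1)"
    unfolding cofactor_def using assms
    by (auto simp: mat_delete_def) (subst det_single; simp)+
  then have "(\<Sum>i<2. A $$ (i,0) * cofactor A i 0) = A $$ (0,0) * A $$ (1,1) - A $$ (0,1) * A $$ (1,0)"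
    by (simp add: numeral_2_eq_2)
  finally show ?thesis .
qed

lemma embed_corner_Z:
  assumes "A \<in> carrier_mat 2 2"
  shows "embed_corner A = sl2_block (A $$ (0,0)) (A $$ (0,1)) (A $$ (1,0)) (A $$ (1,1))"
  by (rule eq_matI)
    (use embed_corner_carrier[OF assms] in \<open>auto simp: sl2_block_def mat3_def embed_corner_index[OF assms] numeral_3_eq_3 less_Suc_eq\<close>)

lemma sl2_block_SL: "a * d - b * c = 1 \<Longrightarrow> sl2_block a b c d \<in> SL 3"
proof -
  assume det: "a * d - b * c = 1"
  define A where "A = mat 2 2 (\<lambda>(r,s). [[a,b],[c,d]] ! r ! s)"
  have A: "A \<in> carrier_mat 2 2" "A $$ (0,0) = a" "A $$ (0,1) = b" "A $$ (1,0) = c" "A $$ (1,1) = d"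
    by (auto simp: A_def)
  have "A \<in> SL 2" using A det det_m2[OF A(1)] by (simp add: carrier_SL)
  from embed_corner_SL[OF this] show ?thesis using embed_corner_Z[OF A(1)] A by (simp add: numeral_3_eq_3)
qed

section \<open>Matrices of SL(2,Z) up to bounded distance in SL(3,Z)\<close>

abbreviation ball3 :: "nat \<Rightarrow> int mat set" where "ball3 \<equiv> conj_ball (SL_int 3) (elems 3)"

interpretation SL3: group "SL_int 3" by (rule group_SL_int)

abbreviation near3 :: "nat \<Rightarrow> int mat \<Rightarrow> int mat \<Rightarrow> bool" where
  "near3 \<equiv> group.conj_near (SL_int 3) (elems 3)"

lemmas ball3_mult = SL3.conj_ball_mult[OF elems_SL, unfolded mult_SL]
lemmas near3_mult = SL3.conj_near_mult[OF elems_SL, unfolded mult_SL]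
lemmas near3_trans = SL3.conj_near_trans[OF elems_SL]
lemmas near3_left = SL3.conj_near_left[OF elems_SL, unfolded mult_SL]
lemmas near3_right = SL3.conj_near_right[OF elems_SL, unfolded mult_SL]
lemmas near3_ball = SL3.conj_near_ball[OF elems_SL]
lemmas ball3_mono = SL3.conj_ball_mono[OF elems_SL]

lemma ball3_elem: "i < 3 \<Longrightarrow> j < 3 \<Longrightarrow> i \<noteq> j \<Longrightarrow> elem 3 i j x \<in> ball3 1"
  by (intro SL3.conj_ball_base[OF elems_SL]) (auto simp: elems_def)

lemma ball3_elem_mult: "A \<in> ball3 k \<Longrightarrow> i < 3 \<Longrightarrow> j < 3 \<Longrightarrow> i \<noteq> j \<Longrightarrow> elem 3 i j x * A \<in> ball3 (Suc k)"
  using ball3_mult[OF ball3_elem, of i j A k x] by simp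

lemma near3_elem_mult: "near3 k A B \<Longrightarrow> i < 3 \<Longrightarrow> j < 3 \<Longrightarrow> i \<noteq> j \<Longrightarrow> near3 (Suc k) (elem 3 i j x * A) B"
  using near3_trans[OF near3_left[OF ball3_elem, of i j A x] , of k B]
  by (simp add: SL3.conj_near_def[OF elems_SL])

lemma near3_mult_elem: "near3 k A B \<Longrightarrow> i < 3 \<Longrightarrow> j < 3 \<Longrightarrow> i \<noteq> j \<Longrightarrow> near3 (Suc k) (A * elem 3 i j x) B"
  using near3_trans[OF near3_right[OF ball3_elem, of i j A x] , of k B]
  by (simp add: SL3.conj_near_def[OF elems_SL])

lemma near3_refl: "A \<in> SL 3 \<Longrightarrow> near3 0 A A"
  by (rule SL3.conj_near_refl[OF elems_SL])

text \<open>Two completions of the same first row differ by one row operation: for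
  \<open>t = c * d' - c' * d\<close> the determinants give \<open>a * t = c - c'\<close> and
  \<open>b * t = d - d'\<close>. From here on only first rows matter.\<close>

lemma sl2_block_same_row:
  assumes "a * d - b * c = 1" "a * d' - b * c' = 1"
  shows "near3 1 (sl2_block a b c d) (sl2_block a b c' d')"
proof -
  define t where "t = c * d' - c' * d"
  have ad: "a * d = 1 + b * c" and ad': "a * d' = 1 + b * c'" using assms by simp_all
  have "a * t = c * (a * d') - c' * (a * d)" by (simp add: t_def algebra_simps)
  then have 1: "a * t = c - c'" unfolding ad ad' by (simp add: algebra_simps)
  have bc: "b * c = a * d - 1" and bc': "b * c' = a * d' - 1" using assms by simp_all
  have "b * t = (b * c) * d' - (b * c') * d" by (simp add: t_def algebra_simps)
  then have 2: "b * t = d - d'" unfolding bc bc' by (simp add: algebra_simps)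
  have "sl2_block a b c d = elem 3 2 1 t * sl2_block a b c' d'"
    unfolding sl2_block_def elem_mat3 mat3_mult using 1 2 by (intro mat3_cong) (simp_all add: mult.commute)
  then show ?thesis using near3_elem_mult[OF near3_refl[OF sl2_block_SL[OF assms(2)]], of 2 1 t] by simp
qed

lemma sl2_block_col1:
  assumes "a * d - b * c = 1" "a' * d' - b * c' = 1" "[a = a'] (mod b)"
  shows "near3 2 (sl2_block a b c d) (sl2_block a' b c' d')"
proof -
  obtain t where t: "a = a' + b * t" using assms(3) by (metis cong_iff_lin cong_sym mult.commute)
  have "(a' * d' - b * c' = 1) \<Longrightarrow> a * d' - b * (c' + d' * t) = 1" unfolding t by (simp add: algebra_simps)
  then have det: "a * d' - b * (c' + d' * t) = 1" using assms(2) by simp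
  have "sl2_block a b (c' + d' * t) d' = sl2_block a' b c' d' * elem 3 2 1 t"
    unfolding sl2_block_def elem_mat3 mat3_mult t by (intro mat3_cong) simp_all
  then have "near3 1 (sl2_block a b (c' + d' * t) d') (sl2_block a' b c' d')"
    using near3_mult_elem[OF near3_refl[OF sl2_block_SL[OF assms(2)]], of 2 1 t] by simp
  from near3_trans[OF sl2_block_same_row[OF assms(1) det] this] show ?thesis by (simp add: numeral_2_eq_2)
qed

lemma sl2_block_col2:
  assumes "a * d - b * c = 1" "a * d' - b' * c' = 1" "[b = b'] (mod a)"
  shows "near3 2 (sl2_block a b c d) (sl2_block a b' c' d')"
proof -
  obtain t where t: "b = b' + a * t" using assms(3) by (metis cong_iff_lin cong_sym mult.commute)
  have "(a * d' - b' * c' = 1) \<Longrightarrow> a * (d' + c' * t) - b * c' = 1" unfolding t by (simp add: algebra_simps)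
  then have det: "a * (d' + c' * t) - b * c' = 1" using assms(2) by simp
  have "sl2_block a b c' (d' + c' * t) = sl2_block a b' c' d' * elem 3 1 2 t"
    unfolding sl2_block_def elem_mat3 mat3_mult t by (intro mat3_cong) simp_all
  then have "near3 1 (sl2_block a b c' (d' + c' * t)) (sl2_block a b' c' d')"
    using near3_mult_elem[OF near3_refl[OF sl2_block_SL[OF assms(2)]], of 1 2 t] by simp
  from near3_trans[OF sl2_block_same_row[OF assms(1) det] this] show ?thesis by (simp add: numeral_2_eq_2)
qed

text \<open>With \<open>U = elem 3 1 2 1\<close> and \<open>V = elem 3 2 1 (-1)\<close>, the block
  of \<open>U * U * V\<close> has trace 0 and determinant 1, so its square is -1.\<close>

lemma minus_one_ball3: "sl2_block (-1) 0 0 (-1) \<in> ball3 6"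
proof -
  have "sl2_block (-1) 0 0 (-1) = elem 3 1 2 1 * (elem 3 1 2 1 * (elem 3 2 1 (-1) * (elem 3 1 2 1 * (elem 3 1 2 1 * elem 3 2 1 (-1)))))"
    unfolding sl2_block_def elem_mat3 mat3_mult by (intro mat3_cong) simp_all
  moreover have "elem 3 1 2 1 * (elem 3 1 2 1 * (elem 3 2 1 (-1) * (elem 3 1 2 1 * (elem 3 1 2 1 * elem 3 2 1 (-1))))) \<in> ball3 (Suc (Suc (Suc (Suc (Suc 1)))))"
    by (intro ball3_elem_mult ball3_elem) simp_all
  ultimately show ?thesis by (simp add: eval_nat_numeral)
qed

text \<open>Column operations change the first row to \<open>(e, b)\<close> and then to
  \<open>(e, 0)\<close>; the radius is \<open>2 + 2 + 6\<close>.\<close>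

lemma sl2_block_unit_ball3:
  assumes "a * d - b * c = 1" "[a = e] (mod b)" "e = 1 \<or> e = -1"
  shows "sl2_block a b c d \<in> ball3 10"
proof -
  have ee: "e * e - b * 0 = 1" using assms(3) by auto
  have Ze: "sl2_block e 0 0 e \<in> ball3 6"
    using assms(3)
  proof
    assume "e = 1"
    then show ?thesis using SL3.conj_ball_one[OF elems_SL, of 6] by (simp add: one_mat3 sl2_block_def)
  qed (use minus_one_ball3 in simp)
  have "[b = 0] (mod e)" using assms(3) by (auto simp: cong_def)
  then have "near3 2 (sl2_block e b 0 e) (sl2_block e 0 0 e)" using ee by (intro sl2_block_col2) auto
  from near3_trans[OF sl2_block_col1[OF assms(1) ee assms(2)] this] have "near3 4 (sl2_block a b c d) (sl2_block e 0 0 e)" by simp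
  from near3_ball[OF this Ze] show ?thesis by simp
qed

text \<open>The cyclic permutation matrix. Conjugation by it moves a block from the coordinates 1, 2
  to the coordinates 2, 0.\<close>

definition rot3 :: "int mat" where "rot3 = mat3 0 0 1 1 0 0 0 1 0"

lemma rot3_ball3: "rot3 \<in> ball3 6"
proof -
  have "rot3 = elem 3 0 1 (-1) * (elem 3 0 2 1 * (elem 3 1 0 1 * (elem 3 0 1 (-1) * (elem 3 2 1 1 * elem 3 1 2 (-1)))))"
    unfolding rot3_def elem_mat3 mat3_mult by (intro mat3_cong) simp_all
  moreover have "elem 3 0 1 (-1) * (elem 3 0 2 1 * (elem 3 1 0 1 * (elem 3 0 1 (-1) * (elem 3 2 1 1 * elem 3 1 2 (-1))))) \<in> ball3 (Suc (Suc (Suc (Suc (Suc 1)))))"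
    by (intro ball3_elem_mult ball3_elem) simp_all
  ultimately show ?thesis by (simp add: eval_nat_numeral)
qed

lemma inv_rot3: "SLinv 3 rot3 = mat3 0 1 0 0 0 1 1 0 0"
proof (rule SL3.inv_equality)
  have r2: "mat3 0 1 0 0 0 1 1 0 0 = rot3 * rot3"
    unfolding rot3_def mat3_mult by (intro mat3_cong) simp_all
  show "rot3 \<in> SL 3" using rot3_ball3 SL3.conj_ball_closed[OF elems_SL] by blast
  then show "mat3 0 1 0 0 0 1 1 0 0 \<in> SL 3" unfolding r2 using SL3.m_closed by (metis mult_SL)
  show "mat3 0 1 0 0 0 1 1 0 0 \<otimes>\<^bsub>SL_int 3\<^esub> rot3 = \<one>\<^bsub>SL_int 3\<^esub>"
    unfolding rot3_def mult_SL one_SL mat3_mult one_mat3 by (intro mat3_cong) simp_all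
qed

text \<open>Mennicke's relation. The second factor is moved to the coordinates 2 and 0, where it
  overlaps with the first one only in coordinate 2; row and column operations then contract the
  product to a single block. The error is 12 for the conjugation by \<open>rot3\<close>, 3 for
  \<open>Y\<close> and 8 for \<open>P\<close>.\<close>

lemma mennicke_aux:
  assumes det: "a * d - b1 * b2 * c = 1"
  shows "near3 23 (sl2_block a (b1 * b2) c d) (sl2_block a b1 (b2 * c) d * sl2_block a b2 (b1 * c) d)"
proof -
  let ?X = "sl2_block a b1 (b2 * c) d"
  let ?A = "sl2_block a b2 (b1 * c) d"
  have X: "?X \<in> SL 3" and A: "?A \<in> SL 3"
    using det by (auto intro!: sl2_block_SL simp: algebra_simps)
  have ad: "a * d = 1 + b1 * b2 * c" using det by simp
  define R where "R = rot3 * ?A * SLinv 3 rot3"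
  have R: "near3 12 R ?A"
    unfolding R_def using SL3.conj_near_conj[OF elems_SL rot3_ball3 A] by simp
  \<comment> \<open>The three factors on the right form a signed swap of the columns 0 and
    2.\<close>
  define Y where "Y = R * elem 3 0 2 1 * elem 3 2 0 (-1) * elem 3 0 2 1"
  have "near3 (Suc (Suc (Suc 12))) Y ?A"
    unfolding Y_def by (intro near3_mult_elem R) simp_all
  from near3_mult[OF near3_refl[OF X] this] have XY: "near3 15 (?X * Y) (?X * ?A)" by simp
  have Yeq: "Y = mat3 (-(b1*c)) 0 d 0 1 0 (-a) 0 b2"
    unfolding Y_def R_def inv_rot3 unfolding rot3_def sl2_block_def elem_mat3 mat3_mult by (intro mat3_cong) simp_all
  \<comment> \<open>The column operations turn the last row into \<open>(-1, 0, 0)\<close> and clear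
    column 0 of the middle row. Two row operations then reduce the first row to
    \<open>(0, c, d)\<close>, and a signed swap of the rows 0 and 2 finishes.\<close>
  define P where "P = elem 3 2 0 1 * (elem 3 0 2 (-1) * (elem 3 2 0 1 * (elem 3 0 1 (c * d) * (elem 3 0 2 (-(b1 * c)) *
     (?X * Y * elem 3 1 0 b1 * elem 3 0 1 (b2 * c) * elem 3 0 2 (d * b2))))))"
  have "near3 (Suc (Suc (Suc (Suc (Suc (Suc (Suc (Suc 15)))))))) P (?X * ?A)"
    unfolding P_def by (intro near3_elem_mult near3_mult_elem XY) simp_all
  moreover have "P = sl2_block a (b1 * b2) c d"
  proof -
    have e1: "?X * Y * elem 3 1 0 b1 = mat3 (-(b1*c)) 0 d (b1 * (a - a)) a (b1 * b2) (b1 * (b2 * c) - d * a) (b2 * c) (d * b2)"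
      unfolding Yeq sl2_block_def elem_mat3 mat3_mult by (intro mat3_cong) (simp_all add: algebra_simps)
    have e2: "b1 * (b2 * c) - d * a = -1" using ad by (simp add: algebra_simps)
    have e3: "?X * Y * elem 3 1 0 b1 * elem 3 0 1 (b2 * c) * elem 3 0 2 (d * b2) =
       mat3 (-(b1*c)) (-(b1*b2*c*c)) (d - b1 * c * d * b2) 0 a (b1 * b2) (-1) 0 0"
      unfolding e1 e2 unfolding elem_mat3 mat3_mult by (intro mat3_cong) (simp_all add: algebra_simps)
    have e4: "elem 3 0 2 (-(b1 * c)) * mat3 (-(b1*c)) (-(b1*b2*c*c)) (d - b1 * c * d * b2) 0 a (b1 * b2) (-1) 0 0 =
       mat3 0 (-(b1*b2*c*c)) (d - b1 * c * d * b2) 0 a (b1 * b2) (-1) 0 0"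
      unfolding elem_mat3 mat3_mult by (intro mat3_cong) (simp_all add: algebra_simps)
    have e5: "elem 3 0 1 (c * d) * mat3 0 (-(b1*b2*c*c)) (d - b1 * c * d * b2) 0 a (b1 * b2) (-1) 0 0 =
       mat3 0 c d 0 a (b1 * b2) (-1) 0 0"
    proof -
      have "c * d * a = c * (a * d)" by simp
      then have "c * d * a = c + b1 * b2 * c * c" unfolding ad by (simp add: algebra_simps)
      then show ?thesis unfolding elem_mat3 mat3_mult by (intro mat3_cong) (simp_all add: algebra_simps)
    qed
    show ?thesis unfolding P_def e3 e4 e5 unfolding sl2_block_def elem_mat3 mat3_mult by (intro mat3_cong) simp_all
  qed
  ultimately show ?thesis by simp
qed


section \<open>Powers of a matrix and their first rows\<close>

lemma sl2_block_mult: "sl2_block a b c d * sl2_block a' b' c' d' = sl2_block (a*a'+b*c') (a*b'+b*d') (c*a'+d*c') (c*b'+d*d')"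
  unfolding sl2_block_def mat3_mult by (intro mat3_cong) simp_all

lemma sl2_block_1: "sl2_block 1 0 0 1 = \<one>\<^bsub>SL_int 3\<^esub>"
  by (simp add: sl2_block_def one_mat3)

text \<open>By Cayley-Hamilton \<open>M^2 = (a + d) M - 1\<close>, which gives the recursion for
  \<open>x\<close> and \<open>y\<close>. Modulo \<open>b\<close> the matrix is lower triangular, so
  the upper left entry of its power is \<open>a ^ k\<close>.\<close>

lemma sl2_block_power:
  assumes det: "a * d - b * c = 1"
  shows "\<exists>x y. sl2_block a b c d [^]\<^bsub>SL_int 3\<^esub> (k::nat) = sl2_block (x + y * a) (y * b) (y * c) (x + y * d) \<and>
    (x + y * a) * (x + y * d) - (y * b) * (y * c) = 1 \<and> [x + y * a = a ^ k] (mod b)"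
proof (induction k)
  case 0
  show ?case by (intro exI[of _ 1] exI[of _ 0]) (simp add: sl2_block_1)
next
  case (Suc k)
  then obtain x y where *: "sl2_block a b c d [^]\<^bsub>SL_int 3\<^esub> k = sl2_block (x + y * a) (y * b) (y * c) (x + y * d)"
    "(x + y * a) * (x + y * d) - (y * b) * (y * c) = 1" "[x + y * a = a ^ k] (mod b)" by blast
  define x' y' where "x' = - y" and "y' = x + y * (a + d)"
  have bc: "b * c = a * d - 1" using det by simp
  have "sl2_block a b c d [^]\<^bsub>SL_int 3\<^esub> Suc k = sl2_block (x + y * a) (y * b) (y * c) (x + y * d) * sl2_block a b c d"
    using *(1) by simp
  also have "\<dots> = sl2_block (x' + y' * a) (y' * b) (y' * c) (x' + y' * d)"
  proof -
    have "(x + y * a) * a + y * b * c = (x + y * a) * a + y * (b * c)"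
      "y * c * b + (x + y * d) * d = y * (b * c) + (x + y * d) * d" by simp_all
    then have "(x + y * a) * a + y * b * c = x' + y' * a" "y * c * b + (x + y * d) * d = x' + y' * d"
      unfolding bc by (simp_all add: x'_def y'_def algebra_simps)
    moreover have "(x + y * a) * b + y * b * d = y' * b" "y * c * a + (x + y * d) * c = y' * c"
      by (simp_all add: y'_def algebra_simps)
    ultimately show ?thesis unfolding sl2_block_mult by simp
  qed
  finally have pow: "sl2_block a b c d [^]\<^bsub>SL_int 3\<^esub> Suc k = sl2_block (x' + y' * a) (y' * b) (y' * c) (x' + y' * d)" .
  have det': "(x' + y' * a) * (x' + y' * d) - (y' * b) * (y' * c) = 1"
  proof -
    \<comment> \<open>The determinant of \<open>u + v M\<close> is a quadratic form in
      \<open>u\<close> and \<open>v\<close> that is invariant under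
      \<open>(u, v) \<mapsto> (-v, u + v (a + d))\<close>.\<close>
    have quad: "(u + v * a) * (u + v * d) - (v * b) * (v * c) = u * u + u * v * (a + d) + v * v" for u v
    proof -
      have "(u + v * a) * (u + v * d) - (v * b) * (v * c) = u * u + u * v * (a + d) + v * v * (a * d - b * c)"
        by (simp add: algebra_simps)
      then show ?thesis using det by simp
    qed
    have "x * x + x * y * (a + d) + y * y = 1" using *(2) unfolding quad .
    then show ?thesis unfolding quad by (simp add: x'_def y'_def algebra_simps)
  qed
  have "x' + y' * a = a * (x + y * a) + b * (y * c)"
  proof -
    have "a * (x + y * a) + b * (y * c) = a * (x + y * a) + y * (b * c)" by simp
    then show ?thesis unfolding bc by (simp add: x'_def y'_def algebra_simps)
  qed
  moreover have "[a * (x + y * a) + b * (y * c) = a * a ^ k + 0] (mod b)"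
    using *(3) by (intro cong_add cong_scalar_left) (auto simp: cong_0_iff)
  ultimately have "[x' + y' * a = a ^ Suc k] (mod b)" by simp
  then show ?case using pow det' by blast
qed

text \<open>Split \<open>y = g * y2\<close> with \<open>g = gcd y (x - 1)\<close>. Then
  \<open>x = 1\<close> modulo \<open>g\<close>, and \<open>x = -1\<close> modulo \<open>y2\<close>
  because \<open>y2\<close> is prime to \<open>(x - 1) div g\<close>. Mennicke's relation reduces
  the claim to these two cases.\<close>

lemma sl2_block_quadratic_ball3:
  assumes "x * d - y * c = 1" "[x * x = 1] (mod y)"
  shows "sl2_block x y c d \<in> ball3 50"
proof (cases "y = 0")
  case True
  then have "x = 1 \<or> x = -1" using assms(1) by (simp add: zmult_eq_1_iff) blast
  then show ?thesis using sl2_block_unit_ball3[OF assms(1), of x] ball3_mono[of 10 50] by simp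
next
  case False
  have "y dvd (x - 1) * (x + 1)" using assms(2) by (simp add: cong_iff_dvd_diff algebra_simps)
  define g where "g = gcd y (x - 1)"
  have g0: "g \<noteq> 0" using False by (simp add: g_def)
  define y2 z where "y2 = y div g" and "z = (x - 1) div g"
  have y2: "y = g * y2" and z: "x - 1 = g * z" by (simp_all add: y2_def z_def g_def)
  have "coprime y2 z"
    unfolding y2_def z_def g_def using False by (intro div_gcd_coprime) simp
  moreover have "y2 dvd z * (x + 1)"
  proof -
    have "g * y2 dvd g * (z * (x + 1))" using \<open>y dvd (x - 1) * (x + 1)\<close> unfolding z y2[symmetric] by (simp add: mult.assoc)
    then show ?thesis using g0 by simp
  qed
  ultimately have dvd2: "y2 dvd x + 1" by (simp add: coprime_dvd_mult_right_iff)
  have d1: "x * d - g * (y2 * c) = 1" and d2: "x * d - y2 * (g * c) = 1" and d0: "x * d - g * y2 * c = 1"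
    using assms(1) y2 by (simp_all add: algebra_simps)
  have "[x = 1] (mod g)" using z by (simp add: cong_iff_dvd_diff)
  then have 1: "sl2_block x g (y2 * c) d \<in> ball3 10" using sl2_block_unit_ball3[OF d1] by blast
  have "[x = -1] (mod y2)" using dvd2 by (simp add: cong_iff_dvd_diff)
  then have 2: "sl2_block x y2 (g * c) d \<in> ball3 10" using sl2_block_unit_ball3[OF d2] by blast
  have "near3 23 (sl2_block x y c d) (sl2_block x g (y2 * c) d * sl2_block x y2 (g * c) d)"
    using mennicke_aux[OF d0] y2 by simp
  from near3_ball[OF this ball3_mult[OF 1 2]] have "sl2_block x y c d \<in> ball3 43" by simp
  then show ?thesis using ball3_mono[of 43 50] by simp
qed

text \<open>Mennicke's relation splits the first row \<open>(u, y * b)\<close> of the power into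
  \<open>(u, y)\<close> and \<open>(u, b)\<close>. Modulo \<open>y\<close> both diagonal entries
  equal \<open>x\<close> and the determinant is 1, so \<open>u * u = 1\<close>; modulo
  \<open>b\<close> the entry \<open>u\<close> is \<open>a ^ k\<close>, hence 1 or -1.\<close>

lemma sl2_block_power_ball3:
  assumes det: "a * d - b * c = 1" and e: "[a ^ k = e] (mod b)" "e = 1 \<or> e = -1"
  shows "sl2_block a b c d [^]\<^bsub>SL_int 3\<^esub> (k::nat) \<in> ball3 90"
proof -
  obtain x y where *: "sl2_block a b c d [^]\<^bsub>SL_int 3\<^esub> k = sl2_block (x + y * a) (y * b) (y * c) (x + y * d)"
    "(x + y * a) * (x + y * d) - (y * b) * (y * c) = 1" "[x + y * a = a ^ k] (mod b)"
    using sl2_block_power[OF det] by blast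
  let ?u = "x + y * a" and ?v = "x + y * d"
  have d0: "?u * ?v - y * b * (y * c) = 1" and d1: "?u * ?v - y * (b * (y * c)) = 1" and d2: "?u * ?v - b * (y * (y * c)) = 1"
    using *(2) by (simp_all add: algebra_simps)
  have "near3 23 (sl2_block ?u (y * b) (y * c) ?v) (sl2_block ?u y (b * (y * c)) ?v * sl2_block ?u b (y * (y * c)) ?v)"
    by (rule mennicke_aux[OF d0])
  moreover have "sl2_block ?u y (b * (y * c)) ?v \<in> ball3 50"
  proof (rule sl2_block_quadratic_ball3[OF d1])
    have "?u * ?u - 1 = ?u * ?u - (?u * ?v - y * (b * (y * c)))" using d1 by simp
    also have "\<dots> = y * (?u * (a - d) + b * (y * c))" by (simp add: algebra_simps)
    finally show "[?u * ?u = 1] (mod y)" by (simp add: cong_iff_dvd_diff)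
  qed
  moreover have "sl2_block ?u b (y * (y * c)) ?v \<in> ball3 10"
    using sl2_block_unit_ball3[OF d2 cong_trans[OF *(3) e(1)] e(2)] .
  ultimately have "sl2_block ?u (y * b) (y * c) ?v \<in> ball3 (23 + (50 + 10))"
    using near3_ball ball3_mult by blast
  then show ?thesis using *(1) ball3_mono[of 83 90] by simp
qed

text \<open>This conjugation exchanges \<open>a\<close> with \<open>d\<close> and, up to sign,
  \<open>b\<close> with \<open>c\<close>, so a congruence for \<open>d\<close> modulo
  \<open>c\<close> serves as well as one for \<open>a\<close> modulo \<open>b\<close>.\<close>

lemma sl2_block_flip_conj:
  assumes det: "a * d - b * c = 1"
  shows "sl2_block a b c d = SLinv 3 (sl2_block 0 1 (-1) 0) \<otimes>\<^bsub>SL_int 3\<^esub> sl2_block d (-c) (-b) a \<otimes>\<^bsub>SL_int 3\<^esub> sl2_block 0 1 (-1) 0"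
proof -
  have J: "sl2_block 0 1 (-1) 0 \<in> SL 3" "sl2_block 0 (-1) 1 0 \<in> SL 3" by (auto intro: sl2_block_SL)
  have "SLinv 3 (sl2_block 0 1 (-1) 0) = sl2_block 0 (-1) 1 0"
    by (rule SL3.inv_equality) (use J in \<open>auto simp: sl2_block_mult sl2_block_1[simplified]\<close>)
  then show ?thesis by (simp add: sl2_block_mult)
qed

lemma (in group) conj_power:
  assumes "x \<in> carrier G" "g \<in> carrier G"
  shows "(inv x \<otimes> g \<otimes> x) [^] (k::nat) = inv x \<otimes> (g [^] k) \<otimes> x"
proof (induction k)
  case (Suc k)
  have "inv x \<otimes> (g [^] k) \<otimes> x \<otimes> (inv x \<otimes> g \<otimes> x) = inv x \<otimes> (g [^] k) \<otimes> (x \<otimes> inv x) \<otimes> g \<otimes> x"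
    using assms by (simp only: m_assoc m_closed inv_closed nat_pow_closed)
  also have "\<dots> = inv x \<otimes> (g [^] k \<otimes> g) \<otimes> x" using assms by (simp add: m_assoc)
  finally show ?case using Suc by simp
qed (use assms in simp)

lemma sl2_block_power_ball3':
  assumes det: "a * d - b * c = 1" and e: "[d ^ k = e] (mod c)" "e = 1 \<or> e = -1"
  shows "sl2_block a b c d [^]\<^bsub>SL_int 3\<^esub> (k::nat) \<in> ball3 90"
proof -
  have J: "sl2_block 0 1 (-1) 0 \<in> SL 3" by (auto intro: sl2_block_SL)
  have det': "d * a - (-c) * (-b) = 1" using det by (simp add: algebra_simps)
  have "sl2_block d (-c) (-b) a [^]\<^bsub>SL_int 3\<^esub> k \<in> ball3 90"
    by (rule sl2_block_power_ball3[OF det' _ e(2)]) (use e(1) in simp)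
  from SL3.conj_ball_conj'[OF elems_SL this J] show ?thesis
    unfolding sl2_block_flip_conj[OF det] SL3.conj_power[OF J sl2_block_SL[OF det']] .
qed

text \<open>With \<open>t\<close> the product of the primes of \<open>K\<close> that do not divide
  \<open>a\<close>, each prime of \<open>K\<close> divides exactly one of \<open>a\<close> and
  \<open>t * b\<close>.\<close>

lemma coprime_shift:
  fixes a b K :: int
  assumes ab: "coprime a b" and K: "K \<noteq> 0"
  shows "\<exists>t. coprime (a + t * b) K"
proof -
  define P where "P = {p \<in> prime_factors K. \<not> p dvd a}"
  define t where "t = \<Prod>P"
  have fin: "finite P" by (simp add: P_def)
  have "coprime (a + t * b) K"
  proof (rule ccontr)
    assume "\<not> ?thesis"
    then have "\<not> is_unit (gcd (a + t * b) K)" by (subst is_unit_gcd)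
    moreover have "gcd (a + t * b) K \<noteq> 0" using K by simp
    ultimately obtain p where "prime p" "p dvd gcd (a + t * b) K" using prime_divisor_exists by blast
    then have p: "prime p" "p dvd a + t * b" "p dvd K" by simp_all
    show False
    proof (cases "p dvd a")
      case True
      then have "p dvd t * b" using p(2) by (simp add: dvd_add_right_iff)
      moreover have "\<not> p dvd b" using True ab p(1) coprime_common_divisor not_prime_unit by blast
      ultimately have "p dvd t" using p(1) prime_dvd_mult_iff by blast
      then obtain q where q: "q \<in> P" "p dvd q"
        unfolding t_def using prime_dvd_prod_iff[OF fin p(1)] by auto
      then have "p = q" using p(1) by (intro primes_dvd_imp_eq) (auto simp: P_def in_prime_factors_imp_prime)
      then show False using True q by (simp add: P_def)
    next
      case False
      then have "p \<in> P" using p K by (auto simp: P_def prime_factors_dvd)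
      then have "p dvd t" unfolding t_def using dvd_prodI[OF fin, of p id] by simp
      then show False using p(2) False by (simp add: dvd_add_left_iff)
    qed
  qed
  then show ?thesis by blast
qed

lemma cong_int_euler:
  fixes a :: int and m :: nat
  assumes "coprime a (int m)" "m > 0"
  shows "[a ^ totient m = 1] (mod int m)"
proof -
  define A where "A = nat (a mod int m)"
  have A: "int A = a mod int m" using assms(2) by (simp add: A_def)
  have "coprime (int A) (int m)" using assms unfolding A by simp
  then have "[A ^ totient m = 1] (mod m)" by (intro euler_theorem) simp
  then have "[int (A ^ totient m) = int 1] (mod int m)" by (simp only: cong_int_iff)
  then have "[int A ^ totient m = 1] (mod int m)" by simp
  moreover have "[a ^ totient m = int A ^ totient m] (mod int m)"
    unfolding A by (intro cong_pow) (simp add: cong_def)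
  ultimately show ?thesis by (rule cong_trans[rotated])
qed

text \<open>As \<open>q = -1\<close> modulo 4, also \<open>p = 3\<close> modulo 4, so
  \<open>e\<close>, the half of \<open>totient q\<close>, is odd. A common prime of \<open>e\<close>
  and \<open>m\<close> divides \<open>q + 1\<close>; it also divides \<open>p\<close>, hence
  \<open>q\<close>, or \<open>p - 1\<close>, hence \<open>q - 1\<close>. This leaves only 2, which
  parity excludes. Being odd, \<open>p\<close> divides at most one of \<open>x ^ e - 1\<close> and
  \<open>x ^ e + 1\<close>, whose product is divisible by \<open>q\<close>.\<close>

lemma half_totient_primepow:
  fixes q m :: nat
  assumes q: "primepow q" "[int q = -1] (mod int (4 * m))" and m: "m > 0"
  obtains e where "coprime e m" "e > 0"
    "\<And>x. coprime x (int q) \<Longrightarrow> [x ^ e = 1] (mod int q) \<or> [x ^ e = -1] (mod int q)"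
proof -
  obtain p k where p: "prime p" and k: "k > 0" and qp: "q = p ^ k" using q(1) by (auto simp: primepow_def)
  have qd: "int (4 * m) dvd int q + 1" using q(2) by (simp add: cong_iff_dvd_diff)
  have q4: "4 dvd q + 1"
  proof -
    have "int 4 dvd int (q + 1)" using qd dvd_mult_left[of 4 "int m" "int q + 1"] by (simp add: add.commute)
    then show ?thesis by (simp only: int_dvd_int_iff)
  qed
  have pmod: "p mod 4 = 3"
  proof -
    have "odd q" using q4 by presburger
    then have "odd p" using qp k by simp
    then have "p mod 4 = 1 \<or> p mod 4 = 3" by presburger
    then consider "p mod 4 = 1" | "p mod 4 = 3" by blast
    then show ?thesis
    proof cases
      case 1
      then have "[p ^ k = 1 ^ k] (mod 4)" by (intro cong_pow) (simp add: cong_def)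
      then have "q mod 4 = 1" using qp by (simp add: cong_def)
      then show ?thesis using q4 by presburger
    qed
  qed
  define h where "h = (p - 1) div 2"
  have h: "p - 1 = 2 * h" "odd h" using pmod unfolding h_def by presburger+
  define e where "e = p ^ (k - 1) * h"
  have tot: "totient q = 2 * e" using totient_prime_power[OF p k] qp h(1) by (simp add: e_def)
  have odd_p: "odd p" using pmod by presburger
  have "odd e" using h(2) odd_p by (simp add: e_def)
  have "coprime e m"
  proof (rule ccontr)
    assume "\<not> coprime e m"
    then have "\<not> is_unit (gcd e m)" by (subst is_unit_gcd)
    moreover have "gcd e m \<noteq> 0" using m by simp
    ultimately obtain l where "prime l" "l dvd gcd e m" using prime_divisor_exists by blast
    then have l: "prime l" "l dvd e" "l dvd m" by simp_all
    have lodd: "l \<noteq> 2" using l(2) \<open>odd e\<close> by auto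
    have "int (4 * m) dvd int (q + 1)" using qd by (simp add: add.commute)
    then have "4 * m dvd q + 1" by (simp only: int_dvd_int_iff)
    then have lq: "l dvd q + 1" using l(3) dvd_mult dvd_trans by blast
    consider "l dvd p" | "l dvd h" using l unfolding e_def by (metis prime_dvd_mult_iff prime_dvd_power)
    then show False
    proof cases
      case 1
      then have "l dvd q" using qp k by (simp add: dvd_power_iff_le dvd_trans[OF _ dvd_power])
      then have "l dvd 1" using lq dvd_add_right_iff by blast
      then show False using l(1) by simp
    next
      case 2
      then have "[p = 1] (mod l)" using h(1) prime_gt_0_nat[OF p] by (simp add: cong_altdef_nat)
      then have "[p ^ k = 1 ^ k] (mod l)" by (rule cong_pow)
      then have "[q + 1 = 1 + 1] (mod l)" using qp by (intro cong_add) auto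
      then have "l dvd 2" using lq by (metis cong_dvd_iff one_add_one)
      then have "l = 2" using l(1) by (simp add: primes_dvd_imp_eq)
      then show False using lodd by simp
    qed
  qed
  moreover have "e > 0" using \<open>odd e\<close> by (cases e) auto
  moreover have "[x ^ e = 1] (mod int q) \<or> [x ^ e = -1] (mod int q)" if x: "coprime x (int q)" for x
  proof -
    have "q > 0" using qp prime_gt_0_nat[OF p] by simp
    then have "[x ^ (2 * e) = 1] (mod int q)" using cong_int_euler[OF x] tot by simp
    moreover have "(x ^ e - 1) * (x ^ e + 1) = x ^ (2 * e) - 1"
      unfolding mult_2 power_add by (simp add: algebra_simps)
    ultimately have dvd: "int q dvd (x ^ e - 1) * (x ^ e + 1)"
      by (simp only: cong_iff_dvd_diff)
    show ?thesis
    proof (cases "int p dvd x ^ e - 1")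
      case True
      have "\<not> int p dvd x ^ e + 1"
      proof
        assume "int p dvd x ^ e + 1"
        then have "int p dvd (x ^ e + 1) - (x ^ e - 1)" using True by (rule dvd_diff)
        then have "int p dvd int 2" by simp
        then have "p dvd 2" by (simp only: int_dvd_int_iff)
        then have "p = 2" using p by (simp add: primes_dvd_imp_eq)
        then show False using odd_p by simp
      qed
      then have "coprime (int p) (x ^ e + 1)" using p by (simp add: prime_imp_coprime)
      then have "coprime (int q) (x ^ e + 1)" using qp by simp
      then have "int q dvd x ^ e - 1" using dvd by (simp add: coprime_dvd_mult_left_iff)
      then show ?thesis by (simp add: cong_iff_dvd_diff)
    next
      case False
      then have "coprime (int p) (x ^ e - 1)" using p by (simp add: prime_imp_coprime)
      then have "coprime (int q) (x ^ e - 1)" using qp by simp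
      then have "int q dvd x ^ e + 1" using dvd by (simp add: coprime_dvd_mult_right_iff)
      then show ?thesis by (simp add: cong_iff_dvd_diff)
    qed
  qed
  ultimately show thesis using that by blast
qed

text \<open>For \<open>m * u = e * v + 1\<close> the matrix is the quotient of its powers with the
  exponents \<open>m * u\<close> and \<open>e * v\<close>, each of radius 90.\<close>

lemma sl2_block_coprime_exponents_ball3:
  assumes det: "a * d - b * c = 1"
    and m: "[a ^ m = 1] (mod b)" "m > 0"
    and e: "[d ^ e = 1] (mod c) \<or> [d ^ e = -1] (mod c)" "e > 0" "coprime m e"
  shows "sl2_block a b c d \<in> ball3 180"
proof -
  have M: "sl2_block a b c d \<in> SL 3" by (rule sl2_block_SL[OF det])
  obtain u v where uv: "m * u = e * v + 1"
  proof (cases "e = 1")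
    case True
    then show ?thesis using that[of 1 "m - 1"] m(2) by simp
  next
    case False
    then show ?thesis using coprime_bezout_strong[OF e(3)] that by blast
  qed
  have "[a ^ (m * u) = 1] (mod b)" using cong_pow[OF m(1), of u] by (simp add: power_mult)
  then have 1: "sl2_block a b c d [^]\<^bsub>SL_int 3\<^esub> (m * u) \<in> ball3 90" by (rule sl2_block_power_ball3[OF det]) simp
  have "[d ^ (e * v) = 1] (mod c) \<or> [d ^ (e * v) = (-1) ^ v] (mod c)"
    using e(1) cong_pow[of "d ^ e" 1 c v] cong_pow[of "d ^ e" "-1" c v] by (auto simp: power_mult)
  moreover have "(-1::int) ^ v = 1 \<or> (-1::int) ^ v = -1" by (cases "even v") auto
  ultimately have 2: "sl2_block a b c d [^]\<^bsub>SL_int 3\<^esub> (e * v) \<in> ball3 90"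
    using sl2_block_power_ball3'[OF det, of "e * v" 1] sl2_block_power_ball3'[OF det, of "e * v" "(-1) ^ v"] by blast
  have eq: "sl2_block a b c d [^]\<^bsub>SL_int 3\<^esub> (m * u) = (sl2_block a b c d [^]\<^bsub>SL_int 3\<^esub> (e * v)) \<otimes>\<^bsub>SL_int 3\<^esub> sl2_block a b c d"
    unfolding uv by simp
  have "sl2_block a b c d = SLinv 3 (sl2_block a b c d [^]\<^bsub>SL_int 3\<^esub> (e * v)) \<otimes>\<^bsub>SL_int 3\<^esub> (sl2_block a b c d [^]\<^bsub>SL_int 3\<^esub> (m * u))"
    using M eq by (intro SL3.inv_solve_left[THEN iffD2] SL3.nat_pow_closed)
  moreover have "SLinv 3 (sl2_block a b c d [^]\<^bsub>SL_int 3\<^esub> (e * v)) \<otimes>\<^bsub>SL_int 3\<^esub> (sl2_block a b c d [^]\<^bsub>SL_int 3\<^esub> (m * u)) \<in> ball3 (90 + 90)"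
    by (rule SL3.conj_ball_mult[OF elems_SL SL3.conj_ball_inv[OF elems_SL 2] 1])
  ultimately show ?thesis by simp
qed

text \<open>The exponent \<open>m\<close> depends on \<open>b\<close> only. So \<open>a\<close> may
  be shifted by a multiple of \<open>b\<close> to become prime to \<open>4 * m\<close>, and then
  \<open>c\<close> by a multiple of the new \<open>a'\<close> to become a prime power that is -1
  modulo \<open>4 * m\<close>. The error of these changes is 2.\<close>

lemma sl2_block_ball3:
  assumes det: "a * d - b * c = 1"
  shows "sl2_block a b c d \<in> ball3 200"
proof (cases "b = 0")
  case True
  then have "a = 1 \<or> a = -1" using det by (simp add: zmult_eq_1_iff) blast
  then show ?thesis using sl2_block_unit_ball3[OF det, of a] ball3_mono[of 10 200] by simp
next
  case False
  define m where "m = totient (nat \<bar>b\<bar>)"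
  have m: "m > 0" using False by (simp add: m_def)
  have "coprime a b"
    using det by (metis coprimeI dvd_diff dvd_mult2)
  then obtain t where t: "coprime (a + t * b) (int (4 * m))" using coprime_shift[of a b "int (4 * m)"] m by auto
  define a' c' where "a' = a + t * b" and "c' = c + t * d"
  have det': "a' * d - b * c' = 1" using det by (simp add: a'_def c'_def algebra_simps)
  have a'0: "a' \<noteq> 0"
  proof
    assume "a' = 0"
    then have "is_unit (int (4 * m))" using t by (simp add: a'_def)
    then show False using m by simp
  qed
  define K where "K = int (4 * m)"
  have cop: "coprime a' K" using t by (simp add: a'_def K_def)
  \<comment> \<open>Since \<open>a'\<close> is prime to \<open>K\<close>, the residues
    \<open>c'\<close> modulo \<open>a'\<close> and -1 modulo \<open>K\<close> can be prescribed
    together.\<close>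
  obtain x where x: "[x = c'] (mod a')" "[x = -1] (mod K)"
    using binary_chinese_remainder_int[OF cop, of c' "-1"] by blast
  define N where "N = nat \<bar>a'\<bar> * (4 * m)"
  have N: "N > 0" "int N = \<bar>a'\<bar> * K" using a'0 m by (simp_all add: N_def K_def)
  define r where "r = nat (x mod int N)"
  have r: "int r = x mod int N" using N(1) by (simp add: r_def)
  have dvdN: "a' dvd int N" "K dvd int N" by (simp_all add: N(2))
  \<comment> \<open>The progression has to consist of units: modulo \<open>a'\<close> this holds
    because \<open>b * c' = -1\<close>, modulo \<open>K\<close> because
    \<open>x = -1\<close>.\<close>
  have xa: "coprime x a'"
  proof -
    have "[b * x = b * c'] (mod a')" using x(1) by (rule cong_scalar_left)
    moreover have "[b * c' = -1] (mod a')" using det' by (simp add: cong_iff_dvd_diff) (metis add.commute diff_add_cancel dvd_triv_left)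
    ultimately have "coprime (b * x) a'" using cong_imp_coprime[of "-1" "b * x" a'] by (meson cong_sym cong_trans coprime_minus_left_iff coprime_1_left)
    then show ?thesis by simp
  qed
  have xK: "coprime x K" using cong_imp_coprime[OF cong_sym[OF x(2)]] by simp
  have "coprime x (int N)" using xa xK by (simp add: N(2))
  then have "coprime (int r) (int N)" unfolding r using N(1) by simp
  then have "coprime r N" by simp
  then obtain q where q: "primepow q" "[q = r] (mod N)" using primepow_in_residue_class[OF N(1)] by blast
  have "[int q = int r] (mod int N)" using q(2) by (simp only: cong_int_iff)
  then have qx: "[int q = x] (mod int N)" unfolding r by (simp add: cong_def)
  have qa: "[int q = c'] (mod a')" using cong_trans[OF cong_dvd_modulus[OF qx dvdN(1)] x(1)] .
  have qK: "[int q = -1] (mod int (4 * m))" using cong_trans[OF cong_dvd_modulus[OF qx dvdN(2)] x(2)] by (simp add: K_def)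
  obtain e where e: "coprime e m" "e > 0"
    "\<And>x. coprime x (int q) \<Longrightarrow> [x ^ e = 1] (mod int q) \<or> [x ^ e = -1] (mod int q)"
    using half_totient_primepow[OF q(1) qK m] by blast
  obtain s where s: "int q = c' + a' * s" using qa by (metis cong_iff_lin cong_sym mult.commute)
  define d' where "d' = d + b * s"
  have det'': "a' * d' - b * int q = 1" using det' by (simp add: s d'_def algebra_simps)
  have am: "[a' ^ m = 1] (mod b)"
  proof -
    have "coprime a' (int (nat \<bar>b\<bar>))" using det' by simp (metis coprimeI dvd_diff dvd_mult2)
    from cong_int_euler[OF this] show ?thesis using False by (simp add: m_def cong_iff_dvd_diff)
  qed
  have "coprime d' (int q)" using det'' by (metis coprimeI dvd_diff dvd_mult)
  then have "sl2_block a' b (int q) d' \<in> ball3 180"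
    using e am m det'' by (intro sl2_block_coprime_exponents_ball3[of a' d' b "int q" m e]) (auto simp: coprime_commute)
  moreover have "near3 2 (sl2_block a b c d) (sl2_block a' b (int q) d')"
    by (rule sl2_block_col1[OF det det'']) (simp add: a'_def cong_iff_dvd_diff)
  ultimately have "sl2_block a b c d \<in> ball3 182" using near3_ball by fastforce
  then show ?thesis using ball3_mono[of 182 200] by simp
qed

section \<open>Reduction of the dimension\<close>

text \<open>The stable range condition for \<int>. After a shift that makes the first entry
  \<open>a'\<close> nonzero, \<open>gcd b w\<close> is prime to \<open>a'\<close> by the hypothesis,
  and \<open>coprime_shift\<close> applies to the quotients of \<open>b\<close> and \<open>w\<close>
  by it.\<close>

lemma coprime_shift2:
  fixes a b w :: int
  assumes "x * a + y * b + w = 1"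
  shows "\<exists>s t. coprime (a + s * w) (b + t * w)"
proof -
  have "\<exists>s. a + s * w \<noteq> 0 \<or> w = 0"
  proof (cases "a = 0")
    case True
    then show ?thesis by (intro exI[of _ 1]) simp
  next
    case False
    then show ?thesis by (intro exI[of _ 0]) simp
  qed
  then obtain s where s: "a + s * w \<noteq> 0 \<or> w = 0" by blast
  show ?thesis
  proof (cases "w = 0")
    case True
    then have "coprime a b" using assms
      by (metis add.right_neutral coprimeI dvd_add dvd_mult)
    then show ?thesis using True by auto
  next
    case False
    define a' where "a' = a + s * w"
    have a'0: "a' \<noteq> 0" using s False by (simp add: a'_def)
    define g where "g = gcd b w"
    have g0: "g \<noteq> 0" using False by (simp add: g_def)
    obtain b1 w1 where bw: "b = g * b1" "w = g * w1" by (metis dvdE g_def gcd_dvd1 gcd_dvd2)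
    have "coprime b1 w1"
    proof -
      have "coprime (b div g) (w div g)" unfolding g_def using False by (intro div_gcd_coprime) simp
      then show ?thesis using bw g0 by simp
    qed
    then obtain t where t: "coprime (b1 + t * w1) a'" using coprime_shift[of b1 w1 a'] a'0 by blast
    have "coprime g a'"
    proof (rule coprimeI)
      fix d assume d: "d dvd g" "d dvd a'"
      have "d dvd b" "d dvd w" using d(1) bw by auto
      moreover from this have "d dvd a" using d(2) by (simp add: a'_def dvd_add_left_iff)
      ultimately have "d dvd x * a + y * b + w" by simp
      then show "is_unit d" using assms by simp
    qed
    then have "coprime (g * (b1 + t * w1)) a'" using t by simp
    moreover have "g * (b1 + t * w1) = b + t * w" by (simp add: bw algebra_simps)
    ultimately have "coprime a' (b + t * w)" by (simp add: coprime_commute)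
    then show ?thesis unfolding a'_def by blast
  qed
qed

section \<open>Row and column operations, clearing a column\<close>

definition rowop :: "nat \<Rightarrow> nat \<Rightarrow> (nat \<Rightarrow> int) \<Rightarrow> int mat" where
  "rowop n i f = mat n n (\<lambda>(r,s). (if r = s then 1 else 0) + (if r = i then f s else 0))"

definition colop :: "nat \<Rightarrow> nat \<Rightarrow> (nat \<Rightarrow> int) \<Rightarrow> int mat" where
  "colop n j f = mat n n (\<lambda>(r,s). (if r = s then 1 else 0) + (if s = j then f r else 0))"

lemma rowop_carrier [simp]: "rowop n i f \<in> carrier_mat n n" "dim_row (rowop n i f) = n" "dim_col (rowop n i f) = n"
  and colop_carrier [simp]: "colop n j f \<in> carrier_mat n n" "dim_row (colop n j f) = n" "dim_col (colop n j f) = n"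
  by (simp_all add: rowop_def colop_def)

lemma rowop_index: "r < n \<Longrightarrow> s < n \<Longrightarrow> rowop n i f $$ (r,s) = (if r = s then 1 else 0) + (if r = i then f s else 0)"
  and colop_index: "r < n \<Longrightarrow> s < n \<Longrightarrow> colop n j f $$ (r,s) = (if r = s then 1 else 0) + (if s = j then f r else 0)"
  by (simp_all add: rowop_def colop_def)

lemma rowop_mult_index:
  assumes "A \<in> carrier_mat n m" "r < n" "s < m"
  shows "(rowop n i f * A) $$ (r,s) = A $$ (r,s) + (if r = i then \<Sum>k<n. f k * A $$ (k,s) else 0)"
proof -
  have "(rowop n i f * A) $$ (r,s) = (\<Sum>k<n. (if k = r then A $$ (r,s) else 0) + (if r = i then f k * A $$ (k,s) else 0))"
    unfolding mat_mult_index[OF rowop_carrier(1) assms]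
    by (intro sum.cong refl) (use assms in \<open>auto simp: rowop_index distrib_right\<close>)
  then show ?thesis using assms by (simp add: sum.distrib)
qed

lemma colop_mult_index:
  assumes "A \<in> carrier_mat n m" "r < n" "s < m" "j < n"
  shows "(colop n j f * A) $$ (r,s) = A $$ (r,s) + f r * A $$ (j,s)"
proof -
  have "(colop n j f * A) $$ (r,s) = (\<Sum>k<n. (if k = r then A $$ (r,s) else 0) + (if k = j then f r * A $$ (j,s) else 0))"
    unfolding mat_mult_index[OF colop_carrier(1) assms(1-3)]
    by (intro sum.cong refl) (use assms in \<open>auto simp: colop_index distrib_right\<close>)
  then show ?thesis using assms by (simp add: sum.distrib)
qed

abbreviation elem_ball :: "nat \<Rightarrow> nat \<Rightarrow> int mat set" where "elem_ball n \<equiv> conj_ball (SL_int n) (elems n)"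

lemmas elem_ball_mult = group.conj_ball_mult[OF group_SL_int elems_SL, unfolded mult_SL]
lemmas elem_ball_mono = group.conj_ball_mono[OF group_SL_int elems_SL]
lemmas elem_ball_one = group.conj_ball_one[OF group_SL_int elems_SL, unfolded one_SL]
lemmas elem_ball_inv = group.conj_ball_inv[OF group_SL_int elems_SL]

lemma elem_ball_SL: "A \<in> elem_ball n k \<Longrightarrow> A \<in> SL n"
  using group.conj_ball_closed[OF group_SL_int elems_SL] by blast

lemma elem_ball_elem: "i < n \<Longrightarrow> j < n \<Longrightarrow> i \<noteq> j \<Longrightarrow> elem n i j x \<in> elem_ball n 1"
  by (intro group.conj_ball_base[OF group_SL_int elems_SL]) (auto simp: elems_def)

lemma rowop_elem_ball:
  assumes "i < n" "f i = 0"
  shows "rowop n i f \<in> elem_ball n n"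
proof -
  have "rowop n i (\<lambda>s. if s < k then f s else 0) \<in> elem_ball n k" if "k \<le> n" for k
    using that
  proof (induction k)
    case 0
    have "rowop n i (\<lambda>s. if s < 0 then f s else 0) = 1\<^sub>m n"
      by (rule eq_matI) (auto simp: rowop_index)
    then show ?case using elem_ball_one by simp
  next
    case (Suc k)
    let ?g = "\<lambda>k s. if s < k then f s else 0"
    show ?case
    proof (cases "k = i")
      case True
      then have "?g (Suc k) = ?g k" using assms(2) by (auto simp: less_Suc_eq)
      then show ?thesis using Suc elem_ball_mono[of k "Suc k" "rowop n i (?g k)" n] by simp
    next
      case False
      have "rowop n i (?g (Suc k)) = rowop n i (?g k) * elem n i k (f k)"
      proof (rule eq_matI)
        fix r s assume "r < dim_row (rowop n i (?g k) * elem n i k (f k))" "s < dim_col (rowop n i (?g k) * elem n i k (f k))"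
        then have rs: "r < n" "s < n" by simp_all
        show "rowop n i (?g (Suc k)) $$ (r,s) = (rowop n i (?g k) * elem n i k (f k)) $$ (r,s)"
          unfolding mult_elem_index[OF rowop_carrier(1) rs assms(1)]
          using rs assms by (auto simp: rowop_index less_Suc_eq)
      qed simp_all
      then show ?thesis using elem_ball_mult[OF Suc.IH elem_ball_elem[of i n k "f k"]] Suc.prems assms False by simp
    qed
  qed
  from this[of n] have "rowop n i (\<lambda>s. if s < n then f s else 0) \<in> elem_ball n n" by simp
  moreover have "rowop n i (\<lambda>s. if s < n then f s else 0) = rowop n i f"
    by (rule eq_matI) (auto simp: rowop_index)
  ultimately show ?thesis by simp
qed

lemma colop_elem_ball:
  assumes "j < n" "f j = 0"
  shows "colop n j f \<in> elem_ball n n"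
proof -
  have "colop n j (\<lambda>s. if s < k then f s else 0) \<in> elem_ball n k" if "k \<le> n" for k
    using that
  proof (induction k)
    case 0
    have "colop n j (\<lambda>s. if s < 0 then f s else 0) = 1\<^sub>m n"
      by (rule eq_matI) (auto simp: colop_index)
    then show ?case using elem_ball_one by simp
  next
    case (Suc k)
    let ?g = "\<lambda>k s. if s < k then f s else 0"
    show ?case
    proof (cases "k = j")
      case True
      then have "?g (Suc k) = ?g k" using assms(2) by (auto simp: less_Suc_eq)
      then show ?thesis using Suc elem_ball_mono[of k "Suc k" "colop n j (?g k)" n] by simp
    next
      case False
      have "colop n j (?g (Suc k)) = elem n k j (f k) * colop n j (?g k)"
      proof (rule eq_matI)
        fix r s assume "r < dim_row (elem n k j (f k) * colop n j (?g k))" "s < dim_col (elem n k j (f k) * colop n j (?g k))"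
        then have rs: "r < n" "s < n" by simp_all
        show "colop n j (?g (Suc k)) $$ (r,s) = (elem n k j (f k) * colop n j (?g k)) $$ (r,s)"
          unfolding elem_mult_index[OF colop_carrier(1) rs assms(1)]
          using rs assms by (auto simp: colop_index less_Suc_eq)
      qed simp_all
      then show ?thesis using elem_ball_mult[OF elem_ball_elem[of k n j "f k"] Suc.IH] Suc.prems assms False by simp
    qed
  qed
  from this[of n] have "colop n j (\<lambda>s. if s < n then f s else 0) \<in> elem_ball n n" by simp
  moreover have "colop n j (\<lambda>s. if s < n then f s else 0) = colop n j f"
    by (rule eq_matI) (auto simp: colop_index)
  ultimately show ?thesis by simp
qed

lemma SL_inv:
  assumes "A \<in> SL n"
  shows "SLinv n A \<in> SL n" "SLinv n A * A = 1\<^sub>m n" "A * SLinv n A = 1\<^sub>m n"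
  using group.inv_closed[OF group_SL_int assms] group.l_inv[OF group_SL_int assms] group.r_inv[OF group_SL_int assms]
  by simp_all

lemma SL_mult: "A \<in> SL n \<Longrightarrow> B \<in> SL n \<Longrightarrow> A * B \<in> SL n"
  using group.is_monoid[OF group_SL_int] monoid.m_closed by fastforce

lemma SL_assoc: "A \<in> SL n \<Longrightarrow> B \<in> SL n \<Longrightarrow> C \<in> SL n \<Longrightarrow> A * B * C = A * (B * C)"
  by (meson SL_mat assoc_mult_mat)

lemma SL_column_unimodular:
  assumes A: "A \<in> SL n" and j: "j < n"
  obtains z where "(\<Sum>k<n. z k * A $$ (k,j)) = 1"
proof -
  have "(SLinv n A * A) $$ (j,j) = (\<Sum>k<n. SLinv n A $$ (j,k) * A $$ (k,j))"
    by (rule mat_mult_index[OF SL_mat[OF SL_inv(1)[OF A]] SL_mat[OF A] j j])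
  then show thesis using SL_inv(2)[OF A] j that by simp
qed

text \<open>A row of the inverse combines the column to 1. The part \<open>w\<close> of this
  combination from row 2 on is added to the entries of the rows 0 and 1 to make them coprime. They
  produce a 1 in row 2, this produces a 1 in row 0, and the latter clears the column. The cost
  \<open>4 * n + 1\<close> does not depend on the entries.\<close>

lemma clear_first_column:
  assumes n: "n \<ge> 3" and A: "A \<in> SL n"
  obtains P where "P \<in> elem_ball n (5 * n)" "\<And>r. r < n \<Longrightarrow> (P * A) $$ (r,0) = (if r = 0 then 1 else 0)"
proof -
  have n0: "0 < n" "1 < n" "2 < n" using n by auto
  obtain z where z: "(\<Sum>k<n. z k * A $$ (k,0)) = 1" using SL_column_unimodular[OF A n0(1)] .
  define w where "w = (\<Sum>k<n. (if k \<ge> 2 then z k else 0) * A $$ (k,0))"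
  have split: "(\<Sum>k<n. g k) = g 0 + g 1 + (\<Sum>k\<in>{2..<n}. g k)" for g :: "nat \<Rightarrow> int"
  proof -
    have "{..<n} = insert 0 (insert 1 {2..<n})" using n by auto
    then show ?thesis by simp
  qed
  have "z 0 * A $$ (0,0) + z 1 * A $$ (1,0) + w = 1"
    using z unfolding w_def split by simp
  then obtain s t where st: "coprime (A $$ (0,0) + s * w) (A $$ (1,0) + t * w)" using coprime_shift2 by blast
  define P1 where "P1 = rowop n 0 (\<lambda>k. if k \<ge> 2 then s * z k else 0)"
  define P2 where "P2 = rowop n 1 (\<lambda>k. if k \<ge> 2 then t * z k else 0)"
  have P1: "P1 \<in> elem_ball n n" and P2: "P2 \<in> elem_ball n n" unfolding P1_def P2_def using n by (auto intro!: rowop_elem_ball)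
  define A1 where "A1 = P1 * A"
  define A2 where "A2 = P2 * A1"
  have A1: "A1 \<in> SL n" unfolding A1_def using SL_mult[OF elem_ball_SL[OF P1] A] .
  have A2: "A2 \<in> SL n" unfolding A2_def using SL_mult[OF elem_ball_SL[OF P2] A1] .
  have A1_col: "A1 $$ (r,0) = A $$ (r,0) + (if r = 0 then s * w else 0)" if "r < n" for r
    unfolding A1_def P1_def rowop_mult_index[OF SL_mat[OF A] that n0(1)]
    unfolding w_def sum_distrib_left by (auto intro!: sum.cong)
  have w1: "(\<Sum>k<n. (if k \<ge> 2 then t * z k else 0) * A1 $$ (k,0)) = t * w"
    unfolding w_def sum_distrib_left by (intro sum.cong refl) (auto simp: A1_col)
  have A2_col: "A2 $$ (r,0) = A1 $$ (r,0) + (if r = 1 then t * w else 0)" if "r < n" for r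
    unfolding A2_def P2_def rowop_mult_index[OF SL_mat[OF A1] that n0(1)] w1 ..
  have "coprime (A2 $$ (0,0)) (A2 $$ (1,0))" using st n0 by (simp add: A2_col A1_col)
  then obtain x y where xy: "x * A2 $$ (0,0) + y * A2 $$ (1,0) = 1"
    using bezout_int[of "A2 $$ (0,0)" "A2 $$ (1,0)"] by (auto simp: coprime_iff_gcd_eq_1)
  define v where "v = 1 - A2 $$ (2,0)"
  define P3 where "P3 = rowop n 2 (\<lambda>k. if k = 0 then v * x else if k = 1 then v * y else 0)"
  have P3: "P3 \<in> elem_ball n n" unfolding P3_def using n by (auto intro!: rowop_elem_ball)
  define A3 where "A3 = P3 * A2"
  have A3: "A3 \<in> SL n" unfolding A3_def using SL_mult[OF elem_ball_SL[OF P3] A2] .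
  have "(\<Sum>k<n. (if k = 0 then v * x else if k = 1 then v * y else 0) * A2 $$ (k,0)) = v * (x * A2 $$ (0,0) + y * A2 $$ (1,0))"
    unfolding split by (simp add: algebra_simps)
  then have s3: "(\<Sum>k<n. (if k = 0 then v * x else if k = 1 then v * y else 0) * A2 $$ (k,0)) = v" using xy by simp
  have A3_2: "A3 $$ (2,0) = 1"
    unfolding A3_def P3_def rowop_mult_index[OF SL_mat[OF A2] n0(3) n0(1)] s3 by (simp add: v_def)
  define P4 where "P4 = elem n 0 2 (1 - A3 $$ (0,0))"
  have P4: "P4 \<in> elem_ball n 1" unfolding P4_def using n by (intro elem_ball_elem) auto
  define A4 where "A4 = P4 * A3"
  have A4: "A4 \<in> SL n" unfolding A4_def using SL_mult[OF elem_ball_SL[OF P4] A3] .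
  have A4_0: "A4 $$ (0,0) = 1"
    unfolding A4_def P4_def elem_mult_index[OF SL_mat[OF A3] n0(1) n0(1) n0(3)] by (simp add: A3_2)
  define P5 where "P5 = colop n 0 (\<lambda>r. if r = 0 then 0 else - A4 $$ (r,0))"
  have P5: "P5 \<in> elem_ball n n" unfolding P5_def using n by (auto intro!: colop_elem_ball)
  have A5: "(P5 * A4) $$ (r,0) = (if r = 0 then 1 else 0)" if "r < n" for r
    unfolding P5_def colop_mult_index[OF SL_mat[OF A4] that n0(1) n0(1)] by (simp add: A4_0)
  define P where "P = P5 * (P4 * (P3 * (P2 * P1)))"
  have "P \<in> elem_ball n (n + (1 + (n + (n + n))))" unfolding P_def by (intro elem_ball_mult P1 P2 P3 P4 P5)
  then have "P \<in> elem_ball n (5 * n)" using elem_ball_mono[of "n + (1 + (n + (n + n)))" "5 * n"] n by simp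
  moreover have "P * A = P5 * A4"
  proof -
    note c = elem_ball_SL[OF P1] elem_ball_SL[OF P2] elem_ball_SL[OF P3] elem_ball_SL[OF P4] elem_ball_SL[OF P5] A
    show ?thesis unfolding P_def A4_def A3_def A2_def A1_def
      by (simp add: SL_assoc[of _ n] SL_mult[of _ n] c)
  qed
  ultimately show thesis using that A5 by metis
qed

lemma reduce_dimension:
  assumes n: "n \<ge> 2" and A: "A \<in> SL (Suc n)"
  obtains B P Q where "B \<in> SL n" "P \<in> elem_ball (Suc n) (5 * Suc n)" "Q \<in> elem_ball (Suc n) (Suc n)"
    "P * A * Q = embed_corner B"
proof -
  let ?N = "Suc n"
  obtain P where P: "P \<in> elem_ball ?N (5 * ?N)" "\<And>r. r < ?N \<Longrightarrow> (P * A) $$ (r,0) = (if r = 0 then 1 else 0)"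
    using clear_first_column[of ?N A] n A by auto
  define A1 where "A1 = P * A"
  have A1: "A1 \<in> SL ?N" unfolding A1_def using SL_mult[OF elem_ball_SL[OF P(1)] A] .
  define Q where "Q = rowop ?N 0 (\<lambda>s. if s = 0 then 0 else - A1 $$ (0,s))"
  have Q: "Q \<in> elem_ball ?N ?N" unfolding Q_def by (auto intro!: rowop_elem_ball)
  define B where "B = mat n n (\<lambda>(r,s). A1 $$ (Suc r, Suc s))"
  have B: "B \<in> carrier_mat n n" by (simp add: B_def)
  have AQ: "A1 * Q \<in> SL ?N" using SL_mult[OF A1 elem_ball_SL[OF Q]] .
  have eq: "A1 * Q = embed_corner B"
  proof (rule eq_matI)
    fix r s assume "r < dim_row (embed_corner B)" "s < dim_col (embed_corner B)"
    then have rs: "r < ?N" "s < ?N" using embed_corner_carrier[OF B] by auto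
    have "(A1 * Q) $$ (r,s) = (\<Sum>k<?N. A1 $$ (r,k) * Q $$ (k,s))"
      by (rule mat_mult_index[OF SL_mat[OF A1] SL_mat[OF elem_ball_SL[OF Q]] rs])
    also have "\<dots> = (\<Sum>k<?N. (if k = s then A1 $$ (r,s) else 0) + (if k = 0 then A1 $$ (r,0) * (if s = 0 then 0 else - A1 $$ (0,s)) else 0))"
      by (intro sum.cong refl) (use rs in \<open>auto simp: Q_def rowop_index distrib_left\<close>)
    also have "\<dots> = A1 $$ (r,s) + A1 $$ (r,0) * (if s = 0 then 0 else - A1 $$ (0,s))"
      using rs by (simp add: sum.distrib del: sum.lessThan_Suc)
    also have "\<dots> = embed_corner B $$ (r,s)"
      unfolding embed_corner_index[OF B rs] using rs P(2)[OF rs(1), folded A1_def] P(2)[of 0, folded A1_def]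
      by (cases r; cases s) (auto simp: B_def)
    finally show "(A1 * Q) $$ (r,s) = embed_corner B $$ (r,s)" .
  qed (use embed_corner_carrier[OF B] SL_dim[OF A1] in \<open>auto simp: Q_def\<close>)
  have "Determinant.det B = 1" using det_embed_corner[OF B] AQ unfolding eq by (simp add: carrier_SL)
  then have "B \<in> SL n" using B by (simp add: carrier_SL)
  then show thesis using that P(1) Q eq by (simp add: A1_def)
qed

text \<open>The hypothesis bounds \<open>embed_corner B\<close> in dimension \<open>Suc n\<close>
  and not \<open>B\<close> itself, so that the step also applies to SL(2,Z) inside SL(3,Z).\<close>

lemma reduce_dimension_ball:
  assumes n: "n \<ge> 2" and D: "\<And>B. B \<in> SL n \<Longrightarrow> embed_corner B \<in> elem_ball (Suc n) D"
    and A: "A \<in> SL (Suc n)"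
  shows "A \<in> elem_ball (Suc n) (D + 6 * Suc n)"
proof -
  interpret group "SL_int (Suc n)" by (rule group_SL_int)
  obtain B P Q where *: "B \<in> SL n" "P \<in> elem_ball (Suc n) (5 * Suc n)" "Q \<in> elem_ball (Suc n) (Suc n)"
    "P * A * Q = embed_corner B" using reduce_dimension[OF n A] .
  let ?i = "\<lambda>X. inv\<^bsub>SL_int (Suc n)\<^esub> X"
  have PQ: "P \<in> SL (Suc n)" "Q \<in> SL (Suc n)" using * elem_ball_SL by auto
  have "?i P \<otimes>\<^bsub>SL_int (Suc n)\<^esub> (P \<otimes>\<^bsub>SL_int (Suc n)\<^esub> A \<otimes>\<^bsub>SL_int (Suc n)\<^esub> Q) \<otimes>\<^bsub>SL_int (Suc n)\<^esub> ?i Q =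
     (?i P \<otimes>\<^bsub>SL_int (Suc n)\<^esub> P) \<otimes>\<^bsub>SL_int (Suc n)\<^esub> A \<otimes>\<^bsub>SL_int (Suc n)\<^esub> (Q \<otimes>\<^bsub>SL_int (Suc n)\<^esub> ?i Q)"
    using PQ A by (simp only: m_assoc m_closed inv_closed)
  also have "\<dots> = A" using PQ A l_inv r_inv l_one r_one by metis
  finally have "A = ?i P \<otimes>\<^bsub>SL_int (Suc n)\<^esub> embed_corner B \<otimes>\<^bsub>SL_int (Suc n)\<^esub> ?i Q" using *(4) by simp
  moreover have "?i P \<otimes>\<^bsub>SL_int (Suc n)\<^esub> embed_corner B \<otimes>\<^bsub>SL_int (Suc n)\<^esub> ?i Q \<in> elem_ball (Suc n) (5 * Suc n + D + Suc n)"
    by (intro conj_ball_mult[OF elems_SL] elem_ball_inv * D)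
  ultimately have "A \<in> elem_ball (Suc n) (5 * Suc n + D + Suc n)" by simp
  moreover have "5 * Suc n + D + Suc n = D + 6 * Suc n" by simp
  ultimately show ?thesis by (simp only:)
qed

theorem SL_bounded_by_elementary_conjugates:
  "n \<ge> 3 \<Longrightarrow> \<exists>D. SL n \<subseteq> elem_ball n D"
proof (induction n rule: nat_induct_at_least)
  case base
  have "embed_corner B \<in> elem_ball (Suc 2) 200" if B: "B \<in> SL 2" for B
  proof -
    have B2: "B \<in> carrier_mat 2 2" "Determinant.det B = 1" using B by (auto simp: carrier_SL)
    then have "B $$ (0,0) * B $$ (1,1) - B $$ (0,1) * B $$ (1,0) = 1" using det_m2[OF B2(1)] by simp
    from sl2_block_ball3[OF this] show ?thesis unfolding embed_corner_Z[OF B2(1)] by (simp add: numeral_3_eq_3)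
  qed
  then have "carrier (SL_int (Suc 2)) \<subseteq> elem_ball (Suc 2) (200 + 6 * Suc 2)"
    using reduce_dimension_ball[of 2 200] by blast
  then show ?case by (auto simp: numeral_3_eq_3)
next
  case (Suc n)
  then obtain D where D: "SL n \<subseteq> elem_ball n D" by blast
  then have "embed_corner B \<in> elem_ball (Suc n) D" if "B \<in> SL n" for B
    using embed_corner_conj_ball that by blast
  then have "SL (Suc n) \<subseteq> elem_ball (Suc n) (D + 6 * Suc n)"
    using reduce_dimension_ball[of n D] Suc.hyps by auto
  then show ?case by blast
qed

section \<open>Elementary matrices near a given matrix\<close>

lemma SL_mult_inv_index:
  assumes A: "A \<in> SL n" and rs: "r < n" "s < n"
  shows "(\<Sum>k<n. A $$ (r,k) * SLinv n A $$ (k,s)) = (if r = s then 1 else 0)"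
    and "(\<Sum>k<n. SLinv n A $$ (r,k) * A $$ (k,s)) = (if r = s then 1 else 0)"
  using mat_mult_index[OF SL_mat[OF A] SL_mat[OF SL_inv(1)[OF A]] rs]
    mat_mult_index[OF SL_mat[OF SL_inv(1)[OF A]] SL_mat[OF A] rs] SL_inv[OF A] rs
  by simp_all

lemma conj_elem_index:
  assumes A: "A \<in> SL n" and ij: "i < n" "j < n" and rs: "r < n" "s < n"
  shows "(A * elem n i j x * SLinv n A) $$ (r,s) =
    (if r = s then 1 else 0) + A $$ (r,i) * x * SLinv n A $$ (j,s)"
proof -
  let ?B = "SLinv n A"
  have c: "A * elem n i j x \<in> carrier_mat n n"
    using mult_carrier_mat[OF SL_mat[OF A] elem_dim(3)] .
  have "(A * elem n i j x * ?B) $$ (r,s) = (\<Sum>k<n. (A * elem n i j x) $$ (r,k) * ?B $$ (k,s))"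
    by (rule mat_mult_index[OF c SL_mat[OF SL_inv(1)[OF A]] rs])
  also have "\<dots> = (\<Sum>k<n. A $$ (r,k) * ?B $$ (k,s) + (if k = j then A $$ (r,i) * x * ?B $$ (j,s) else 0))"
  proof (intro sum.cong refl)
    fix k assume "k \<in> {..<n}"
    then have k: "k < n" by simp
    show "(A * elem n i j x) $$ (r,k) * ?B $$ (k,s) = A $$ (r,k) * ?B $$ (k,s) + (if k = j then A $$ (r,i) * x * ?B $$ (j,s) else 0)"
      unfolding mult_elem_index[OF SL_mat[OF A] rs(1) k ij(1)] by (simp add: distrib_right)
  qed
  also have "\<dots> = (if r = s then 1 else 0) + A $$ (r,i) * x * ?B $$ (j,s)"
    using ij by (simp add: sum.distrib SL_mult_inv_index(1)[OF A rs])
  finally show ?thesis .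
qed

lemma commutator_elem_index:
  assumes A: "A \<in> SL n" and ij: "i < n" "j < n" "i \<noteq> j" and rs: "r < n" "s < n"
  shows "(A * elem n i j 1 * SLinv n A * elem n i j (-1)) $$ (r,s) =
    (if r = s then 1 else 0) + A $$ (r,i) * SLinv n A $$ (j,s)
     - (if s = j then (if r = i then 1 else 0) + A $$ (r,i) * SLinv n A $$ (j,i) else 0)"
proof -
  have c: "A * elem n i j 1 * SLinv n A \<in> carrier_mat n n"
    using A SL_inv(1)[OF A] elem_SL[OF ij(3)] by (intro SL_mat SL_mult) auto
  show ?thesis
    unfolding mult_elem_index[OF c rs ij(1)] conj_elem_index[OF A ij(1,2) rs] conj_elem_index[OF A ij(1,2) rs(1) ij(1)]
    by simp
qed

text \<open>All defects vanish modulo \<open>m\<close> exactly when \<open>A\<close> is scalar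
  modulo \<open>m\<close>.\<close>

definition defect :: "int mat \<Rightarrow> nat \<Rightarrow> nat \<Rightarrow> int" where
  "defect A i j = (if i = j then A $$ (i,i) - A $$ (0,0) else A $$ (i,j))"

context
  fixes n :: nat and S :: "int mat set"
  assumes n: "n \<ge> 3" and S: "S \<subseteq> SL n"
begin

interpretation group "SL_int n" by (rule group_SL_int)

abbreviation gen_ball where "gen_ball \<equiv> conj_ball (SL_int n) S"
abbreviation gen_ideal where "gen_ideal \<equiv> elem_ideal n S"

lemma n_gt: "0 < n" "1 < n" "2 < n"
  using n by auto

lemma B_SL: "A \<in> gen_ball c \<Longrightarrow> A \<in> SL n"
  using conj_ball_closed[OF S] by blast

lemma J_mult: "x \<in> gen_ideal c \<Longrightarrow> x * y \<in> gen_ideal (2 * c)"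
  by (rule elem_ideal_mult[OF S n])

lemma J_diff: "x \<in> gen_ideal c \<Longrightarrow> y \<in> gen_ideal d \<Longrightarrow> x - y \<in> gen_ideal (c + 2 * d)"
  using elem_ideal_add[OF S _ J_mult[of y d "-1"], of x c] by simp

lemma J_sum:
  assumes "finite I" "\<And>i. i \<in> I \<Longrightarrow> f i \<in> gen_ideal c"
  shows "sum f I \<in> gen_ideal (card I * c)"
  using assms
proof (induction I rule: finite_induct)
  case (insert i I)
  then show ?case using elem_ideal_add[OF S, of "f i" c "sum f I" "card I * c"] by simp
qed (simp add: elem_ideal_0[OF S])

lemma B_commutator_elem:
  assumes "A \<in> gen_ball c" "i < n" "j < n" "i \<noteq> j"
  shows "A * elem n i j 1 * SLinv n A * elem n i j (-1) \<in> gen_ball (2 * c)"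
  using conj_ball_commutator(1)[OF S assms(1) elem_SL[OF assms(4), of n 1]] inv_elem[OF assms(4,2,3), of 1] by simp

text \<open>The first two columns of \<open>A\<close> are read off from the commutator of \<open>A\<close> with an elementary matrix
  in the third column, since from the third row on \<open>A\<close> is the identity.\<close>

lemma two_row_entries:
  assumes A: "A \<in> gen_ball c" and rows: "\<And>r s. 2 \<le> r \<Longrightarrow> r < n \<Longrightarrow> s < n \<Longrightarrow> A $$ (r,s) = (if r = s then 1 else 0)"
    and ik: "i < 2" "k < 2"
  shows "A $$ (k,i) - (if k = i then 1 else 0) \<in> gen_ideal (32 * c)"
proof -
  have A': "A \<in> SL n" using B_SL[OF A] .
  define M where "M = A * elem n i 2 1 * SLinv n A * elem n i 2 (-1)"
  have M: "M \<in> gen_ball (2 * c)" unfolding M_def using ik n_gt by (intro B_commutator_elem A) auto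
  note MS = B_SL[OF M]
  have inv_row: "SLinv n A $$ (2,s) = (if s = 2 then 1 else 0)" if s: "s < n" for s
  proof -
    have "(\<Sum>k<n. A $$ (2,k) * SLinv n A $$ (k,s)) = (\<Sum>k<n. if k = 2 then SLinv n A $$ (2,s) else 0)"
      using rows[of 2] n_gt by (intro sum.cong refl) auto
    then show ?thesis using SL_mult_inv_index(1)[OF A' n_gt(3) s] n_gt by simp
  qed
  define \<alpha> where "\<alpha> k = A $$ (k,i) - (if k = i then 1 else 0)" for k
  have M_index: "M $$ (r,s) = (if r = s then 1 else 0) + (if s = 2 then \<alpha> r else 0)" if rs: "r < n" "s < n" for r s
    unfolding M_def using ik n_gt rs
    by (subst commutator_elem_index[OF A']) (auto simp: inv_row \<alpha>_def)
  have \<alpha>0: "\<alpha> r = 0" if "2 \<le> r" "r < n" for r using rows[of r i] that ik n_gt by (auto simp: \<alpha>_def)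
  \<comment> \<open>\<open>M\<close> is the identity with the vector \<open>\<alpha>\<close> added
    to column 2, and \<open>\<alpha>\<close> vanishes from row 2 on. So its commutator with
    \<open>elem n k' k 1\<close> is elementary with entry \<open>\<alpha> k\<close>. Two commutators
    double the radius twice and \<open>elem_idealI\<close> multiplies it by 8, which makes
    32.\<close>
  have swap: "elem n k' k 1 * M = elem n k' 2 (\<alpha> k) * M * elem n k' k 1" if k': "k' < 2" "k' \<noteq> k" for k'
  proof (rule eq_matI)
    fix r s assume "r < dim_row (elem n k' 2 (\<alpha> k) * M * elem n k' k 1)" "s < dim_col (elem n k' 2 (\<alpha> k) * M * elem n k' k 1)"
    then have rs: "r < n" "s < n" by simp_all
    have kn: "k < n" "k' < n" using ik k' n_gt by auto
    have c: "elem n k' 2 (\<alpha> k) * M \<in> carrier_mat n n" using mult_carrier_mat[OF elem_dim(3) SL_mat[OF MS]] .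
    have x: "k \<noteq> 2" "k' \<noteq> 2" using ik k' by auto
    show "(elem n k' k 1 * M) $$ (r,s) = (elem n k' 2 (\<alpha> k) * M * elem n k' k 1) $$ (r,s)"
      unfolding mult_elem_index[OF c rs kn(2)] elem_mult_index[OF SL_mat[OF MS] rs kn(1)]
        elem_mult_index[OF SL_mat[OF MS] rs n_gt(3)] elem_mult_index[OF SL_mat[OF MS] rs(1) kn(2) n_gt(3)]
      using rs kn n_gt x k'(2) \<alpha>0[of 2] by (auto simp: M_index)
  qed (use SL_dim[OF MS] in simp_all)
  define k' where "k' = 1 - k"
  have "k = 0 \<or> k = 1" using ik by linarith
  then have k': "k' < 2" "k' \<noteq> k" by (auto simp: k'_def)
  have kn: "k' < n" "k < n" using k' ik n_gt by auto
  let ?x = "elem n k' k 1" and ?e = "elem n k' 2 (\<alpha> k)"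
  have xS: "?x \<in> SL n" "?e \<in> SL n" using k' by (auto intro!: elem_SL)
  have "?x \<otimes>\<^bsub>SL_int n\<^esub> M \<otimes>\<^bsub>SL_int n\<^esub> SLinv n ?x \<otimes>\<^bsub>SL_int n\<^esub> SLinv n M =
    (?e \<otimes>\<^bsub>SL_int n\<^esub> M \<otimes>\<^bsub>SL_int n\<^esub> ?x) \<otimes>\<^bsub>SL_int n\<^esub> SLinv n ?x \<otimes>\<^bsub>SL_int n\<^esub> SLinv n M"
    using swap[OF k'] by simp
  also have "\<dots> = ?e \<otimes>\<^bsub>SL_int n\<^esub> M \<otimes>\<^bsub>SL_int n\<^esub> (?x \<otimes>\<^bsub>SL_int n\<^esub> SLinv n ?x) \<otimes>\<^bsub>SL_int n\<^esub> SLinv n M"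
    using xS MS by (simp only: m_assoc m_closed inv_closed)
  also have "\<dots> = ?e \<otimes>\<^bsub>SL_int n\<^esub> (M \<otimes>\<^bsub>SL_int n\<^esub> SLinv n M)"
    using xS MS by (simp only: m_assoc m_closed inv_closed r_inv r_one one_closed l_one)
  also have "\<dots> = ?e" using xS MS by (simp only: r_inv r_one)
  finally have "?e \<in> gen_ball (2 * (2 * c))" using conj_ball_commutator(2)[OF S M xS(1)] by simp
  from elem_idealI[OF S n kn(1) n_gt(3) _ this] k' show ?thesis by (simp add: \<alpha>_def)
qed

text \<open>The rows \<open>j \<ge> 1\<close> of the inverse are orthogonal to the first column
  \<open>(a, b, 0, ...)\<close>, so they begin with \<open>t j * (b, - a)\<close>. The commutators
  with \<open>elem n 0 j 1\<close> differ from 1 only in the first two rows and yield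
  \<open>a * (b * t j)\<close> and \<open>b * (b * t j)\<close>. As \<open>a\<close> and
  \<open>b\<close> are coprime, \<open>b * t j\<close> follows, and a combination of these is
  \<open>b\<close>.\<close>

lemma first_column_two_entries:
  assumes A: "A \<in> gen_ball c" and col: "\<And>r. 2 \<le> r \<Longrightarrow> r < n \<Longrightarrow> A $$ (r,0) = 0"
  shows "A $$ (1,0) \<in> gen_ideal (1536 * n * c)"
proof -
  have A': "A \<in> SL n" using B_SL[OF A] .
  define I where "I = SLinv n A"
  define a b where "a = A $$ (0,0)" and "b = A $$ (1,0)"
  define x y where "x = I $$ (0,0)" and "y = I $$ (0,1)"
  have two: "(\<Sum>k<n. f k * A $$ (k,0)) = f 0 * a + f 1 * b" for f
  proof -
    have "(\<Sum>k<n. f k * A $$ (k,0)) = (\<Sum>k\<in>{0,1}. f k * A $$ (k,0))"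
      by (rule sum.mono_neutral_right) (use n_gt col in auto)
    then show ?thesis by (simp add: a_def b_def)
  qed
  have rel: "I $$ (j,0) * a + I $$ (j,1) * b = (if j = 0 then 1 else 0)" if "j < n" for j
    using SL_mult_inv_index(2)[OF A' that n_gt(1)] two[of "\<lambda>k. I $$ (j,k)"] by (simp add: I_def)
  have xy: "x * a + y * b = 1" using rel[of 0] n_gt by (simp add: x_def y_def)
  define t where "t j = y * I $$ (j,0) - x * I $$ (j,1)" for j
  have t0: "t 0 = 0" by (simp add: t_def x_def y_def)
  have I0: "I $$ (j,0) = b * t j" and I1: "I $$ (j,1) = - (a * t j)" if j: "1 \<le> j" "j < n" for j
  proof -
    have r: "I $$ (j,0) * a + I $$ (j,1) * b = 0" using rel[of j] j by simp
    have "b * t j = I $$ (j,0) * (x * a + y * b) - x * (I $$ (j,0) * a + I $$ (j,1) * b)"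
      by (simp add: t_def algebra_simps)
    then show "I $$ (j,0) = b * t j" using r xy by simp
    have "a * t j = y * (I $$ (j,0) * a + I $$ (j,1) * b) - I $$ (j,1) * (x * a + y * b)"
      by (simp add: t_def algebra_simps)
    then show "I $$ (j,1) = - (a * t j)" using r xy by simp
  qed
  have bt: "b * t j \<in> gen_ideal (768 * c)" if j: "j < n" for j
  proof (cases "j = 0")
    case True
    then show ?thesis using t0 elem_ideal_0[OF S] by simp
  next
    case False
    then have j1: "1 \<le> j" by simp
    define M where "M = A * elem n 0 j 1 * SLinv n A * elem n 0 j (-1)"
    have M: "M \<in> gen_ball (2 * c)" unfolding M_def using False j n_gt by (intro B_commutator_elem A) auto
    have M_index: "M $$ (r,s) = (if r = s then 1 else 0) + A $$ (r,0) * I $$ (j,s)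
        - (if s = j then (if r = 0 then 1 else 0) + A $$ (r,0) * I $$ (j,0) else 0)" if "r < n" "s < n" for r s
      unfolding M_def I_def by (rule commutator_elem_index[OF A' n_gt(1) j _ that]) (use False in simp)
    have M_rows: "M $$ (r,s) = (if r = s then 1 else 0)" if "2 \<le> r" "r < n" "s < n" for r s
      using M_index[of r s] that col[of r] by simp
    note ent = two_row_entries[OF M M_rows]
    have "M $$ (0,0) - 1 \<in> gen_ideal (32 * (2 * c))" using ent[of 0 0] by simp
    moreover have "M $$ (0,0) - 1 = a * (b * t j)" using M_index[of 0 0] n_gt False I0[OF j1 j] by (simp add: a_def)
    ultimately have 1: "a * (b * t j) \<in> gen_ideal (64 * c)" by simp
    have "M $$ (1,0) \<in> gen_ideal (32 * (2 * c))" using ent[of 0 1] by simp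
    moreover have "M $$ (1,0) = b * (b * t j)" using M_index[of 1 0] n_gt False I0[OF j1 j] by (simp add: b_def)
    ultimately have 2: "b * (b * t j) \<in> gen_ideal (64 * c)" by simp
    have "b * t j = (x * a + y * b) * (b * t j)" using xy by simp
    also have "\<dots> = a * (b * t j) * x + b * (b * t j) * y" by (simp add: algebra_simps)
    also have "\<dots> \<in> gen_ideal (2 * (64 * c) + 2 * (64 * c))"
      by (intro elem_ideal_add[OF S] J_mult 1 2)
    finally have 3: "b * t j \<in> gen_ideal (256 * c)" by simp
    show ?thesis using elem_ideal_mono[OF S 3, of "768 * c"] by simp
  qed
  \<comment> \<open>\<open>t\<close> is \<open>y\<close> times column 0 minus \<open>x\<close> times
    column 1 of the inverse, so \<open>A\<close> maps it to \<open>(y, - x, 0, ...)\<close>. Taking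
    \<open>b\<close> times row 0 minus \<open>a\<close> times row 1 then gives
    \<open>b * y + a * x = 1\<close>.\<close>
  have unit: "(\<Sum>j<n. b * t j * (b * A $$ (0,j) - a * A $$ (1,j))) = b"
  proof -
    have At: "(\<Sum>j<n. A $$ (r,j) * t j) = (if r = 0 then y else 0) - (if r = 1 then x else 0)" if r: "r < n" for r
    proof -
      have "(\<Sum>j<n. A $$ (r,j) * t j) = y * (\<Sum>j<n. A $$ (r,j) * I $$ (j,0)) - x * (\<Sum>j<n. A $$ (r,j) * I $$ (j,1))"
        by (simp add: t_def sum_distrib_left sum_subtractf[symmetric] algebra_simps)
      then show ?thesis
        unfolding I_def SL_mult_inv_index(1)[OF A' r n_gt(1)] SL_mult_inv_index(1)[OF A' r n_gt(2)] by simp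
    qed
    have "(\<Sum>j<n. b * t j * (b * A $$ (0,j) - a * A $$ (1,j)))
        = b * b * (\<Sum>j<n. A $$ (0,j) * t j) - b * a * (\<Sum>j<n. A $$ (1,j) * t j)"
      by (simp add: sum_distrib_left sum_subtractf[symmetric] algebra_simps)
    also have "\<dots> = b * (x * a + y * b)" unfolding At[OF n_gt(1)] At[OF n_gt(2)] by (simp add: algebra_simps)
    finally show ?thesis using xy by simp
  qed
  have "(\<Sum>j<n. b * t j * (b * A $$ (0,j) - a * A $$ (1,j))) \<in> gen_ideal (card {..<n} * (2 * (768 * c)))"
    by (intro J_sum J_mult bt) auto
  then show ?thesis unfolding unit b_def[symmetric] by (simp add: mult_ac)
qed

text \<open>The number of row operations is not bounded, but \<open>P\<close> serves only for
  conjugation. Adding multiples of rows other than row 0 keeps the first column of \<open>P\<close>.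
  In a minimal position at most one entry of the first column of \<open>P * A\<close> below the top
  is nonzero, and it can be moved to row 1.\<close>

lemma reduce_first_column:
  assumes A: "A \<in> SL n"
  obtains P where "P \<in> SL n" "\<And>r. r < n \<Longrightarrow> P $$ (r,0) = (if r = 0 then 1 else 0)"
    "\<And>r. 2 \<le> r \<Longrightarrow> r < n \<Longrightarrow> (P * A) $$ (r,0) = 0"
proof -
  define Q where "Q P \<longleftrightarrow> P \<in> SL n \<and> (\<forall>r<n. P $$ (r,0) = (if r = 0 then 1 else 0))" for P
  define \<mu> where "\<mu> P = (\<Sum>r\<in>{1..<n}. nat \<bar>(P * A) $$ (r,0)\<bar>)" for P
  have one: "Q (1\<^sub>m n)" using n_gt one_closed by (auto simp: Q_def)
  have step: "Q (elem n i j x * P)" "\<And>r. r < n \<Longrightarrow> (elem n i j x * P * A) $$ (r,0) = (P * A) $$ (r,0) + (if r = i then x * (P * A) $$ (j,0) else 0)"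
    if P: "Q P" and ij: "i < n" "j < n" "i \<noteq> j" "j \<noteq> 0" for P i j x
  proof -
    have PS: "P \<in> SL n" using P by (simp add: Q_def)
    note PA = SL_mult[OF PS A]
    have "(elem n i j x * P) $$ (r,0) = (if r = 0 then 1 else 0)" if r: "r < n" for r
      unfolding elem_mult_index[OF SL_mat[OF PS] r n_gt(1) ij(2)] using P r ij by (simp add: Q_def)
    then show "Q (elem n i j x * P)" using SL_mult[OF elem_SL[OF ij(3)] PS] by (simp add: Q_def)
    show "(elem n i j x * P * A) $$ (r,0) = (P * A) $$ (r,0) + (if r = i then x * (P * A) $$ (j,0) else 0)" if r: "r < n" for r
      unfolding SL_assoc[OF elem_SL[OF ij(3)] PS A] by (rule elem_mult_index[OF SL_mat[OF PA] r n_gt(1) ij(2)])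
  qed
  obtain P where P: "Q P" and min: "\<And>P'. Q P' \<Longrightarrow> \<mu> P \<le> \<mu> P'"
    using ex_has_least_nat[of Q _ \<mu>] one by blast
  define u where "u r = (P * A) $$ (r,0)" for r
  have one_nonzero: "u i = 0 \<or> u j = 0" if ij: "1 \<le> i" "i < n" "1 \<le> j" "j < n" "i \<noteq> j" "\<bar>u j\<bar> \<le> \<bar>u i\<bar>" for i j
  proof (rule ccontr)
    assume nz: "\<not> ?thesis"
    \<comment> \<open>One step of Euclid's algorithm: the sign makes \<open>\<bar>u i\<bar>\<close>
      drop by \<open>\<bar>u j\<bar>\<close>.\<close>
    define x where "x = - (sgn (u i) * sgn (u j))"
    have less: "\<bar>u i + x * u j\<bar> < \<bar>u i\<bar>"
      using nz ij(6) unfolding x_def by (auto simp: sgn_if split: if_splits)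
    have Q': "Q (elem n i j x * P)" using step(1)[OF P] ij by simp
    have "\<mu> (elem n i j x * P) < \<mu> P"
      unfolding \<mu>_def
    proof (rule sum_strict_mono_ex1)
      show "\<forall>r\<in>{1..<n}. nat \<bar>(elem n i j x * P * A) $$ (r,0)\<bar> \<le> nat \<bar>(P * A) $$ (r,0)\<bar>"
        using step(2)[OF P, of i j] ij less by (auto simp: u_def)
      show "\<exists>r\<in>{1..<n}. nat \<bar>(elem n i j x * P * A) $$ (r,0)\<bar> < nat \<bar>(P * A) $$ (r,0)\<bar>"
        using step(2)[OF P, of i j i] ij less by (intro bexI[of _ i]) (auto simp: u_def)
    qed simp
    then show False using min[OF Q'] by simp
  qed
  have one_nonzero': "u i = 0 \<or> u j = 0" if "1 \<le> i" "i < n" "1 \<le> j" "j < n" "i \<noteq> j" for i j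
    using one_nonzero[of i j] one_nonzero[of j i] that by linarith
  show thesis
  proof (cases "\<forall>r. 2 \<le> r \<longrightarrow> r < n \<longrightarrow> u r = 0")
    case True
    then show ?thesis using that[of P] P by (auto simp: Q_def u_def)
  next
    case False
    then obtain p where p: "2 \<le> p" "p < n" "u p \<noteq> 0" by blast
    have others: "u r = 0" if "1 \<le> r" "r < n" "r \<noteq> p" for r using one_nonzero'[of r p] that p by auto
    \<comment> \<open>The entry of row \<open>p\<close> is copied to row 1, where the entry is 0 or
      \<open>p\<close> itself is excluded, and then removed from row \<open>p\<close>.\<close>
    let ?P1 = "elem n 1 p 1 * P"
    let ?P2 = "elem n p 1 (-1) * ?P1"
    have Q1: "Q ?P1" using step(1)[OF P, of 1 p 1] p n_gt by simp
    have u1: "(?P1 * A) $$ (r,0) = u r + (if r = 1 then u p else 0)" if "r < n" for r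
      using step(2)[OF P, of 1 p r 1] that p n_gt by (simp add: u_def)
    have Q2: "Q ?P2" using step(1)[OF Q1, of p 1 "-1"] p n_gt by simp
    have u2: "(?P2 * A) $$ (r,0) = (?P1 * A) $$ (r,0) + (if r = p then - (?P1 * A) $$ (1,0) else 0)" if "r < n" for r
      using step(2)[OF Q1, of p 1 r "-1"] that p n_gt by simp
    have "(?P2 * A) $$ (r,0) = 0" if "2 \<le> r" "r < n" for r
      using u2[of r] u1[of r] u1[of 1] others[of 1] others[of r] that p n_gt by (cases "r = p") auto
    then show ?thesis using that[of ?P2] Q2 by (auto simp: Q_def)
  qed
qed

text \<open>\<open>P\<close> fixes the first basis vector, so the conjugate by \<open>P\<close> has
  the first column of \<open>P * A\<close>. Going back, the entry of row \<open>l\<close> is a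
  multiple of the entry of row 1, and this multiplication doubles the constant.\<close>

lemma first_column_entries:
  assumes A: "A \<in> gen_ball c" and l: "1 \<le> l" "l < n"
  shows "A $$ (l,0) \<in> gen_ideal (3072 * n * c)"
proof -
  have A': "A \<in> SL n" using B_SL[OF A] .
  obtain P where P: "P \<in> SL n" "\<And>r. r < n \<Longrightarrow> P $$ (r,0) = (if r = 0 then 1 else 0)"
    "\<And>r. 2 \<le> r \<Longrightarrow> r < n \<Longrightarrow> (P * A) $$ (r,0) = 0" using reduce_first_column[OF A'] by blast
  define I where "I = SLinv n P"
  have I: "I \<in> SL n" using SL_inv(1)[OF P(1)] by (simp add: I_def)
  have PA: "P * A \<in> SL n" using SL_mult[OF P(1) A'] .
  have I0: "I $$ (r,0) = (if r = 0 then 1 else 0)" if r: "r < n" for r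
  proof -
    have "(\<Sum>k<n. I $$ (r,k) * P $$ (k,0)) = (\<Sum>k<n. if k = 0 then I $$ (r,0) else 0)"
      by (intro sum.cong refl) (auto simp: P(2))
    then show ?thesis using SL_mult_inv_index(2)[OF P(1) r n_gt(1)] n_gt by (simp add: I_def)
  qed
  define Q where "Q = P * A * I"
  have Q: "Q \<in> gen_ball c" unfolding Q_def I_def using conj_ball_conj[OF S A P(1)] by simp
  have Q0: "Q $$ (r,0) = (P * A) $$ (r,0)" if r: "r < n" for r
  proof -
    have "Q $$ (r,0) = (\<Sum>k<n. (P * A) $$ (r,k) * I $$ (k,0))"
      unfolding Q_def by (rule mat_mult_index[OF SL_mat[OF PA] SL_mat[OF I] r n_gt(1)])
    also have "\<dots> = (\<Sum>k<n. if k = 0 then (P * A) $$ (r,0) else 0)"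
      by (intro sum.cong refl) (auto simp: I0)
    finally show ?thesis using n_gt by simp
  qed
  have b: "Q $$ (1,0) \<in> gen_ideal (1536 * n * c)"
    by (rule first_column_two_entries[OF Q]) (simp add: Q0 P(3))
  have "A = I * (P * A)"
    using SL_assoc[OF I P(1) A'] SL_inv(2)[OF P(1)] SL_mat[OF A'] by (simp add: I_def)
  then have "A $$ (l,0) = (\<Sum>k<n. I $$ (l,k) * (P * A) $$ (k,0))"
    using mat_mult_index[OF SL_mat[OF I] SL_mat[OF PA] l(2) n_gt(1)] by simp
  also have "\<dots> = (\<Sum>k<n. if k = 1 then I $$ (l,1) * (P * A) $$ (1,0) else 0)"
  proof (intro sum.cong refl)
    fix k assume "k \<in> {..<n}"
    then show "I $$ (l,k) * (P * A) $$ (k,0) = (if k = 1 then I $$ (l,1) * (P * A) $$ (1,0) else 0)"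
      using I0[OF l(2)] l P(3)[of k] by (cases "k = 0"; cases "k = 1") auto
  qed
  also have "\<dots> = Q $$ (1,0) * I $$ (l,1)" using n_gt by (simp add: Q0)
  finally show ?thesis using J_mult[OF b, of "I $$ (l,1)"] by (simp add: mult.assoc)
qed

text \<open>Conjugation by \<open>elem n j 0 1\<close> adds column \<open>j\<close> to column 0, so
  \<open>first_column_entries\<close> reaches further entries. Differences isolate the entries off
  the diagonal and, up to an entry of row 0, the differences of diagonal entries. Row 0 takes two
  such conjugations together.\<close>

lemma defect_ideal:
  assumes A: "A \<in> gen_ball c" and ij: "i < n" "j < n"
  shows "defect A i j \<in> gen_ideal (33 * (3072 * n * c))"
proof -
  define K where "K = 3072 * n * c"
  have A': "A \<in> SL n" using B_SL[OF A] .
  have mono: "x \<in> gen_ideal (33 * K)" if "x \<in> gen_ideal d" "d \<le> 33 * K" for x d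
    using elem_ideal_mono[OF S that] .
  have col0: "A $$ (l,0) \<in> gen_ideal K" if "1 \<le> l" "l < n" for l
    unfolding K_def by (rule first_column_entries[OF A that])
  have single: "A $$ (l,0) + A $$ (l,j) - (if l = j then A $$ (0,0) + A $$ (0,j) else 0) \<in> gen_ideal K"
    if l: "1 \<le> l" "l < n" and j: "1 \<le> j" "j < n" for l j
  proof -
    have AP: "A * elem n j 0 1 \<in> SL n" using SL_mult[OF A' elem_SL] j by simp
    have "elem n j 0 (-1) * (A * elem n j 0 1) \<in> gen_ball c"
      using conj_ball_conj'[OF S A elem_SL[of j 0 n 1]] inv_elem[of j 0 n 1] j n_gt
        SL_assoc[OF elem_SL A' elem_SL, of j 0 j 0 "-1" 1] by simp
    from first_column_entries[OF this l] show ?thesis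
      unfolding elem_mult_index[OF SL_mat[OF AP] l(2) n_gt(1) n_gt(1)]
        mult_elem_index[OF SL_mat[OF A'] l(2) n_gt(1) j(2)]
        mult_elem_index[OF SL_mat[OF A'] n_gt(1) n_gt(1) j(2)] K_def[symmetric]
      by (cases "l = j") (simp_all add: algebra_simps)
  qed
  have off: "A $$ (l,j) \<in> gen_ideal (3 * K)" if "1 \<le> l" "l < n" "1 \<le> j" "j < n" "l \<noteq> j" for l j
    using J_diff[OF single[OF that(1-4)] col0[OF that(1,2)]] that(5) by simp
  have diag: "A $$ (j,j) - A $$ (0,0) - A $$ (0,j) \<in> gen_ideal (3 * K)" if "1 \<le> j" "j < n" for j
    using J_diff[OF single[OF that that] col0[OF that]] by (simp add: algebra_simps)
  \<comment> \<open>The entry \<open>(l, 0)\<close> of the conjugate by \<open>P\<close> is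
    \<open>A2 $$ (l,0) - A2 $$ (0,0)\<close>. Subtracting what is known from \<open>col0\<close>,
    \<open>off\<close> and \<open>diag\<close> leaves \<open>- A $$ (0,j)\<close>. The radius grows
    from \<open>K\<close> to \<open>3 * K\<close>, \<open>9 * K\<close> and \<open>15 * K\<close>,
    and the change of sign doubles it.\<close>
  have row0: "A $$ (0,j) \<in> gen_ideal (30 * K)" if j: "1 \<le> j" "j < n" for j
  proof -
    obtain l where l: "l < n" "l \<noteq> 0" "l \<noteq> j" using third_index[OF n] by blast
    then have l1: "1 \<le> l" by simp
    define P where "P = elem n j 0 1 * elem n l 0 1"
    have elems: "elem n j 0 1 \<in> SL n" "elem n l 0 1 \<in> SL n" using j l by (auto intro!: elem_SL)
    have elm: "elem n j 0 (-1) \<in> SL n" "elem n l 0 (-1) \<in> SL n" using j l by (auto intro!: elem_SL)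
    have P: "P \<in> SL n" unfolding P_def using SL_mult elems by blast
    have invP: "SLinv n P = elem n l 0 (-1) * elem n j 0 (-1)"
      unfolding P_def using inv_mult_group[OF elems] inv_elem[of j 0 n 1] inv_elem[of l 0 n 1] j l n_gt by simp
    define A2 where "A2 = A * elem n j 0 1 * elem n l 0 1"
    have A1: "A * elem n j 0 1 \<in> SL n" using SL_mult[OF A' elems(1)] .
    have A2: "A2 \<in> SL n" unfolding A2_def using SL_mult[OF A1 elems(2)] .
    have A2_col: "A2 $$ (r,0) = A $$ (r,0) + A $$ (r,j) + A $$ (r,l)" if r: "r < n" for r
      unfolding A2_def mult_elem_index[OF SL_mat[OF A1] r n_gt(1) l(1)]
        mult_elem_index[OF SL_mat[OF A'] r n_gt(1) j(2)] mult_elem_index[OF SL_mat[OF A'] r l(1) j(2)]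
      using l by simp
    define A3 where "A3 = elem n j 0 (-1) * A2"
    have A3: "A3 \<in> SL n" unfolding A3_def using SL_mult[OF elm(1) A2] .
    have "elem n l 0 (-1) * A3 = SLinv n P * A * P"
      unfolding invP A3_def A2_def unfolding P_def using elems elm A'
      by (simp add: SL_assoc[of _ n] SL_mult[of _ n])
    then have "elem n l 0 (-1) * A3 \<in> gen_ball c" using conj_ball_conj'[OF S A P] by simp
    then have "(elem n l 0 (-1) * A3) $$ (l,0) \<in> gen_ideal K"
      unfolding K_def using l1 l(1) by (rule first_column_entries)
    moreover have "(elem n l 0 (-1) * A3) $$ (l,0) = A3 $$ (l,0) - A3 $$ (0,0)"
      unfolding elem_mult_index[OF SL_mat[OF A3] l(1) n_gt(1) n_gt(1)] by simp
    moreover have "A3 $$ (l,0) = A2 $$ (l,0)" "A3 $$ (0,0) = A2 $$ (0,0)"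
      unfolding A3_def elem_mult_index[OF SL_mat[OF A2] l(1) n_gt(1) n_gt(1)]
        elem_mult_index[OF SL_mat[OF A2] n_gt(1) n_gt(1) n_gt(1)] using l j by simp_all
    ultimately have "A2 $$ (l,0) - A2 $$ (0,0) \<in> gen_ideal K" by simp
    from J_diff[OF J_diff[OF J_diff[OF this col0[OF l1 l(1)]] off[OF l1 l(1) j l(3)]] diag[OF l1 l(1)]]
    have "- A $$ (0,j) \<in> gen_ideal (15 * K)" by (simp add: A2_col l n_gt algebra_simps)
    from J_mult[OF this, of "-1"] show ?thesis by simp
  qed
  have diag': "A $$ (j,j) - A $$ (0,0) \<in> gen_ideal (33 * K)" if "1 \<le> j" "j < n" for j
    using elem_ideal_add[OF S diag[OF that] row0[OF that]] by simp
  show ?thesis unfolding K_def[symmetric]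
  proof (cases "i = j")
    case True
    then show "defect A i j \<in> gen_ideal (33 * K)" using diag'[of j] ij elem_ideal_0[OF S] by (cases "j = 0") (auto simp: defect_def)
  next
    case False
    then consider "i = 0" "1 \<le> j" | "j = 0" "1 \<le> i" | "1 \<le> i" "1 \<le> j" by linarith
    then show "defect A i j \<in> gen_ideal (33 * K)"
    proof cases
      case 1
      then show ?thesis using mono[OF row0[of j]] ij by (simp add: defect_def)
    next
      case 2
      then show ?thesis using mono[OF col0[of i]] ij by (simp add: defect_def)
    next
      case 3
      then show ?thesis using mono[OF off[of i j]] ij False by (simp add: defect_def)
    qed
  qed
qed

end

section \<open>Strong and uniform boundedness\<close>

lemma finite_bezout:
  fixes D :: "int set"
  assumes "finite D"
  shows "\<exists>f. \<forall>d\<in>D. (\<Sum>e\<in>D. f e * e) dvd d"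
  using assms
proof (induction D rule: finite_induct)
  case (insert d D)
  then obtain f where f: "\<forall>e\<in>D. (\<Sum>e\<in>D. f e * e) dvd e" by blast
  define g where "g = (\<Sum>e\<in>D. f e * e)"
  obtain u v where uv: "u * d + v * g = gcd d g" using bezout_int by blast
  define f' where "f' e = (if e = d then u else v * f e)" for e
  have "(\<Sum>e\<in>D. f' e * e) = (\<Sum>e\<in>D. v * (f e * e))"
    using insert.hyps by (intro sum.cong) (auto simp: f'_def)
  then have "(\<Sum>e\<in>insert d D. f' e * e) = gcd d g"
    using insert.hyps uv by (simp add: f'_def g_def sum_distrib_left)
  moreover have "gcd d g dvd e" if "e \<in> D" for e using f that dvd_trans[OF gcd_dvd2] by (auto simp: g_def)
  ultimately show ?case by (intro exI[of _ f']) auto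
qed simp

text \<open>Multiplying 1 by an arbitrary entry puts all elementary matrices into the ball of radius
  \<open>2 * c\<close>. The number \<open>D\<close> depends on \<open>n\<close> only and precedes
  the choice of \<open>S\<close>.\<close>

lemma SL_eq_conj_ball:
  assumes n: "n \<ge> 3"
  obtains D where "\<And>S c. S \<subseteq> SL n \<Longrightarrow> 1 \<in> elem_ideal n S c \<Longrightarrow> SL n \<subseteq> conj_ball (SL_int n) S (2 * c * D)"
proof -
  obtain D where D: "SL n \<subseteq> elem_ball n D" using SL_bounded_by_elementary_conjugates[OF n] by blast
  have "SL n \<subseteq> conj_ball (SL_int n) S (2 * c * D)"
    if S: "S \<subseteq> SL n" and c: "1 \<in> elem_ideal n S c" for S c
  proof -
    have "elems n \<subseteq> conj_ball (SL_int n) S (2 * c)"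
    proof
      fix M assume "M \<in> elems n"
      then obtain i j x where *: "i < n" "j < n" "i \<noteq> j" "M = elem n i j x" by (auto simp: elems_def)
      have "x \<in> elem_ideal n S (2 * c)" using elem_ideal_mult[OF S n c, of x] by simp
      then show "M \<in> conj_ball (SL_int n) S (2 * c)" using * by (simp add: elem_ideal_def)
    qed
    from group.conj_ball_trans[OF group_SL_int S this] D show ?thesis by blast
  qed
  then show thesis using that by blast
qed

section \<open>Matrices that are central modulo m\<close>

definition mcong :: "nat \<Rightarrow> int \<Rightarrow> int mat \<Rightarrow> int mat \<Rightarrow> bool" where
  "mcong n m A B \<longleftrightarrow> (\<forall>i<n. \<forall>j<n. [A $$ (i,j) = B $$ (i,j)] (mod m))"

lemma mcong_refl: "mcong n m A A"
  and mcong_sym: "mcong n m A B \<Longrightarrow> mcong n m B A"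
  by (auto simp: mcong_def intro: cong_sym)

lemma mcong_trans: "mcong n m A B \<Longrightarrow> mcong n m B C \<Longrightarrow> mcong n m A C"
  unfolding mcong_def by (meson cong_trans)

lemma mcong_mult:
  assumes "A \<in> carrier_mat n n" "A' \<in> carrier_mat n n" "B \<in> carrier_mat n n" "B' \<in> carrier_mat n n"
    and "mcong n m A A'" "mcong n m B B'"
  shows "mcong n m (A * B) (A' * B')"
  unfolding mcong_def
proof (intro allI impI)
  fix i j assume ij: "i < n" "j < n"
  show "[(A * B) $$ (i,j) = (A' * B') $$ (i,j)] (mod m)"
    unfolding mat_mult_index[OF assms(1,3) ij] mat_mult_index[OF assms(2,4) ij]
    using assms(5,6) ij by (intro cong_sum cong_mult) (auto simp: mcong_def)
qed

lemma mcong_mult_left: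
  "A \<in> SL n \<Longrightarrow> B \<in> SL n \<Longrightarrow> C \<in> SL n \<Longrightarrow> mcong n m B C \<Longrightarrow> mcong n m (A * B) (A * C)"
  by (intro mcong_mult mcong_refl) (auto dest: SL_mat)

lemma mcong_mult_right:
  "A \<in> SL n \<Longrightarrow> B \<in> SL n \<Longrightarrow> C \<in> SL n \<Longrightarrow> mcong n m B C \<Longrightarrow> mcong n m (B * A) (C * A)"
  by (intro mcong_mult mcong_refl) (auto dest: SL_mat)

text \<open>The preimage of the centre of the image of SL(n,Z) in SL(n,Z/m), expressed by
  congruences.\<close>

definition central_mod :: "nat \<Rightarrow> int \<Rightarrow> int mat set" where
  "central_mod n m = {A \<in> SL n. \<forall>B\<in>SL n. mcong n m (A * B) (B * A)}"

lemma central_mod_normal: "central_mod n m \<lhd> SL_int n"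
proof -
  interpret group "SL_int n" by (rule group_SL_int)
  let ?G = "SL n" and ?i = "\<lambda>A. SLinv n A"
  have sub: "subgroup (central_mod n m) (SL_int n)"
  proof (rule subgroupI)
    show "central_mod n m \<subseteq> ?G" by (auto simp: central_mod_def)
    have "1\<^sub>m n \<in> central_mod n m"
      using one_closed by (auto simp: central_mod_def mcong_def dest!: SL_mat)
    then show "central_mod n m \<noteq> {}" by blast
  next
    fix A assume A: "A \<in> central_mod n m"
    then have AG: "A \<in> ?G" by (simp add: central_mod_def)
    note I = SL_inv[OF AG]
    have "mcong n m (?i A * B) (B * ?i A)" if B: "B \<in> ?G" for B
    proof -
      have "mcong n m (B * A) (A * B)" using A B mcong_sym by (auto simp: central_mod_def)
      then have "mcong n m (?i A * (B * A)) (?i A * (A * B))"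
        using I(1) SL_mult B AG by (intro mcong_mult_left) auto
      then have "mcong n m (?i A * (B * A) * ?i A) (?i A * (A * B) * ?i A)"
        using I(1) SL_mult B AG by (intro mcong_mult_right) auto
      moreover have "?i A * (B * A) * ?i A = ?i A * B"
        using r_inv[OF AG] I(1) B AG right_mult_one_mat[OF SL_mat[OF B]] by (simp add: SL_assoc[of _ n] SL_mult[of _ n])
      moreover have "?i A * (A * B) * ?i A = B * ?i A"
        using I B AG SL_assoc[OF I(1) AG B] SL_mat[OF B] by simp
      ultimately show ?thesis by simp
    qed
    then show "?i A \<in> central_mod n m" using I(1) by (simp add: central_mod_def)
  next
    fix A A' assume *: "A \<in> central_mod n m" "A' \<in> central_mod n m"
    then have G: "A \<in> ?G" "A' \<in> ?G" by (auto simp: central_mod_def)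
    have "mcong n m (A * A' * B) (B * (A * A'))" if B: "B \<in> ?G" for B
    proof -
      have "mcong n m (A * (A' * B)) (A * (B * A'))"
        using * B G SL_mult by (intro mcong_mult_left) (auto simp: central_mod_def)
      moreover have "mcong n m (A * B * A') (B * A * A')"
        using * B G SL_mult by (intro mcong_mult_right) (auto simp: central_mod_def)
      ultimately show ?thesis using G B mcong_trans by (simp add: SL_assoc[of _ n])
    qed
    then show "A \<otimes>\<^bsub>SL_int n\<^esub> A' \<in> central_mod n m" using G SL_mult by (simp add: central_mod_def)
  qed
  show ?thesis
  proof (rule normal_invI[OF sub])
    fix C A assume C: "C \<in> ?G" and A: "A \<in> central_mod n m"
    then have AG: "A \<in> ?G" by (simp add: central_mod_def)
    note I = SL_inv[OF C]
    have "mcong n m (C * A * ?i C * B) (B * (C * A * ?i C))" if B: "B \<in> ?G" for B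
    proof -
      define B1 where "B1 = ?i C * B * C"
      have B1: "B1 \<in> ?G" unfolding B1_def using I(1) B C SL_mult by blast
      have "mcong n m (A * B1) (B1 * A)" using A B1 by (simp add: central_mod_def)
      then have "mcong n m (C * (A * B1)) (C * (B1 * A))"
        using C AG B1 SL_mult by (intro mcong_mult_left) auto
      then have mc: "mcong n m (C * (A * B1) * ?i C) (C * (B1 * A) * ?i C)"
        using I(1) C AG B1 SL_mult by (intro mcong_mult_right) auto
      have "C * (A * B1) * ?i C = C * A * ?i C * B"
        unfolding B1_def using I C AG B SL_mat[OF B] by (simp add: SL_assoc[of _ n] SL_mult[of _ n])
      moreover have "C * (B1 * A) * ?i C = B * (C * A * ?i C)"
      proof -
        have "C * (B1 * A) * ?i C = (C * ?i C) * B * C * A * ?i C"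
          unfolding B1_def using I(1) C AG B by (simp add: SL_assoc[of _ n] SL_mult[of _ n])
        then show ?thesis unfolding I(3) using I(1) C AG B SL_mat[OF B] by (simp add: SL_assoc[of _ n] SL_mult[of _ n])
      qed
      ultimately show ?thesis using mc by simp
    qed
    then show "C \<otimes>\<^bsub>SL_int n\<^esub> A \<otimes>\<^bsub>SL_int n\<^esub> ?i C \<in> central_mod n m"
      using I(1) C AG SL_mult by (simp add: central_mod_def)
  qed
qed

lemma central_mod_proper:
  assumes n: "n \<ge> 3" and m: "m > 1"
  shows "central_mod n m \<noteq> SL n"
proof
  assume eq: "central_mod n m = SL n"
  have n0: "0 < n" "1 < n" using n by auto
  have elems: "elem n 0 1 1 \<in> SL n" "elem n 1 0 1 \<in> SL n" by (auto intro!: elem_SL)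
  then have "mcong n m (elem n 0 1 1 * elem n 1 0 1) (elem n 1 0 1 * elem n 0 1 1)"
    using eq by (auto simp: central_mod_def)
  then have "[(elem n 0 1 1 * elem n 1 0 1) $$ (0,0) = (elem n 1 0 1 * elem n 0 1 1) $$ (0,0)] (mod m)"
    using n0 by (simp add: mcong_def)
  moreover have "(elem n 0 1 1 * elem n 1 0 1) $$ (0,0) = 2"
    unfolding elem_mult_index[OF elem_dim(3) n0(1) n0(1) n0(2)] using n0 by (simp add: elem_index)
  moreover have "(elem n 1 0 1 * elem n 0 1 1) $$ (0,0) = 1"
    unfolding elem_mult_index[OF elem_dim(3) n0(1) n0(1) n0(1)] using n0 by (simp add: elem_index)
  ultimately have "m dvd 1" by (simp add: cong_iff_dvd_diff)
  then show False using m by simp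
qed

lemma scalar_central_mod:
  assumes A: "A \<in> SL n" and m: "\<And>i j. i < n \<Longrightarrow> j < n \<Longrightarrow> m dvd defect A i j"
  shows "A \<in> central_mod n m"
proof -
  let ?a = "A $$ (0,0)"
  have A_cong: "[A $$ (i,j) = (if i = j then ?a else 0)] (mod m)" if "i < n" "j < n" for i j
    using m[OF that] by (auto simp: defect_def cong_iff_dvd_diff split: if_splits)
  have "mcong n m (A * B) (B * A)" if B: "B \<in> SL n" for B
    unfolding mcong_def
  proof (intro allI impI)
    fix i j assume ij: "i < n" "j < n"
    have "(A * B) $$ (i,j) = (\<Sum>k<n. A $$ (i,k) * B $$ (k,j))"
      by (rule mat_mult_index[OF SL_mat[OF A] SL_mat[OF B] ij])
    moreover have "[(\<Sum>k<n. A $$ (i,k) * B $$ (k,j)) = (\<Sum>k<n. (if i = k then ?a else 0) * B $$ (k,j))] (mod m)"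
      using A_cong ij by (intro cong_sum cong_mult) auto
    moreover have "(\<Sum>k<n. (if i = k then ?a else 0) * B $$ (k,j)) = ?a * B $$ (i,j)"
      using ij by (simp add: if_distrib[of "\<lambda>x. x * _"] cong: if_cong)
    moreover have "(B * A) $$ (i,j) = (\<Sum>k<n. B $$ (i,k) * A $$ (k,j))"
      by (rule mat_mult_index[OF SL_mat[OF B] SL_mat[OF A] ij])
    moreover have "[(\<Sum>k<n. B $$ (i,k) * A $$ (k,j)) = (\<Sum>k<n. B $$ (i,k) * (if k = j then ?a else 0))] (mod m)"
      using A_cong ij by (intro cong_sum cong_mult) auto
    moreover have "(\<Sum>k<n. B $$ (i,k) * (if k = j then ?a else 0)) = ?a * B $$ (i,j)"
      using ij by (simp add: if_distrib[of "\<lambda>x. _ * x"] cong: if_cong)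
    ultimately show "[(A * B) $$ (i,j) = (B * A) $$ (i,j)] (mod m)"
      by (metis cong_sym cong_trans)
  qed
  then show ?thesis using A by (simp add: central_mod_def)
qed

text \<open>There are at most \<open>card S * (n * n)\<close> defects, all with the same radius, so
  the radius of 1 depends on \<open>S\<close> only through its cardinality.\<close>

lemma normally_generates_unit_ideal:
  assumes n: "n \<ge> 3" and S: "finite S" "normally_generates (SL_int n) S"
  shows "1 \<in> elem_ideal n S (card S * (n * n) * (66 * (3072 * n)))"
proof -
  have SG: "S \<subseteq> SL n" using S(2) by (simp add: normally_generates_def)
  define D where "D = (\<lambda>(s,i,j). defect s i j) ` (S \<times> {..<n} \<times> {..<n})"
  have fin: "finite D" using S(1) by (simp add: D_def)
  have card: "card D \<le> card S * (n * n)"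
    unfolding D_def using card_image_le[of "S \<times> {..<n} \<times> {..<n}" "\<lambda>(s,i,j). defect s i j"] S(1)
    by (simp add: card_cartesian_product)
  have DJ: "d \<in> elem_ideal n S (33 * (3072 * n))" if d: "d \<in> D" for d
  proof -
    obtain s i j where *: "s \<in> S" "i < n" "j < n" "d = defect s i j" using d by (auto simp: D_def)
    then show ?thesis
      using defect_ideal[OF n SG group.conj_ball_base[OF group_SL_int SG *(1)] *(2,3)] by simp
  qed
  obtain f where f: "\<forall>d\<in>D. (\<Sum>e\<in>D. f e * e) dvd d" using finite_bezout[OF fin] by blast
  define g where "g = (\<Sum>e\<in>D. f e * e)"
  have unit: "\<bar>g\<bar> = 1"
  proof (rule ccontr)
    assume g1: "\<bar>g\<bar> \<noteq> 1"
    \<comment> \<open>For \<open>g = 0\<close> all defects vanish, and any modulus above 1 leads to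
      the contradiction.\<close>
    define m where "m = (if g = 0 then 2 else \<bar>g\<bar>)"
    have m: "m > 1" using g1 by (auto simp: m_def)
    have md: "m dvd d" if "d \<in> D" for d using f that unfolding g_def[symmetric] by (cases "g = 0") (auto simp: m_def)
    have "S \<subseteq> central_mod n m"
    proof
      fix s assume s: "s \<in> S"
      have "m dvd defect s i j" if "i < n" "j < n" for i j
        using s that by (intro md) (auto simp: D_def intro!: image_eqI[of _ _ "(s,i,j)"])
      then show "s \<in> central_mod n m" using s SG by (intro scalar_central_mod) auto
    qed
    then have "normal_closure (SL_int n) S \<subseteq> central_mod n m"
      using central_mod_normal unfolding normal_closure_def by blast
    then have "SL n \<subseteq> central_mod n m" using S(2) by (simp add: normally_generates_def)
    moreover have "central_mod n m \<subseteq> SL n" by (auto simp: central_mod_def)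
    ultimately show False using central_mod_proper[OF n m] by blast
  qed
  \<comment> \<open>\<open>g\<close> may be -1; multiplying the coefficients by \<open>g\<close>
    turns the sum into 1.\<close>
  have "g * g = 1" using unit by (metis abs_mult_self_eq mult_1)
  have "g * g = (\<Sum>e\<in>D. f e * e) * g" by (subst (1) g_def) (rule refl)
  also have "\<dots> = (\<Sum>e\<in>D. e * (f e * g))" unfolding sum_distrib_right by (intro sum.cong refl) simp
  also have "\<dots> \<in> elem_ideal n S (card D * (2 * (33 * (3072 * n))))"
    by (intro J_sum[OF n SG fin] J_mult[OF n SG] DJ)
  finally have "1 \<in> elem_ideal n S (card D * (66 * (3072 * n)))" using \<open>g * g = 1\<close> by simp
  then show ?thesis using elem_ideal_mono[OF SG] mult_le_mono1[OF card] by blast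
qed

lemma (in group) normally_generatesI:
  assumes S: "S \<subseteq> carrier G" and ball: "carrier G \<subseteq> conj_ball G S k"
  shows "normally_generates G S"
proof -
  have "carrier G \<subseteq> N" if N: "N \<lhd> G" "S \<subseteq> N" for N
  proof -
    interpret N: normal N G by (rule N(1))
    have sc: "c \<in> N" if "c \<in> sym_conjugates G S" for c
      using that
    proof (rule sym_conjugatesE)
      fix y t assume *: "c = y \<otimes> t \<otimes> inv y" "y \<in> carrier G" "t \<in> S \<union> (\<lambda>s. inv s) ` S"
      have "t \<in> N" using *(3) N(2) by auto
      then show "c \<in> N" using * N.inv_op_closed2 by simp
    qed
    have "g \<in> N" if "g \<in> conj_ball G S k" for g k
      by (rule conj_ball_induct[OF S that]) (auto intro: sc)
    then show ?thesis using ball by blast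
  qed
  moreover have "carrier G \<lhd> G" by (rule normal_invI[OF subgroup_self]) simp
  ultimately have "normal_closure G S = carrier G" using S by (auto simp: normal_closure_def)
  then show ?thesis using S by (simp add: normally_generates_def)
qed

lemma one_mat_SL: "1\<^sub>m n \<in> SL n"
  by (simp add: carrier_SL)

lemma mcong_foldr_one:
  assumes "set cs \<subseteq> SL n" "\<And>c. c \<in> set cs \<Longrightarrow> mcong n m c (1\<^sub>m n)"
  shows "foldr (\<otimes>\<^bsub>SL_int n\<^esub>) cs \<one>\<^bsub>SL_int n\<^esub> \<in> SL n \<and> mcong n m (foldr (\<otimes>\<^bsub>SL_int n\<^esub>) cs \<one>\<^bsub>SL_int n\<^esub>) (1\<^sub>m n)"
  using assms
proof (induction cs)
  case Nil
  then show ?case by (simp add: mcong_refl one_mat_SL)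
next
  case (Cons c cs)
  let ?f = "foldr (\<otimes>\<^bsub>SL_int n\<^esub>) cs \<one>\<^bsub>SL_int n\<^esub>"
  have "?f \<in> SL n \<and> mcong n m ?f (1\<^sub>m n)"
    by (rule Cons.IH) (use Cons.prems in auto)
  then have IH: "?f \<in> SL n" "mcong n m ?f (1\<^sub>m n)" by (rule conjunct1, rule conjunct2)
  have c: "c \<in> SL n" "mcong n m c (1\<^sub>m n)" using Cons.prems by auto
  have "mcong n m (c * ?f) (1\<^sub>m n * 1\<^sub>m n)"
    by (rule mcong_mult[OF SL_mat[OF c(1)] one_carrier_mat SL_mat[OF IH(1)] one_carrier_mat c(2) IH(2)])
  then have "mcong n m (c * ?f) (1\<^sub>m n)" by (simp only: left_mult_one_mat[OF one_carrier_mat])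
  moreover have "foldr (\<otimes>\<^bsub>SL_int n\<^esub>) (c # cs) \<one>\<^bsub>SL_int n\<^esub> = c * ?f" by (simp only: foldr.simps o_apply mult_SL)
  ultimately show ?case using SL_mult[OF c(1) IH(1)] by (simp only: simp_thms)
qed

lemma mcong_sym_conjugate:
  assumes "y \<in> SL n" "t \<in> SL n" "mcong n m t (1\<^sub>m n)"
  shows "mcong n m (y * t * SLinv n y) (1\<^sub>m n)"
proof -
  note one = one_mat_SL[of n]
  have "mcong n m (y * t) (y * 1\<^sub>m n)" using assms one by (intro mcong_mult_left)
  then have "mcong n m (y * t * SLinv n y) (y * 1\<^sub>m n * SLinv n y)"
    using assms one SL_inv SL_mult by (intro mcong_mult_right) auto
  then show ?thesis using SL_inv(3)[OF assms(1)] SL_mat[OF assms(1)] by simp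
qed

lemma large_diameter:
  assumes n: "n \<ge> 3"
  shows "\<exists>S. finite S \<and> normally_generates (SL_int n) S \<and> ereal (real K) \<le> conj_diameter (SL_int n) S"
proof -
  have n0: "0 < n" "1 < n" using n by auto
  \<comment> \<open>One prime more than \<open>K\<close> keeps \<open>P\<close> nonempty for
    \<open>K = 0\<close>.\<close>
  obtain P :: "nat set" where P: "finite P" "card P = Suc K" "P \<subseteq> {p. prime p}"
    using infinite_arbitrarily_large[OF primes_infinite] by blast
  define x where "x p = int (\<Prod>(P - {p}))" for p
  define s where "s p = elem n 0 1 (x p)" for p
  define S where "S = s ` P"
  have SG: "S \<subseteq> SL n" by (auto simp: S_def s_def elem_SL)
  have fin: "finite S" using P by (simp add: S_def)
  have xd: "int q dvd x p" if "q \<in> P" "q \<noteq> p" for p q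
    unfolding x_def int_dvd_int_iff using that P(1) dvd_prodI[of "P - {p}" q id] by simp
  have "\<exists>c. 1 \<in> elem_ideal n S c"
  proof -
    obtain f where f: "\<forall>d\<in>x ` P. (\<Sum>e\<in>x ` P. f e * e) dvd d" using finite_bezout[of "x ` P"] P(1) by blast
    define g where "g = (\<Sum>e\<in>x ` P. f e * e)"
    have xJ: "x p \<in> elem_ideal n S 8" if p: "p \<in> P" for p
    proof -
      have "s p \<in> conj_ball (SL_int n) S 1"
        using p by (intro group.conj_ball_base[OF group_SL_int SG]) (simp add: S_def)
      then show ?thesis using elem_idealI[OF SG n n0, of "x p" 1] by (simp add: s_def)
    qed
    \<comment> \<open>A prime \<open>l'\<close> dividing \<open>x q\<close> for every
      \<open>q\<close> in \<open>P\<close> would belong to \<open>P - {q}\<close> for every such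
      \<open>q\<close>, hence also for \<open>q = l'\<close>.\<close>
    have "is_unit g"
    proof (rule ccontr)
      assume nu: "\<not> is_unit g"
      obtain p where p: "p \<in> P" using P(2) by fastforce
      have xp0: "x q \<noteq> 0" for q using P prime_gt_0_nat by (auto simp: x_def)
      have gd: "g dvd x q" if "q \<in> P" for q using f that by (simp add: g_def)
      have "g \<noteq> 0" using gd[OF p] xp0[of p] by auto
      then obtain l where l: "prime l" "l dvd g" using nu prime_divisor_exists by blast
      define l' where "l' = nat l"
      have l': "prime l'" "int l' = l" using l(1) by (auto simp: l'_def prime_ge_0_int prime_nat_iff_prime)
      have lin: "l' \<in> P - {q}" if q: "q \<in> P" for q
      proof -
        have "int l' dvd int (\<Prod>(P - {q}))" using l(2) gd[OF q] l'(2) dvd_trans by (auto simp: x_def)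
        then have "l' dvd \<Prod>(P - {q})" by (simp only: int_dvd_int_iff)
        then have "\<exists>r\<in>P - {q}. l' dvd r" using prime_dvd_prod_iff[of "P - {q}" l' id] P(1) l'(1) by simp
        then obtain r where r: "r \<in> P - {q}" "l' dvd r" by blast
        then have "l' = r" using P(3) l'(1) primes_dvd_imp_eq by blast
        then show ?thesis using r by simp
      qed
      have "l' \<in> P" using lin[OF p] by simp
      then show False using lin[of l'] by simp
    qed
    then have gg: "g * g = 1" using zdvd1_eq[of g] by (metis abs_mult_self_eq mult_1)
    have "g * g = (\<Sum>e\<in>x ` P. f e * e) * g" by (subst (1) g_def) (rule refl)
  also have "\<dots> = (\<Sum>e\<in>x ` P. e * (f e * g))" unfolding sum_distrib_right by (intro sum.cong refl) simp
    also have "\<dots> \<in> elem_ideal n S (card (x ` P) * (2 * 8))"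
      using P(1) by (intro J_sum[OF n SG] J_mult[OF n SG]) (auto intro: xJ)
    finally show ?thesis using gg by auto
  qed
  then obtain c where c: "1 \<in> elem_ideal n S c" by blast
  obtain D where "SL n \<subseteq> conj_ball (SL_int n) S (2 * c * D)"
    using SL_eq_conj_ball[OF n] SG c by metis
  then have gen: "normally_generates (SL_int n) S"
    using group.normally_generatesI[OF group_SL_int SG] by blast
  have long: "K \<le> length cs" if cs: "set cs \<subseteq> sym_conjugates (SL_int n) S"
    "foldr (\<otimes>\<^bsub>SL_int n\<^esub>) cs \<one>\<^bsub>SL_int n\<^esub> = elem n 0 1 1" for cs
  proof (rule ccontr)
    assume less: "\<not> ?thesis"
    have "\<exists>p\<in>P. \<forall>q\<in>P. q \<noteq> p \<longrightarrow> mcong n (int q) c (1\<^sub>m n)" if c: "c \<in> set cs" for c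
    proof -
      have "c \<in> sym_conjugates (SL_int n) S" using c cs(1) by blast
      then show ?thesis
      proof (rule sym_conjugatesE)
        fix y t assume *: "c = y \<otimes>\<^bsub>SL_int n\<^esub> t \<otimes>\<^bsub>SL_int n\<^esub> SLinv n y" "y \<in> SL n"
          "t \<in> S \<union> (\<lambda>s. SLinv n s) ` S"
        obtain p z where p: "p \<in> P" "t = elem n 0 1 z" "z = x p \<or> z = - x p"
          using *(3) n0 by (auto simp: S_def s_def inv_elem)
        have "mcong n (int q) c (1\<^sub>m n)" if q: "q \<in> P" "q \<noteq> p" for q
        proof -
          have "int q dvd z" using xd[OF q] p(3) by auto
          then have "mcong n (int q) t (1\<^sub>m n)" by (auto simp: p(2) mcong_def elem_index cong_0_iff)
          moreover have "t \<in> SL n" by (simp add: p(2) elem_SL)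
          ultimately show ?thesis using mcong_sym_conjugate[OF *(2)] *(1) by simp
        qed
        then show ?thesis using p(1) by blast
      qed
    qed
    then obtain \<phi> where \<phi>: "\<And>c. c \<in> set cs \<Longrightarrow> \<phi> c \<in> P"
      "\<And>c q. c \<in> set cs \<Longrightarrow> q \<in> P \<Longrightarrow> q \<noteq> \<phi> c \<Longrightarrow> mcong n (int q) c (1\<^sub>m n)" by metis
    have "card (\<phi> ` set cs) \<le> length cs"
      using card_image_le[of "set cs" \<phi>] card_length[of cs] by simp
    then have "card (\<phi> ` set cs) < card P" using less P(2) by simp
    then obtain q where q: "q \<in> P" "q \<notin> \<phi> ` set cs"
      by (metis card_mono finite_imageI finite_set not_less subsetI)
    have "set cs \<subseteq> SL n"
      using cs(1) group.sym_conjugates_closed[OF group_SL_int SG] by blast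
    moreover have "mcong n (int q) c (1\<^sub>m n)" if "c \<in> set cs" for c
      using \<phi>(2)[OF that q(1)] q(2) that by blast
    ultimately have "mcong n (int q) (elem n 0 1 1) (1\<^sub>m n)"
      using mcong_foldr_one[of cs n "int q"] cs(2) by simp
    then have "[elem n 0 1 1 $$ (0,1) = 1\<^sub>m n $$ (0,1)] (mod int q)" using n0 by (simp only: mcong_def)
    then have "int q dvd 1" using n0 by (simp add: elem_index cong_iff_dvd_diff)
    then show False using q(1) P(3) by (auto simp: prime_gt_1_nat)
  qed
  have "ereal (real K) \<le> conj_norm (SL_int n) S (elem n 0 1 1)"
    unfolding conj_norm_def by (rule Inf_greatest) (use long in auto)
  also have "\<dots> \<le> conj_diameter (SL_int n) S"
    unfolding conj_diameter_def by (rule SUP_upper) (simp add: elem_SL)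
  finally show ?thesis using fin gen by blast
qed

theorem theorem1p4:
  fixes n :: nat
  assumes "n \<ge> 3"
  shows "strongly_bounded (SL_int n) \<and> \<not> uniformly_bounded (SL_int n)"
proof
  interpret group "SL_int n" by (rule group_SL_int)
  obtain D where D: "\<And>S c. S \<subseteq> SL n \<Longrightarrow> 1 \<in> elem_ideal n S c \<Longrightarrow>
      SL n \<subseteq> conj_ball (SL_int n) S (2 * c * D)"
    using SL_eq_conj_ball[OF assms] by blast
  have fng: "finitely_normally_generated (SL_int n)"
    using large_diameter[OF assms] group_SL_int by (auto simp: finitely_normally_generated_def)
  have "Delta_upto k (SL_int n) < \<infinity>" for k
  proof -
    define c where "c = k * (n * n) * (66 * (3072 * n))"
    have "Delta_upto k (SL_int n) \<le> ereal (real (2 * c * D))"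
      unfolding Delta_upto_def conj_diameter_def
    proof (intro SUP_least)
      fix S g assume S: "S \<in> {S. finite S \<and> card S \<le> k \<and> normally_generates (SL_int n) S}"
        and g: "g \<in> SL n"
      have SG: "S \<subseteq> SL n" using S by (simp add: normally_generates_def)
      have "card S * (n * n) * (66 * (3072 * n)) \<le> c" unfolding c_def using S by simp
      then have "1 \<in> elem_ideal n S c"
        using elem_ideal_mono[OF SG normally_generates_unit_ideal[OF assms]] S by blast
      then have "g \<in> conj_ball (SL_int n) S (2 * c * D)" using D[OF SG] g by blast
      then show "conj_norm (SL_int n) S g \<le> ereal (real (2 * c * D))" by (rule conj_norm_le[OF SG])
    qed
    also have "\<dots> < \<infinity>" by simp
    finally show ?thesis .
  qed
  then show "strongly_bounded (SL_int n)" using fng by (simp add: strongly_bounded_def)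
  show "\<not> uniformly_bounded (SL_int n)"
  proof
    assume "uniformly_bounded (SL_int n)"
    then have "Delta (SL_int n) \<noteq> \<infinity>" by (auto simp: uniformly_bounded_def)
    then obtain K :: nat where K: "Delta (SL_int n) < ereal (real K)"
      unfolding less_PInf_Ex_of_nat ..
    have le: "ereal (real K) \<le> Delta (SL_int n)" for K
    proof -
      obtain S where S: "finite S" "normally_generates (SL_int n) S" "ereal (real K) \<le> conj_diameter (SL_int n) S"
        using large_diameter[OF assms] by blast
      have "conj_diameter (SL_int n) S \<le> Delta (SL_int n)"
        unfolding Delta_def by (rule SUP_upper) (use S in simp)
      then show ?thesis using S(3) by (rule order_trans[rotated])
    qed
    show False using le[of K] K by simp
  qed
qed

end
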